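(* Let $n\geq 4$ and $k\geq 4$ be integers with $k\neq\frac{2n+1}{3}$. Then $\mathcal{D}_k(\vec{C}_{2n+1}\langle n\rangle)$ is connected and has diameter at most $4n+2+\lfloor\frac n2\rfloor$.
   Context: For $n\ge2$, $\vec{C}_{2n+1}\langle n\rangle$ is the tournament with vertex set $\mathbb{Z}_{2n+1}$ and arcs $(a,a+j)$ for all $a\in\mathbb{Z}_{2n+1}$, $j\in\{1,\dots,n-1\}$, together with arcs $(a,a-n)$ for all $a\in\mathbb{Z}_{2n+1}$. A $k$-coloring of a digraph $D$ is a function $\alpha\colon V(D)\to\{1,\dots,k\}$ such that every color class $\{x:\alpha(x)=i\}$ (possibly empty) induces an acyclic subdigraph. The $k$-dicoloring graph $\mathcal{D}_k(D)$ has the $k$-colorings of $D$ as vertices, two being adjacent iff they differ on exactly one vertex. *)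

theory Defs
  imports "Graph_Theory.Graph_Theory" "HOL-Library.FuncSet"
begin

text \<open>
  Elements of \<open>\<int>/(2n+1)\<close> are represented by their least nonnegative residues, as integers so
  that subtraction does not truncate.
\<close>

definition circ_tournament :: "nat \<Rightarrow> (int, int \<times> int) pre_digraph" where
  "circ_tournament n = with_proj
    \<lparr> pverts = {0..<2 * int n + 1},
      parcs = {(a, (a + j) mod (2 * int n + 1)) | a j. a \<in> {0..<2 * int n + 1} \<and> j \<in> {1..int n - 1}}
            \<union> {(a, (a - int n) mod (2 * int n + 1)) | a. a \<in> {0..<2 * int n + 1}} \<rparr>"

definition acyclic_digraph :: "('a, 'b) pre_digraph \<Rightarrow> bool" where
  "acyclic_digraph D \<longleftrightarrow> \<not> (\<exists>p. pre_digraph.cycle D p)"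

text \<open>
  Colorings are extensional functions, so that two colorings are equal as soon as they agree on
  the vertices.
\<close>

definition dicolorings :: "nat \<Rightarrow> ('a, 'b) pre_digraph \<Rightarrow> ('a \<Rightarrow> nat) set" where
  "dicolorings k D = {\<alpha> \<in> verts D \<rightarrow>\<^sub>E {1..k}.
     \<forall>i\<in>{1..k}. acyclic_digraph (D \<restriction> {x \<in> verts D. \<alpha> x = i})}"

text \<open>The undirected dicoloring graph, as a symmetric digraph.\<close>

definition dicoloring_graph ::
  "nat \<Rightarrow> ('a, 'b) pre_digraph \<Rightarrow> ('a \<Rightarrow> nat, ('a \<Rightarrow> nat) \<times> ('a \<Rightarrow> nat)) pre_digraph" where
  "dicoloring_graph k D = with_proj
    \<lparr> pverts = dicolorings k D,
      parcs = {(\<alpha>, \<beta>). \<alpha> \<in> dicolorings k D \<and> \<beta> \<in> dicolorings k D \<and>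
                       (\<exists>!x. x \<in> verts D \<and> \<alpha> x \<noteq> \<beta> x)} \<rparr>"

text \<open>
  With unit weights, \<open>\<mu>\<close> is the number of arcs of a shortest walk, and \<open>\<infinity>\<close> if there is none.
  The definition is only meaningful for well-formed digraphs with at least one vertex.
\<close>

definition diameter :: "('a, 'b) pre_digraph \<Rightarrow> ereal" where
  "diameter G = (SUP u\<in>verts G. SUP v\<in>verts G. wf_digraph.\<mu> G (\<lambda>_. 1) u v)"

lemma digraph_circ_tournament:
  assumes "n \<ge> 2"
  shows "digraph (circ_tournament n)"
proof -
  let ?N = "2 * int n + 1"
  let ?P = "{0..<?N}"
  have bound: "x mod ?N \<le> 2 * int n" for x
    using pos_mod_bound[of ?N x] by simp
  have fin: "finite (arcs (circ_tournament n))"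
    by (rule finite_subset[of _ "?P \<times> ?P"]) (auto simp: circ_tournament_def bound)
  have loop1: "(a + j) mod ?N \<noteq> a" if "0 < j" "j < ?N" for a j :: int
  proof
    assume "(a + j) mod ?N = a"
    then have "(a + j) mod ?N = a mod ?N"
      by (metis mod_mod_trivial)
    then have "?N dvd j"
      by (simp add: mod_eq_dvd_iff)
    with that show False
      using zdvd_imp_le by fastforce
  qed
  have loop2: "(a - int n) mod ?N \<noteq> a" for a
    using loop1[of "int n + 1" a] assms mod_add_self2[of "a - int n" ?N]
    by (simp add: algebra_simps)
  show ?thesis
  proof (unfold_locales)
    fix e assume "e \<in> arcs (circ_tournament n)"
    then show "tail (circ_tournament n) e \<noteq> head (circ_tournament n) e"
      using loop1[THEN not_sym] loop2[THEN not_sym] by (auto simp: circ_tournament_def)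
  qed (use fin in \<open>auto simp: circ_tournament_def arc_to_ends_def bound\<close>)
qed

lemma dicoloring_graph_wf: "wf_digraph (dicoloring_graph k D)"
  by unfold_locales (auto simp: dicoloring_graph_def)

lemma dicoloring_graph_symmetric: "symmetric (dicoloring_graph k D)"
  by (simp add: dicoloring_graph_def symmetric_def sym_def) (simp add: eq_commute)

lemma diameter_le_iff:
  assumes "wf_digraph G"
  shows "diameter G \<le> ereal (real N) \<longleftrightarrow>
    (\<forall>u\<in>verts G. \<forall>v\<in>verts G. \<exists>p. pre_digraph.awalk G u p v \<and> length p \<le> N)"
proof -
  interpret wf_digraph G by fact
  have cost: "awalk_cost (\<lambda>_. 1) p = real (length p)" for p :: "'b list"
    by (induction p) auto
  have "\<mu> (\<lambda>_. 1) u v \<le> ereal (real N) \<longleftrightarrow> (\<exists>p. awalk u p v \<and> length p \<le> N)" for u v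
  proof
    assume "\<mu> (\<lambda>_. 1) u v \<le> ereal (real N)"
    then have "\<mu> (\<lambda>_. 1) u v < ereal (real (Suc N))"
      by (rule le_less_trans) simp
    then show "\<exists>p. awalk u p v \<and> length p \<le> N"
      unfolding \<mu>_def INF_less_iff cost by auto
  next
    assume "\<exists>p. awalk u p v \<and> length p \<le> N"
    then show "\<mu> (\<lambda>_. 1) u v \<le> ereal (real N)"
      unfolding \<mu>_def cost by (auto intro: INF_lower2)
  qed
  then show ?thesis
    by (simp add: diameter_def SUP_le_iff)
qed

end

theory Submission
  imports Defs
begin

text \<open>
  Write \<open>N = 2n + 1\<close>. If a class \<open>b\<close> of a coloring \<open>f\<close> lies in \<open>n\<close> consecutive residues, then \<open>b\<close> can be
  extended to this whole arc, after which the other \<open>n + 1\<close> residues can be recolored almost freely; this takes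
  \<open>N - |b|\<close> steps. Doing the same with a class \<open>c\<close> of \<open>g\<close> in an arc of \<open>n\<close> residues, one can arrange the two
  resulting colorings to agree outside the overlap of the arcs. This gives a path from \<open>f\<close> to \<open>g\<close> of length at
  most \<open>2 N + max 1 |overlap| - |b| - |c|\<close> unless \<open>b \<noteq> c\<close> share the same arc.

  An acyclic class that lies in no such arc is either \<open>{p, p + n}\<close> together with some of
  \<open>p + n + 2, \<dots>, p + 2n - 1\<close>, or a triple \<open>{q, q + n, q + n + 1}\<close>. Unless all classes are triples, which
  forces \<open>3 k = N\<close>, few steps lead from \<open>f\<close> to a coloring with a class in an arc. An empty class may be taken to
  lie in any arc. If no class is empty and \<open>f\<close> reaches a class in an arc that is larger than the number of steps
  spent, then the position of this arc is fixed, and one shows that \<open>g\<close> reaches one whose cost plus overlap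
  exceeds its size by at most \<open>n div 2 + 1\<close>. If this fails for both \<open>f\<close> and \<open>g\<close>, then both have two classes
  that one step makes singletons, and singletons of different colors lie in arcs that overlap in at most one
  residue.
\<close>

text \<open>The arcs of the tournament have the gaps \<open>1, ..., n - 1\<close> and
  \<open>n + 1\<close>, so a triangle inside \<open>n + 1\<close> consecutive residues must use both
  ends of that interval. This is why the complement of an arc can be recolored at one step per
  residue once its two ends are kept apart; \<open>k \<ge> 4\<close> supplies a color for an end
  that avoids three prescribed ones. The term \<open>2 N\<close> counts every vertex twice, once on
  the way from each coloring to an intermediate one. The obstacle is a class of the other coloring
  that sits in the arc already taken, or mostly inside it. The additive \<open>n div 2\<close> is
  the price of the worst short class: two consecutive residues in the middle of
  \<open>{1..n}\<close>, since every arc around them meets about half of \<open>{1..n}\<close>. That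
  nothing worse happens is shown by contradiction. The classes are sorted by the part of
  \<open>{1..n}\<close> that they can absorb. Whenever one or two classes can absorb everything that
  a third has in \<open>{1..n}\<close>, the third can be moved out of this arc cheaply. Confronting
  the possible positions in this way leaves only triples.\<close>

locale circ_params =
  fixes n :: int and k :: nat
  assumes n4: "4 \<le> n" and k4: "4 \<le> k"
begin

abbreviation N :: int where "N \<equiv> 2 * n + 1"
abbreviation h :: int where "h \<equiv> n div 2"

section \<open>Colorings as periodic functions\<close>

text \<open>Colorings are represented by \<open>N\<close>-periodic functions on the integers, and a vertex set of the
  tournament is acyclic iff it contains no directed triangle; \<open>tri\<close> lists the vertices of such a triangle
  in increasing order.\<close>

definition tri :: "int \<Rightarrow> int \<Rightarrow> int \<Rightarrow> bool" where
  "tri x y z \<longleftrightarrow> x < y \<and> y < z \<and> z < x + N \<and> y - x \<le> n + 1 \<and> y - x \<noteq> n \<and>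
     z - y \<le> n + 1 \<and> z - y \<noteq> n \<and> x + N - z \<le> n + 1 \<and> x + N - z \<noteq> n"

definition acy :: "(int \<Rightarrow> bool) \<Rightarrow> bool" where
  "acy P \<longleftrightarrow> (\<forall>x y z. tri x y z \<longrightarrow> \<not> (P x \<and> P y \<and> P z))"

definition per :: "(int \<Rightarrow> 'b) \<Rightarrow> bool" where
  "per f \<longleftrightarrow> (\<forall>x. f (x + N) = f x)"

definition col :: "(int \<Rightarrow> nat) \<Rightarrow> bool" where
  "col f \<longleftrightarrow> per f \<and> (\<forall>x. f x \<in> {1..k}) \<and> (\<forall>c. acy (\<lambda>x. f x = c))"

lemma acy_mono: "acy P \<Longrightarrow> (\<And>x. Q x \<Longrightarrow> P x) \<Longrightarrow> acy Q"
  unfolding acy_def by blast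

lemma per_mult: "per f \<Longrightarrow> f (x + N * j) = f x"
proof (induction j arbitrary: x rule: int_induct[where k = 0])
  case (step1 i)
  then show ?case
    unfolding per_def by (metis (no_types, opaque_lifting) add.assoc distrib_left mult.right_neutral)
next
  case (step2 i)
  have "f (x + N * (i - 1)) = f (x + N * (i - 1) + N)"
    using step2.prems unfolding per_def by simp
  also have "x + N * (i - 1) + N = x + N * i"
    by (simp add: algebra_simps)
  finally show ?case
    using step2 by simp
qed simp

lemma per_mod: "per f \<Longrightarrow> f (x mod N) = f x"
  using per_mult[of f "x mod N" "x div N"] by (simp add: add.commute)

lemma per_cong: "per f \<Longrightarrow> x mod N = y mod N \<Longrightarrow> f x = f y"
  by (metis per_mod)

lemma per_shift: "per f \<Longrightarrow> f (x - N) = f x"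
  using per_mult[of f x "-1"] by (simp add: algebra_simps)

lemma per_plus: "per f \<Longrightarrow> f (x + N) = f x"
  unfolding per_def by simp

lemma Npos: "N > 0"
  using n4 by simp

lemma window_rep:
  obtains j where "a \<le> x + N * j" "x + N * j < a + N"
proof -
  have "x + N * (- ((x - a) div N)) = a + (x - a) mod N"
    using div_mult_mod_eq[of "x - a" N] by (simp add: algebra_simps)
  then show thesis
    using that[of "- ((x - a) div N)"] Npos pos_mod_sign[of N "x - a"] pos_mod_bound[of N "x - a"]
    by simp
qed

lemma tri_shift: "tri (x + d) (y + d) (z + d) \<longleftrightarrow> tri x y z"
  unfolding tri_def by (auto simp: algebra_simps)

lemma acy_window:
  assumes P: "per P" and a: "\<And>x y z. a \<le> x \<Longrightarrow> x < a + N \<Longrightarrow> tri x y z \<Longrightarrow> P x \<Longrightarrow> P y \<Longrightarrow> P z \<Longrightarrow> False"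
  shows "acy P"
  unfolding acy_def
proof (intro allI impI notI)
  fix x y z assume t: "tri x y z" and p: "P x \<and> P y \<and> P z"
  obtain j where j: "a \<le> x + N * j" "x + N * j < a + N" by (rule window_rep)
  show False
    by (rule a[OF j, of "y + N * j" "z + N * j"]) (use t p per_mult[OF P] tri_shift in auto)
qed

text \<open>Three of \<open>n\<close> consecutive residues leave a cyclic gap of at least
  \<open>n + 2\<close>, whereas the gaps of a triangle are at most \<open>n + 1\<close>.\<close>

lemma arc_acy:
  assumes P: "per P" and e: "\<And>x. e < x \<Longrightarrow> x < e + n + 2 \<Longrightarrow> \<not> P x"
  shows "acy P"
proof (rule acy_window[OF P, of "e - n + 1"])
  fix x y z assume *: "e - n + 1 \<le> x" "x < e - n + 1 + N" "tri x y z" "P x" "P y" "P z"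
  have e2: "\<not> P w" if "e + N < w" "w < e + N + n + 2" for w
    using e[of "w - N"] per_shift[OF P] that by auto
  have "x \<le> e" using * e[of x] by force
  moreover have "y \<le> e \<or> e + n + 2 \<le> y" "z \<le> e \<or> e + n + 2 \<le> z"
    using * e[of y] e[of z] by force+
  ultimately show False using * n4 unfolding tri_def by linarith
qed

text \<open>All residues other than \<open>p\<close> lie in the arc from \<open>p + n\<close> to
  \<open>p + 2 * n - 1\<close>, and each of them beats \<open>p\<close>: \<open>p + n\<close> by the
  gap \<open>n + 1\<close>, the others by a gap between \<open>2\<close> and \<open>n - 1\<close>.
  So \<open>p\<close> is a sink and lies in no triangle.\<close>

lemma J_acy:
  assumes P: "per P" and p: "\<And>x. p < x \<Longrightarrow> x < p + N \<Longrightarrow> P x \<Longrightarrow> x = p + n \<or> p + n + 2 \<le> x \<and> x \<le> p + 2 * n - 1"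
  shows "acy P"
proof (rule acy_window[OF P, of p])
  fix x y z assume *: "p \<le> x" "x < p + N" "tri x y z" "P x" "P y" "P z"
  have p2: "w = p + n + N \<or> p + N + n + 2 \<le> w \<and> w \<le> p + N + 2 * n - 1"
    if "p + N < w" "w < p + N + N" "P w" for w
    using p[of "w - N"] per_shift[OF P] that by auto
  have x: "x = p \<or> x = p + n \<or> p + n + 2 \<le> x \<and> x \<le> p + 2 * n - 1"
    using *(1,2,4) p[of x] by force
  have y: "y = p + n \<or> p + n + 2 \<le> y \<and> y \<le> p + 2 * n - 1 \<or> y = p + N \<or>
      y = p + n + N \<or> p + N + n + 2 \<le> y"
    using * p[of y] p2[of y] unfolding tri_def by force
  have z: "z = p + n \<or> p + n + 2 \<le> z \<and> z \<le> p + 2 * n - 1 \<or> z = p + N \<or>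
      z = p + n + N \<or> p + N + n + 2 \<le> z"
    using * p[of z] p2[of z] unfolding tri_def by force
  from x y z *(3) n4 show False
    unfolding tri_def by (elim disjE conjE) linarith+
qed

section \<open>Recoloring steps and paths\<close>

definition adj :: "(int \<Rightarrow> nat) \<Rightarrow> (int \<Rightarrow> nat) \<Rightarrow> bool" where
  "adj f g \<longleftrightarrow> col f \<and> col g \<and> (\<exists>x. f x \<noteq> g x \<and> (\<forall>y. f y \<noteq> g y \<longrightarrow> N dvd y - x))"

text \<open>The bound is an integer because later bounds contain subtracted class sizes.\<close>

definition reach :: "(int \<Rightarrow> nat) \<Rightarrow> (int \<Rightarrow> nat) \<Rightarrow> int \<Rightarrow> bool" where
  "reach f g s \<longleftrightarrow> col f \<and> (\<exists>i. int i \<le> s \<and> (adj ^^ i) f g)"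

lemma col_per: "col f \<Longrightarrow> per f"
  unfolding col_def by simp

lemma col_acy: "col f \<Longrightarrow> acy (\<lambda>x. f x = c)"
  unfolding col_def by simp

lemma adj_sym: "adj f g \<Longrightarrow> adj g f"
  unfolding adj_def by metis

lemma adj_col: "adj f g \<Longrightarrow> col f \<and> col g"
  unfolding adj_def by simp

lemma adj_pow_col: "(adj ^^ i) f g \<Longrightarrow> col f \<Longrightarrow> col g"
  by (induction i arbitrary: g) (auto dest: adj_col)

lemma reach_col: "reach f g s \<Longrightarrow> col f" "reach f g s \<Longrightarrow> col g"
  unfolding reach_def using adj_pow_col by auto

lemma reach_refl: "col f \<Longrightarrow> 0 \<le> s \<Longrightarrow> reach f f s"
  unfolding reach_def by (auto intro!: exI[of _ 0])

lemma reach_mono: "reach f g s \<Longrightarrow> s \<le> t \<Longrightarrow> reach f g t"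
  unfolding reach_def by force

lemma reach_trans:
  assumes "reach f g s" "reach g u t"
  shows "reach f u (s + t)"
proof -
  obtain i j where "int i \<le> s" "(adj ^^ i) f g" "int j \<le> t" "(adj ^^ j) g u"
    using assms unfolding reach_def by auto
  then have "(adj ^^ (i + j)) f u" "int (i + j) \<le> s + t"
    unfolding relpowp_add by auto
  then show ?thesis
    using assms(1) unfolding reach_def by blast
qed

lemma adj_pow_sym: "(adj ^^ i) f g \<Longrightarrow> (adj ^^ i) g f"
proof (induction i arbitrary: g)
  case (Suc i)
  then obtain u where "(adj ^^ i) f u" "adj u g" by auto
  then show ?case
    using Suc.IH adj_sym relpowp_Suc_I2 by metis
qed auto

lemma reach_sym: "reach f g s \<Longrightarrow> reach g f s"
  using adj_pow_sym reach_col(2) unfolding reach_def by blast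

lemma adj_reach: "adj f g \<Longrightarrow> reach f g 1"
  unfolding reach_def using adj_col by (auto intro!: exI[of _ 1])

definition upd :: "(int \<Rightarrow> nat) \<Rightarrow> int \<Rightarrow> nat \<Rightarrow> int \<Rightarrow> nat" where
  "upd f x c y = (if N dvd y - x then c else f y)"

lemma upd_per:
  assumes "per f"
  shows "per (upd f x c)"
proof -
  have "N dvd y + N - x \<longleftrightarrow> N dvd y - x" for y
  proof -
    have "y + N - x = N + (y - x)" by simp
    then show ?thesis by (metis dvd_add_right_iff dvd_refl)
  qed
  then show ?thesis using assms unfolding per_def upd_def by presburger
qed

lemma dvd_per: "per f \<Longrightarrow> N dvd y - x \<Longrightarrow> f y = f x"
  by (rule per_cong) (simp_all only: mod_eq_dvd_iff)

lemma upd_cases: "upd f x c y = f y \<or> upd f x c y = c"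
  unfolding upd_def by simp

lemma upd_same: "upd f x c x = c"
  unfolding upd_def by simp

lemma dvd_window:
  assumes d: "N dvd y - x" and y: "a \<le> y" "y < a + N" and x: "a \<le> x" "x < a + N"
  shows "y = x"
proof (rule ccontr)
  assume "y \<noteq> x"
  then have "\<bar>N\<bar> \<le> \<bar>y - x\<bar>" using d dvd_imp_le_int[of "y - x" N] by simp
  then show False using y x by linarith
qed

lemma upd_window: "a \<le> y \<Longrightarrow> y < a + N \<Longrightarrow> a \<le> x \<Longrightarrow> x < a + N \<Longrightarrow> upd f x c y = (if y = x then c else f y)"
  unfolding upd_def using dvd_window[of y x a] by auto

text \<open>Every intermediate class lies in the union of its old and its new version, so the
  vertices can be recolored one at a time in any order. Longer paths are concatenations of such
  blocks.\<close>

lemma compat_reach: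
  assumes "col f" "col g" "\<And>c. acy (\<lambda>x. f x = c \<or> g x = c)"
    and "int (card {x \<in> {a..<a + N}. f x \<noteq> g x}) \<le> s"
  shows "reach f g s"
  using assms
proof (induction "card {x \<in> {a..<a + N}. f x \<noteq> g x}" arbitrary: f s)
  case 0
  have "finite {x \<in> {a..<a + N}. f x \<noteq> g x}" by (rule finite_subset[of _ "{a..<a + N}"]) auto
  then have E: "{x \<in> {a..<a + N}. f x \<noteq> g x} = {}" using 0(1) card_0_eq by metis
  have "f x = g x" for x
  proof -
    obtain j where "a \<le> x + N * j" "x + N * j < a + N" by (rule window_rep)
    then have "f (x + N * j) = g (x + N * j)" using E by auto
    then show ?thesis using per_mult 0(2,3) col_per by metis
  qed
  then have "f = g" by auto
  then show ?case using 0 by (auto intro: reach_refl)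
next
  case (Suc i)
  let ?D = "\<lambda>f. {x \<in> {a..<a + N}. f x \<noteq> g x}"
  obtain x where x: "x \<in> ?D f" using Suc(2) by (metis card.empty ex_in_conv nat.distinct(1))
  define u where "u = upd f x (g x)"
  have pf: "per f" and pg: "per g" using Suc(3,4) col_per by auto
  have bet: "u y = f y \<or> u y = g y" for y
    unfolding u_def upd_def using dvd_per[OF pg, of y x] by presburger
  have "per u" unfolding u_def by (rule upd_per[OF pf])
  moreover have "acy (\<lambda>y. u y = c)" for c
  proof (rule acy_mono[OF Suc(5)[of c]])
    show "u y = c \<Longrightarrow> f y = c \<or> g y = c" for y using bet[of y] by metis
  qed
  moreover have "u y \<in> {1..k}" for y using bet[of y] Suc(3,4) unfolding col_def by metis
  ultimately have cu: "col u" unfolding col_def by auto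
  have "f x \<noteq> u x" using x unfolding u_def upd_same by simp
  moreover have "N dvd y - x" if "f y \<noteq> u y" for y using that unfolding u_def upd_def by presburger
  ultimately have af: "adj f u" unfolding adj_def using Suc(3) cu by blast
  have "?D u = ?D f - {x}"
  proof (rule set_eqI)
    fix y
    show "y \<in> ?D u \<longleftrightarrow> y \<in> ?D f - {x}"
      using upd_window[of a y x f "g x"] x unfolding u_def by (cases "y = x") auto
  qed
  then have cd: "card (?D u) = i" using Suc(2) x by simp
  have "reach u g (s - 1)"
  proof (rule Suc(1)[OF cd[symmetric] cu Suc(4)])
    show "acy (\<lambda>y. u y = c \<or> g y = c)" for c
    proof (rule acy_mono[OF Suc(5)[of c]])
      show "u y = c \<or> g y = c \<Longrightarrow> f y = c \<or> g y = c" for y using bet[of y] by metis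
    qed
    show "int (card (?D u)) \<le> s - 1" using Suc(2,6) cd by linarith
  qed
  from reach_trans[OF adj_reach[OF af] this] show ?case by simp
qed


section \<open>Recoloring through arcs\<close>

definition cnt :: "(int \<Rightarrow> nat) \<Rightarrow> nat \<Rightarrow> int" where
  "cnt f c = int (card {x \<in> {0..<N}. f x = c})"

lemma mod_N: "0 \<le> x mod N" "x mod N \<le> 2 * n" "x mod N < N"
  using Npos pos_mod_sign[of N x] pos_mod_bound[of N x] by simp_all

lemma card_window:
  assumes P: "per P"
  shows "card {x \<in> {a..<a + N}. P x} = card {x \<in> {0..<N}. P x}"
proof -
  have m: "(a + (x - a) mod N) mod N = x mod N" for x
    by (metis add_diff_cancel_left' diff_add_cancel mod_add_right_eq add.commute)
  have P1: "P (a + (x - a) mod N) = P x" for x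
    by (rule per_cong[OF P m])
  have "bij_betw (\<lambda>x. x mod N) {x \<in> {a..<a + N}. P x} {x \<in> {0..<N}. P x}"
  proof (rule bij_betw_byWitness[where f' = "\<lambda>x. a + (x - a) mod N"])
    show "\<forall>x\<in>{x \<in> {a..<a + N}. P x}. a + (x mod N - a) mod N = x"
      by (auto simp: mod_diff_left_eq mod_pos_pos_trivial)
    show "\<forall>x\<in>{x \<in> {0..<N}. P x}. (a + (x - a) mod N) mod N = x"
      using m by auto
    show "(\<lambda>x. x mod N) ` {x \<in> {a..<a + N}. P x} \<subseteq> {x \<in> {0..<N}. P x}"
      using per_mod[OF P] mod_N by auto
    show "(\<lambda>x. a + (x - a) mod N) ` {x \<in> {0..<N}. P x} \<subseteq> {x \<in> {a..<a + N}. P x}"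
      using P1 mod_N by auto
  qed
  then show ?thesis by (rule bij_betw_same_card)
qed

lemma per_eq: "per f \<Longrightarrow> per (\<lambda>x. f x = c)"
  unfolding per_def by simp

lemma per_or: "per f \<Longrightarrow> per g \<Longrightarrow> per (\<lambda>x. f x = c \<or> g x = c)"
  unfolding per_def by simp

lemma cnt_window: "per f \<Longrightarrow> cnt f c = int (card {x \<in> {a..<a + N}. f x = c})"
  unfolding cnt_def using card_window[of "\<lambda>x. f x = c" a] per_eq[of f c] by (simp only:)

lemma cnt_nonneg: "0 \<le> cnt f c"
  unfolding cnt_def by simp

lemma cnt_pos:
  assumes "per f" "f x = c"
  shows "1 \<le> cnt f c"
proof -
  have "x \<in> {x..<x + N}" using n4 by auto
  then have "{y \<in> {x..<x + N}. f y = c} \<noteq> {}" using assms by blast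
  moreover have "finite {y \<in> {x..<x + N}. f y = c}" by (rule finite_subset[of _ "{x..<x + N}"]) auto
  ultimately have "card {y \<in> {x..<x + N}. f y = c} \<noteq> 0" using card_0_eq by blast
  then show ?thesis using cnt_window[OF assms(1), of c x] by linarith
qed

lemma per_shiftf: "per f \<Longrightarrow> per (\<lambda>x. f (x + a))"
  unfolding per_def by (metis add.assoc add.commute)

lemma per_refl: "per f \<Longrightarrow> per (\<lambda>x. f (a - x))"
proof -
  assume p: "per f"
  have "f (a - (x + N)) = f (a - x)" for x
    using per_shift[OF p, of "a - x"] by (simp add: algebra_simps)
  then show ?thesis unfolding per_def by blast
qed

lemma acy_shift: "acy P \<Longrightarrow> acy (\<lambda>x. P (x + a))"
  unfolding acy_def using tri_shift by blast

text \<open>A reflection reverses all arcs, and a reversed triangle is a triangle again. This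
  provides the mirror images of later lemmas.\<close>

lemma tri_refl: "tri x y z \<Longrightarrow> tri (a - z) (a - y) (a - x)"
  unfolding tri_def by auto

lemma acy_refl: "acy P \<Longrightarrow> acy (\<lambda>x. P (a - x))"
  unfolding acy_def using tri_refl by blast

lemma col_shift: "col f \<Longrightarrow> col (\<lambda>x. f (x + a))"
  unfolding col_def using per_shiftf acy_shift[of "\<lambda>x. f x = _"] by auto

lemma col_refl: "col f \<Longrightarrow> col (\<lambda>x. f (a - x))"
  unfolding col_def using per_refl acy_refl[of "\<lambda>x. f x = _"] by auto

lemma adj_shift:
  assumes "adj f g"
  shows "adj (\<lambda>x. f (x + a)) (\<lambda>x. g (x + a))"
proof -
  obtain x where x: "f x \<noteq> g x" "\<And>y. f y \<noteq> g y \<Longrightarrow> N dvd y - x"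
    using assms unfolding adj_def by blast
  have "f (x - a + a) \<noteq> g (x - a + a)" using x by simp
  moreover have "N dvd y - (x - a)" if "f (y + a) \<noteq> g (y + a)" for y
    using x(2)[OF that] by (simp add: algebra_simps)
  ultimately show ?thesis using assms col_shift unfolding adj_def by blast
qed

lemma adj_refl:
  assumes "adj f g"
  shows "adj (\<lambda>x. f (a - x)) (\<lambda>x. g (a - x))"
proof -
  obtain x where x: "f x \<noteq> g x" "\<And>y. f y \<noteq> g y \<Longrightarrow> N dvd y - x"
    using assms unfolding adj_def by blast
  have "f (a - (a - x)) \<noteq> g (a - (a - x))" using x by simp
  moreover have "N dvd y - (a - x)" if "f (a - y) \<noteq> g (a - y)" for y
  proof -
    have "N dvd - (a - y - x)" using x(2)[OF that] by (subst dvd_minus_iff)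
    then show ?thesis by (simp add: algebra_simps)
  qed
  ultimately show ?thesis using assms col_refl unfolding adj_def by blast
qed

lemma adj_pow_map:
  assumes "\<And>f g. adj f g \<Longrightarrow> adj (\<lambda>x. f (t x)) (\<lambda>x. g (t x))"
  shows "(adj ^^ i) f g \<Longrightarrow> (adj ^^ i) (\<lambda>x. f (t x)) (\<lambda>x. g (t x))"
proof (induction i arbitrary: g)
  case (Suc i)
  then show ?case using assms by (auto intro!: relcomppI)
qed auto

lemma reach_shift: "reach f g s \<Longrightarrow> reach (\<lambda>x. f (x + a)) (\<lambda>x. g (x + a)) s"
  unfolding reach_def using adj_pow_map[of "\<lambda>x. x + a"] adj_shift col_shift by blast

lemma reach_refl_map: "reach f g s \<Longrightarrow> reach (\<lambda>x. f (a - x)) (\<lambda>x. g (a - x)) s"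
  unfolding reach_def using adj_pow_map[of "\<lambda>x. a - x"] adj_refl col_refl by blast

lemma cnt_shift:
  assumes "per f"
  shows "cnt (\<lambda>x. f (x + a)) c = cnt f c"
proof -
  have "bij_betw (\<lambda>x. x + a) {x \<in> {0..<N}. f (x + a) = c} {x \<in> {a..<a + N}. f x = c}"
    by (rule bij_betw_byWitness[where f' = "\<lambda>x. x - a"]) auto
  then show ?thesis using cnt_window[OF assms, of c a] bij_betw_same_card unfolding cnt_def by fastforce
qed

lemma cnt_refl:
  assumes "per f"
  shows "cnt (\<lambda>x. f (a - x)) c = cnt f c"
proof -
  have "bij_betw (\<lambda>x. a - x) {x \<in> {0..<N}. f (a - x) = c} {x \<in> {a - 2 * n..<a - 2 * n + N}. f x = c}"
    by (rule bij_betw_byWitness[where f' = "\<lambda>x. a - x"]) auto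
  then show ?thesis using cnt_window[OF assms, of c "a - 2 * n"] bij_betw_same_card unfolding cnt_def by fastforce
qed

section \<open>Filling an arc and recoloring its complement\<close>

lemma arc_acy_w:
  assumes P: "per P" and "a \<le> l" "u \<le> l + n - 1" "l \<le> a + N"
    and w: "\<And>x. a \<le> x \<Longrightarrow> x < a + N \<Longrightarrow> P x \<Longrightarrow> l \<le> x \<and> x \<le> u"
  shows "acy P"
proof (rule arc_acy[OF P])
  fix x assume x: "l + n - 1 < x" "x < l + n - 1 + n + 2"
  show "\<not> P x"
  proof
    assume px: "P x"
    then have "P (x - N)" using per_shift[OF P, of x] by simp
    then show False using x assms(2-4) px w[of x] w[of "x - N"] n4 by (cases "x < a + N") linarith+
  qed
qed

lemma recolor:
  assumes f: "col f" and g: "per g" and r: "\<And>x. g x \<in> {1..k}"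
    and ac: "\<And>c. acy (\<lambda>x. f x = c \<or> g x = c)"
    and s: "int (card {x \<in> {a..<a + N}. f x \<noteq> g x}) \<le> s"
  shows "reach f g s"
proof (rule compat_reach[OF f _ ac s])
  have "acy (\<lambda>x. g x = c)" for c by (rule acy_mono[OF ac[of c]]) simp
  then show "col g" unfolding col_def using g r by blast
qed

lemma acy_keep: "col f \<Longrightarrow> (\<And>x. g x = c \<Longrightarrow> f x = c) \<Longrightarrow> acy (\<lambda>x. f x = c \<or> g x = c)"
  by (rule acy_mono[OF col_acy[of f c]]) auto

lemma move:
  assumes f: "col f" and c: "c \<in> {1..k}" and ac: "acy (\<lambda>y. f y = c \<or> N dvd y - x)"
  shows "reach f (upd f x c) 1"
proof (rule recolor[OF f upd_per[OF col_per[OF f]]])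
  show "upd f x c y \<in> {1..k}" for y using c f unfolding upd_def col_def by auto
  show "acy (\<lambda>y. f y = d \<or> upd f x c y = d)" for d
  proof (cases "d = c")
    case True
    then show ?thesis by (auto intro: acy_mono[OF ac] simp: upd_def split: if_splits)
  next
    case False
    then show ?thesis by (intro acy_keep[OF f]) (auto simp: upd_def split: if_splits)
  qed
  have "{y \<in> {x..<x + N}. f y \<noteq> upd f x c y} \<subseteq> {x}"
    using upd_window[of x _ x f c] by (auto split: if_splits)
  then show "int (card {y \<in> {x..<x + N}. f y \<noteq> upd f x c y}) \<le> 1"
    using card_mono[of "{x}"] by fastforce
qed

text \<open>The periodic function that agrees with \<open>v\<close> on the window of length
  \<open>N\<close> from \<open>a\<close>. Intermediate colorings are thus written down on a single
  window.\<close>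

definition ext :: "int \<Rightarrow> (int \<Rightarrow> 'b) \<Rightarrow> int \<Rightarrow> 'b" where
  "ext a v x = v (a + (x - a) mod N)"

lemma ext_per: "per (ext a v)"
proof -
  have "(x + N - a) mod N = (x - a) mod N" for x
  proof -
    have "x + N - a = (x - a) + N" by simp
    then show ?thesis by (metis mod_add_self2)
  qed
  then show ?thesis unfolding per_def ext_def by simp
qed

lemma ext_window: "a \<le> x \<Longrightarrow> x < a + N \<Longrightarrow> ext a v x = v x"
  unfolding ext_def by (simp add: mod_pos_pos_trivial)

lemma ext_range: "(\<And>x. a \<le> x \<Longrightarrow> x < a + N \<Longrightarrow> v x \<in> A) \<Longrightarrow> ext a v x \<in> A"
  unfolding ext_def using mod_N(1,3)[of "x - a"] by simp

lemma window_all: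
  assumes "per P" "\<And>x. a \<le> x \<Longrightarrow> x < a + N \<Longrightarrow> P x"
  shows "P x"
proof -
  obtain j where "a \<le> x + N * j" "x + N * j < a + N" by (rule window_rep)
  then show ?thesis using assms per_mult by metis
qed

lemma keep_window:
  assumes f: "col f" and g: "per g" and w: "\<And>x. a \<le> x \<Longrightarrow> x < a + N \<Longrightarrow> g x = c \<Longrightarrow> f x = c"
  shows "acy (\<lambda>x. f x = c \<or> g x = c)"
proof (rule acy_keep[OF f])
  have "per (\<lambda>x. g x = c \<longrightarrow> f x = c)" using col_per[OF f] g unfolding per_def by simp
  then show "g x = c \<Longrightarrow> f x = c" for x using window_all[of "\<lambda>x. g x = c \<longrightarrow> f x = c" a x] w by blast
qed

lemma card_diff_le:
  assumes "\<And>x. a \<le> x \<Longrightarrow> x < a + N \<Longrightarrow> f x \<noteq> g x \<Longrightarrow> l \<le> x \<and> x \<le> u" "u - l + 1 \<le> s" "0 \<le> s"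
  shows "int (card {x \<in> {a..<a + N}. f x \<noteq> g x}) \<le> s"
proof -
  have "{x \<in> {a..<a + N}. f x \<noteq> g x} \<subseteq> {l..u}" using assms by auto
  then have "card {x \<in> {a..<a + N}. f x \<noteq> g x} \<le> card {l..u}" by (intro card_mono) auto
  also have "\<dots> = nat (u - l + 1)" by simp
  finally show ?thesis using assms(2,3) by linarith
qed

text \<open>Recoloring the ends first makes the colors of the two ends differ from then on, so that no class can
  contain both of them.\<close>

lemma recolor_rest:
  assumes f: "col f" and g: "per g" and r: "\<And>x. g x \<in> {1..k}"
    and fb: "\<And>x. a \<le> x \<Longrightarrow> x < a + N \<Longrightarrow> f x = b \<longleftrightarrow> x \<le> a + n - 1"
    and gb: "\<And>x. a \<le> x \<Longrightarrow> x < a + N \<Longrightarrow> g x = b \<longleftrightarrow> x \<le> a + n - 1"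
    and e: "g (a + 2 * n) \<noteq> f (a + n)" "g (a + 2 * n) \<noteq> g (a + n)"
  shows "reach f g (n + 1)"
proof -
  define f1 where "f1 = upd f (a + 2 * n) (g (a + 2 * n))"
  define f2 where "f2 = upd f1 (a + n) (g (a + n))"
  have f1w: "f1 x = (if x = a + 2 * n then g (a + 2 * n) else f x)" if "a \<le> x" "x < a + N" for x
    unfolding f1_def using upd_window[of a x "a + 2 * n"] that n4 by simp
  have f2w: "f2 x = (if x = a + n then g (a + n) else f1 x)" if "a \<le> x" "x < a + N" for x
    unfolding f2_def using upd_window[of a x "a + n"] that n4 by simp
  have pf: "per f" using col_per[OF f] .
  have p1: "per f1" unfolding f1_def using upd_per pf by blast
  have p2: "per f2" unfolding f2_def using upd_per p1 by blast
  have u1: "f1 x = f x \<or> f1 x = g (a + 2 * n)" for x unfolding f1_def by (rule upd_cases)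
  have u2: "f2 x = f1 x \<or> f2 x = g (a + n)" for x unfolding f2_def by (rule upd_cases)
  have s1: "reach f f1 1"
  proof (rule recolor[OF f p1])
    show "f1 x \<in> {1..k}" for x using u1[of x] r f unfolding col_def by metis
    show "acy (\<lambda>x. f x = c \<or> f1 x = c)" for c
    proof (cases "c = g (a + 2 * n)")
      case True
      have cb: "c \<noteq> b" using gb[of "a + 2 * n"] n4 True by auto
      show ?thesis
      proof (rule arc_acy_w[OF per_or[OF pf p1], of a "a + n + 1" "a + 2 * n"])
        fix x assume x: "a \<le> x" "x < a + N" "f x = c \<or> f1 x = c"
        then have "f x = c \<or> x = a + 2 * n" using f1w[of x] by (auto split: if_splits)
        moreover have "f x \<noteq> c" if "x \<le> a + n"
        proof (cases "x = a + n")
          case True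
          then show ?thesis using e \<open>c = _\<close> by auto
        next
          case False
          then show ?thesis using fb[of x] x that cb by auto
        qed
        ultimately show "a + n + 1 \<le> x \<and> x \<le> a + 2 * n" using x n4 by force
      qed (use n4 in auto)
    next
      case False
      then show ?thesis using u1 by (intro acy_keep[OF f]) metis
    qed
    show "int (card {x \<in> {a..<a + N}. f x \<noteq> f1 x}) \<le> 1"
      by (rule card_diff_le[of _ _ _ "a + 2 * n" "a + 2 * n"]) (use f1w in \<open>auto split: if_splits\<close>)
  qed
  note c1 = reach_col(2)[OF s1]
  have s2: "reach f1 f2 1"
  proof (rule recolor[OF c1 p2])
    show "f2 x \<in> {1..k}" for x using u2[of x] r c1 unfolding col_def by metis
    show "acy (\<lambda>x. f1 x = c \<or> f2 x = c)" for c
    proof (cases "c = g (a + n)")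
      case True
      have cb: "c \<noteq> b" using gb[of "a + n"] n4 True by auto
      show ?thesis
      proof (rule arc_acy_w[OF per_or[OF p1 p2], of a "a + n" "a + 2 * n - 1"])
        fix x assume x: "a \<le> x" "x < a + N" "f1 x = c \<or> f2 x = c"
        then have d: "f1 x = c \<or> x = a + n" using f2w[of x] by (auto split: if_splits)
        have "\<not> x < a + n"
          using fb[of x] x d cb f1w[of x] n4 by auto
        moreover have "x \<noteq> a + 2 * n" using d f1w[of x] x e True n4 by auto
        ultimately show "a + n \<le> x \<and> x \<le> a + 2 * n - 1" using x by linarith
      qed (use n4 in auto)
    next
      case False
      then show ?thesis using u2 by (intro acy_keep[OF c1]) metis
    qed
    show "int (card {x \<in> {a..<a + N}. f1 x \<noteq> f2 x}) \<le> 1"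
      by (rule card_diff_le[of _ _ _ "a + n" "a + n"]) (use f2w in \<open>auto split: if_splits\<close>)
  qed
  note c2 = reach_col(2)[OF s2]
  have f2e: "f2 (a + n) = g (a + n)" "f2 (a + 2 * n) = g (a + 2 * n)"
    using f2w[of "a + n"] f2w[of "a + 2 * n"] f1w[of "a + 2 * n"] n4 by auto
  have f2b: "f2 x = b \<longleftrightarrow> x \<le> a + n - 1" if "a \<le> x" "x < a + N" for x
    using fb[OF that] gb[of "a + n"] gb[of "a + 2 * n"] f2w[OF that] f1w[OF that] n4 by (auto split: if_splits)
  have s3: "reach f2 g (n - 1)"
  proof (rule recolor[OF c2 g r])
    show "acy (\<lambda>x. f2 x = c \<or> g x = c)" for c
    proof (cases "c = b")
      case True
      then show ?thesis
        by (intro arc_acy_w[OF per_or[OF p2 g], of a a "a + n - 1"]) (use f2b gb n4 in auto)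
    next
      case cb: False
      show ?thesis
      proof (cases "g (a + n) = c")
        case True
        show ?thesis
        proof (rule arc_acy_w[OF per_or[OF p2 g], of a "a + n" "a + 2 * n - 1"])
          fix x assume x: "a \<le> x" "x < a + N" "f2 x = c \<or> g x = c"
          then show "a + n \<le> x \<and> x \<le> a + 2 * n - 1"
            using cb f2b[of x] gb[of x] f2e e True by (cases "x = a + 2 * n") auto
        qed (use n4 in auto)
      next
        case False
        show ?thesis
        proof (rule arc_acy_w[OF per_or[OF p2 g], of a "a + n + 1" "a + 2 * n"])
          fix x assume x: "a \<le> x" "x < a + N" "f2 x = c \<or> g x = c"
          then show "a + n + 1 \<le> x \<and> x \<le> a + 2 * n"
            using cb f2b[of x] gb[of x] f2e e False by (cases "x = a + n") auto
        qed (use n4 in auto)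
      qed
    qed
    show "int (card {x \<in> {a..<a + N}. f2 x \<noteq> g x}) \<le> n - 1"
    proof (rule card_diff_le[of _ _ _ "a + n + 1" "a + 2 * n - 1"])
      fix x assume x: "a \<le> x" "x < a + N" "f2 x \<noteq> g x"
      then have "x \<noteq> a + n" "x \<noteq> a + 2 * n" "\<not> x \<le> a + n - 1" using f2e f2b[of x] gb[of x] by auto
      then show "a + n + 1 \<le> x \<and> x \<le> a + 2 * n - 1" using x by auto
    qed (use n4 in auto)
  qed
  show ?thesis using reach_trans[OF reach_trans[OF s1 s2] s3] by (simp add: add.commute)
qed


text \<open>This is where \<open>k4\<close> is needed for the choices below: in \<open>meet\<close>
  the three colors to avoid are those of the two arcs and that of one end residue.\<close>

lemma color_avoid: "\<exists>g\<in>{1..k}. g \<noteq> u \<and> g \<noteq> v \<and> g \<noteq> w"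
proof (rule ccontr)
  assume "\<not> ?thesis"
  then have "{1..k} \<subseteq> {u, v, w}" by blast
  then have "card {1..k} \<le> card {u, v, w}" by (intro card_mono) auto
  also have "\<dots> \<le> 3" by (simp add: card_insert_if)
  finally show False using k4 by simp
qed

text \<open>Filling the arc costs \<open>n - cnt f b\<close> steps, and the remaining
  \<open>n + 1\<close> residues cost one step each. The target is arbitrary outside the arc, except
  for the condition \<open>e\<close> on the two ends.\<close>

lemma spread:
  assumes f: "col f" and g: "per g" and r: "\<And>x. g x \<in> {1..k}"
    and fb: "\<And>x. a \<le> x \<Longrightarrow> x < a + N \<Longrightarrow> f x = b \<Longrightarrow> x \<le> a + n - 1"
    and gb: "\<And>x. a \<le> x \<Longrightarrow> x < a + N \<Longrightarrow> g x = b \<longleftrightarrow> x \<le> a + n - 1"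
    and e: "g (a + 2 * n) \<noteq> f (a + n)" "g (a + 2 * n) \<noteq> g (a + n)"
  shows "reach f g (N - cnt f b)"
proof -
  define f1 where "f1 = ext a (\<lambda>x. if x \<le> a + n - 1 then b else f x)"
  have f1w: "f1 x = (if x \<le> a + n - 1 then b else f x)" if "a \<le> x" "x < a + N" for x
    unfolding f1_def using ext_window[OF that] .
  have p: "per f" and p1: "per f1" using col_per[OF f] ext_per unfolding f1_def by auto
  have bk: "b \<in> {1..k}" using gb[of a] r[of a] n4 by auto
  have c1: "int (card {x \<in> {a..<a + N}. f x \<noteq> f1 x}) = n - cnt f b"
  proof -
    have "{x \<in> {a..<a + N}. f x \<noteq> f1 x} = {a..a + n - 1} - {x \<in> {a..<a + N}. f x = b}"
      using f1w n4 by (auto split: if_splits)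
    moreover have "{x \<in> {a..<a + N}. f x = b} \<subseteq> {a..a + n - 1}" using fb by auto
    moreover from this have "finite {x \<in> {a..<a + N}. f x = b}" by (rule finite_subset) simp
    ultimately have e: "card {x \<in> {a..<a + N}. f x \<noteq> f1 x} = card {a..a + n - 1} - card {x \<in> {a..<a + N}. f x = b}"
      and l: "card {x \<in> {a..<a + N}. f x = b} \<le> card {a..a + n - 1}"
      by (simp_all only: card_Diff_subset card_mono finite_atLeastAtMost_int)
    have "int (card {a..a + n - 1}) = n" using n4 by simp
    then show ?thesis using e l cnt_window[OF p, of b a] by linarith
  qed
  have s1: "reach f f1 (n - cnt f b)"
  proof (rule recolor[OF f p1])
    show "f1 x \<in> {1..k}" for x unfolding f1_def
      by (rule ext_range) (use bk f in \<open>auto simp: col_def\<close>)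
    show "acy (\<lambda>x. f x = c \<or> f1 x = c)" for c
    proof (cases "c = b")
      case True
      show ?thesis
      proof (rule arc_acy_w[OF per_or[OF p p1], of a a "a + n - 1"])
        fix x assume "a \<le> x" "x < a + N" "f x = c \<or> f1 x = c"
        then show "a \<le> x \<and> x \<le> a + n - 1" using fb[of x] f1w[of x] True by (auto split: if_splits)
      qed (use n4 in auto)
    next
      case False
      show ?thesis by (rule keep_window[OF f p1, of a]) (use f1w False in \<open>auto split: if_splits\<close>)
    qed
    show "int (card {x \<in> {a..<a + N}. f x \<noteq> f1 x}) \<le> n - cnt f b" using c1 by simp
  qed
  have "reach f1 g (n + 1)"
  proof (rule recolor_rest[OF reach_col(2)[OF s1] g r _ gb])
    show "f1 x = b \<longleftrightarrow> x \<le> a + n - 1" if "a \<le> x" "x < a + N" for x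
      using f1w[OF that] fb[OF that] by auto
    show "g (a + 2 * n) \<noteq> f1 (a + n)" using e f1w[of "a + n"] n4 by simp
  qed (use e in auto)
  then have "reach f g (n - cnt f b + (n + 1))" using reach_trans[OF s1] by blast
  moreover have "n - cnt f b + (n + 1) = N - cnt f b" by simp
  ultimately show ?thesis by (simp only:)
qed

text \<open>The reflection that fixes the arc swaps the ends \<open>a + n\<close> and
  \<open>a + 2 * n\<close> of its complement, so the condition falls on the opposite end. In
  \<open>meet\<close> each of the two colorings needs its own version.\<close>

lemma spread_refl:
  assumes f: "col f" and g: "per g" and r: "\<And>x. g x \<in> {1..k}"
    and fb: "\<And>x. a \<le> x \<Longrightarrow> x < a + N \<Longrightarrow> f x = b \<Longrightarrow> x \<le> a + n - 1"
    and gb: "\<And>x. a \<le> x \<Longrightarrow> x < a + N \<Longrightarrow> g x = b \<longleftrightarrow> x \<le> a + n - 1"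
    and e: "g (a + n) \<noteq> f (a + 2 * n)" "g (a + n) \<noteq> g (a + 2 * n)"
  shows "reach f g (N - cnt f b)"
proof -
  let ?c = "2 * a + n - 1"
  let ?f = "\<lambda>x. f (?c - x)" and ?g = "\<lambda>x. g (?c - x)"
  have p: "per f" using col_per[OF f] .
  have w: "?f x = f (?c + N - x)" "?g x = g (?c + N - x)" for x
    using per_plus[OF p, of "?c - x"] per_plus[OF g, of "?c - x"] by (simp_all add: algebra_simps)
  have "reach ?f ?g (N - cnt ?f b)"
  proof (rule spread[OF col_refl[OF f] per_refl[OF g] r])
    fix x assume x: "a \<le> x" "x < a + N"
    show "g (?c - x) = b \<longleftrightarrow> x \<le> a + n - 1"
    proof (cases "x \<le> a + n - 1")
      case True
      then show ?thesis using gb[of "?c - x"] x n4 by auto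
    next
      case False
      then show ?thesis using gb[of "?c + N - x"] x n4 w(2)[of x] by auto
    qed
    show "x \<le> a + n - 1" if "f (?c - x) = b"
      using fb[of "?c + N - x"] x n4 w(1)[of x] that by (cases "x \<le> a + n - 1") auto
  next
    have "?c + N - (a + 2 * n) = a + n" "?c + N - (a + n) = a + 2 * n" by auto
    then show "?g (a + 2 * n) \<noteq> ?f (a + n)" "?g (a + 2 * n) \<noteq> ?g (a + n)"
      using e w[of "a + 2 * n"] w[of "a + n"] by simp_all
  qed
  from reach_refl_map[OF this, of ?c] show ?thesis using cnt_refl[OF p] by simp
qed

text \<open>The intermediate colorings \<open>u\<close> and \<open>v\<close> differ only on the overlap of the two arcs, or in one
  residue if the arcs are disjoint.\<close>

lemma meet:
  assumes f: "col f" and g: "col g" and bc: "b \<noteq> c" "b \<in> {1..k}" "c \<in> {1..k}" and d: "1 \<le> d" "d \<le> n"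
    and fb: "\<And>x. a \<le> x \<Longrightarrow> x < a + N \<Longrightarrow> f x = b \<Longrightarrow> x \<le> a + n - 1"
    and gc: "\<And>x. a + d \<le> x \<Longrightarrow> x < a + d + N \<Longrightarrow> g x = c \<Longrightarrow> x \<le> a + d + n - 1"
  shows "reach f g (2 * N + max 1 (n - d) - cnt f b - cnt g c)"
proof -
  \<comment> \<open>In \<open>u\<close> the end \<open>a + 2 * n\<close> gets color
    \<open>p\<close>, and in \<open>v\<close> the end \<open>a + d + n\<close> gets color
    \<open>q\<close>; the last inequalities are the conditions of \<open>spread\<close> and
    \<open>spread_refl\<close> there.\<close>
  obtain p where p: "p \<in> {1..k}" "p \<noteq> b" "p \<noteq> c" "p \<noteq> f (a + n)" using color_avoid by blast
  obtain q where q: "q \<in> {1..k}" "q \<noteq> b" "q \<noteq> c" "q \<noteq> g (a + d + 2 * n)" using color_avoid by blast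
  define u where "u = ext a (\<lambda>x. if x \<le> a + n - 1 then b else if x \<le> a + n + d - 1 then c
     else if x = a + 2 * n then p else q)"
  \<comment> \<open>For \<open>d = n\<close> the residue \<open>a + 2 * n\<close> is itself the end
    \<open>a + d + n\<close> and must have color \<open>q\<close>. This is the one step in
    \<open>max 1 (n - d)\<close> when the arcs are disjoint.\<close>
  define v where "v = ext (a + d) (\<lambda>x. if x \<le> a + d + n - 1 then c else if x \<le> a + 2 * n then
     (if x = a + 2 * n \<and> d < n then p else q) else b)"
  have uw: "u x = (if x \<le> a + n - 1 then b else if x \<le> a + n + d - 1 then c
     else if x = a + 2 * n then p else q)" if "a \<le> x" "x < a + N" for x
    unfolding u_def using ext_window[OF that] .
  have vw: "v x = (if x \<le> a + d + n - 1 then c else if x \<le> a + 2 * n then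
     (if x = a + 2 * n \<and> d < n then p else q) else b)" if "a + d \<le> x" "x < a + d + N" for x
    unfolding v_def using ext_window[OF that] .
  have pu: "per u" and pv: "per v" unfolding u_def v_def by (auto intro: ext_per)
  have ru: "u x \<in> {1..k}" for x unfolding u_def by (rule ext_range) (use p q bc in auto)
  have rv: "v x \<in> {1..k}" for x unfolding v_def by (rule ext_range) (use p q bc in auto)
  have vw2: "v x = b" if "a \<le> x" "x < a + d" for x
    using vw[of "x + N"] per_plus[OF pv, of x] that d n4 by auto
  have tab: "x < a + d \<and> u x = b \<and> v x = b \<or> a + d \<le> x \<and> x \<le> a + n - 1 \<and> u x = b \<and> v x = c \<or>
      a + n \<le> x \<and> x \<le> a + d + n - 1 \<and> u x = c \<and> v x = c \<or>
      a + d + n \<le> x \<and> x < a + 2 * n \<and> u x = q \<and> v x = q \<or>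
      x = a + 2 * n \<and> u x = p \<and> v x = (if d < n then p else q)" if x: "a \<le> x" "x < a + N" for x
  proof -
    consider "x < a + d" | "a + d \<le> x" "x \<le> a + n - 1" | "a + n \<le> x" "x \<le> a + d + n - 1" |
      "a + d + n \<le> x" "x < a + 2 * n" | "x = a + 2 * n" using x d by linarith
    then show ?thesis using x d uw[OF x] vw[of x] vw2[of x] n4 by cases simp_all
  qed
  have s1: "reach f u (N - cnt f b)"
  proof (rule spread[OF f pu ru fb])
    show "u x = b \<longleftrightarrow> x \<le> a + n - 1" if "a \<le> x" "x < a + N" for x
      using uw[OF that] p q bc by simp
    show "u (a + 2 * n) \<noteq> f (a + n)" "u (a + 2 * n) \<noteq> u (a + n)"
      using uw[of "a + n"] uw[of "a + 2 * n"] p q bc d n4 by simp_all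
  qed
  have s2: "reach g v (N - cnt g c)"
  proof (rule spread_refl[OF g pv rv gc])
    show "v x = c \<longleftrightarrow> x \<le> a + d + n - 1" if "a + d \<le> x" "x < a + d + N" for x
      using vw[OF that] p q bc by simp
    show "v (a + d + n) \<noteq> g (a + d + 2 * n)" "v (a + d + n) \<noteq> v (a + d + 2 * n)"
      using vw[of "a + d + n"] vw[of "a + d + 2 * n"] p q bc d n4 by simp_all
  qed
  have s3: "reach u v (max 1 (n - d))"
  proof (rule recolor[OF reach_col(2)[OF s1] pv rv])
    show "acy (\<lambda>x. u x = r \<or> v x = r)" for r
    proof -
      consider "r = c" | "r = q" | "r \<noteq> c" "r \<noteq> q" by blast
      then show ?thesis
      proof cases
        case 1
        show ?thesis
        proof (rule arc_acy_w[OF per_or[OF pu pv], of a "a + d" "a + d + n - 1"])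
          fix x assume x: "a \<le> x" "x < a + N" "u x = r \<or> v x = r"
          have "a + d \<le> x \<and> x \<le> a + n - 1 \<or> a + n \<le> x \<and> x \<le> a + d + n - 1"
            using tab[OF x(1,2)] x(3) 1 p q bc by metis
          then show "a + d \<le> x \<and> x \<le> a + d + n - 1" using d by linarith
        qed (use d n4 in auto)
      next
        case 2
        show ?thesis
        proof (rule arc_acy_w[OF per_or[OF pu pv], of a "a + d + n" "a + 2 * n"])
          fix x assume x: "a \<le> x" "x < a + N" "u x = r \<or> v x = r"
          have "a + d + n \<le> x \<and> x < a + 2 * n \<or> x = a + 2 * n"
            using tab[OF x(1,2)] x(3) 2 p q bc by metis
          then show "a + d + n \<le> x \<and> x \<le> a + 2 * n" using d by linarith
        qed (use d n4 in auto)
      next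
        case 3
        show ?thesis
        proof (rule keep_window[OF reach_col(2)[OF s1] pv, of a])
          fix x assume x: "a \<le> x" "x < a + N" "v x = r"
          show "u x = r"
            using tab[OF x(1,2)] x(3) 3 by metis
        qed
      qed
    qed
    show "int (card {x \<in> {a..<a + N}. u x \<noteq> v x}) \<le> max 1 (n - d)"
    proof (cases "d = n")
      case True
      show ?thesis
      proof (rule card_diff_le[of _ _ _ "a + 2 * n" "a + 2 * n"])
        fix x assume x: "a \<le> x" "x < a + N" "u x \<noteq> v x"
        show "a + 2 * n \<le> x \<and> x \<le> a + 2 * n"
          using tab[OF x(1,2)] x(3) True by auto
      qed auto
    next
      case False
      show ?thesis
      proof (rule card_diff_le[of _ _ _ "a + d" "a + n - 1"])
        fix x assume x: "a \<le> x" "x < a + N" "u x \<noteq> v x"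
        show "a + d \<le> x \<and> x \<le> a + n - 1"
          using tab[OF x(1,2)] x(3) False d by auto
      qed auto
    qed
  qed
  have "reach f g (N - cnt f b + max 1 (n - d) + (N - cnt g c))"
    using reach_trans[OF reach_trans[OF s1 s3] reach_sym[OF s2]] .
  moreover have "N - cnt f b + max 1 (n - d) + (N - cnt g c) = 2 * N + max 1 (n - d) - cnt f b - cnt g c"
    by simp
  ultimately show ?thesis by (simp only:)
qed

text \<open>With equal colors the arcs may coincide. The intermediate colorings then differ only at
  \<open>a + 2 * n\<close>: the color there has to avoid one color of \<open>f\<close> on one side
  and one of \<open>g\<close> on the other, and with four colors a common choice need not
  exist.\<close>

lemma meet_same:
  assumes f: "col f" and g: "col g" and b: "b \<in> {1..k}"
    and fb: "\<And>x. a \<le> x \<Longrightarrow> x < a + N \<Longrightarrow> f x = b \<Longrightarrow> x \<le> a + n - 1"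
    and gb: "\<And>x. a \<le> x \<Longrightarrow> x < a + N \<Longrightarrow> g x = b \<Longrightarrow> x \<le> a + n - 1"
  shows "reach f g (2 * N + 1 - cnt f b - cnt g b)"
proof -
  obtain c where c: "c \<in> {1..k}" "c \<noteq> b" using color_avoid by blast
  obtain p where p: "p \<in> {1..k}" "p \<noteq> b" "p \<noteq> c" "p \<noteq> f (a + n)" using color_avoid by blast
  obtain q where q: "q \<in> {1..k}" "q \<noteq> b" "q \<noteq> c" "q \<noteq> g (a + n)" using color_avoid by blast
  define u where "u t = ext a (\<lambda>x. if x \<le> a + n - 1 then b else if x \<le> a + 2 * n - 1 then c else t)" for t
  have uw: "u t x = (if x \<le> a + n - 1 then b else if x \<le> a + 2 * n - 1 then c else t)"
    if "a \<le> x" "x < a + N" for x t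
    unfolding u_def using ext_window[OF that] .
  have pu: "per (u t)" for t unfolding u_def by (rule ext_per)
  have ru: "u t x \<in> {1..k}" if "t \<in> {1..k}" for x t unfolding u_def by (rule ext_range) (use that b c in auto)
  have s1: "reach f (u p) (N - cnt f b)"
    by (rule spread[OF f pu ru[OF p(1)] fb]) (use p b c n4 in \<open>simp_all add: uw\<close>)
  have s2: "reach g (u q) (N - cnt g b)"
    by (rule spread[OF g pu ru[OF q(1)] gb]) (use q b c n4 in \<open>simp_all add: uw\<close>)
  have s3: "reach (u p) (u q) 1"
  proof (rule recolor[OF reach_col(2)[OF s1] pu ru[OF q(1)]])
    show "acy (\<lambda>x. u p x = r \<or> u q x = r)" for r
    proof (cases "r = q")
      case True
      show ?thesis
      proof (rule arc_acy_w[OF per_or[OF pu pu], of a "a + 2 * n" "a + 2 * n"])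
        fix x assume x: "a \<le> x" "x < a + N" "u p x = r \<or> u q x = r"
        then show "a + 2 * n \<le> x \<and> x \<le> a + 2 * n"
          using uw[of x] True p q b c n4 by (auto split: if_splits)
      qed (use n4 in auto)
    next
      case False
      show ?thesis
        by (rule keep_window[OF reach_col(2)[OF s1] pu, of a]) (use False in \<open>simp_all add: uw split: if_splits\<close>)
    qed
    show "int (card {x \<in> {a..<a + N}. u p x \<noteq> u q x}) \<le> 1"
      by (rule card_diff_le[of _ _ _ "a + 2 * n" "a + 2 * n"]) (simp_all add: uw split: if_splits)
  qed
  have "reach f g (N - cnt f b + 1 + (N - cnt g b))"
    using reach_trans[OF reach_trans[OF s1 s3] reach_sym[OF s2]] .
  moreover have "N - cnt f b + 1 + (N - cnt g b) = 2 * N + 1 - cnt f b - cnt g b"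
    by simp
  ultimately show ?thesis by (simp only:)
qed

text \<open>The class \<open>c\<close> lies in the \<open>n\<close> consecutive residues that end with \<open>e\<close>.\<close>

definition arc :: "(int \<Rightarrow> nat) \<Rightarrow> nat \<Rightarrow> int \<Rightarrow> bool" where
  "arc f c e \<longleftrightarrow> (\<forall>x. e < x \<and> x < e + n + 2 \<longrightarrow> f x \<noteq> c)"

text \<open>The arc of \<open>f\<close> is normalized to \<open>{1..n}\<close>, and the offset in
  \<open>meet\<close> becomes the distance between \<open>e\<close> and \<open>n\<close>. The
  excluded value \<open>e = n\<close> is the case of two colors in the same arc.\<close>

lemma arc_meet:
  assumes f: "col f" and g: "col g" and bc: "b \<noteq> c" "b \<in> {1..k}" "c \<in> {1..k}"
    and fb: "arc f b n" and gc: "arc g c e" and e: "0 \<le> e" "e \<le> 2 * n" "e \<noteq> n"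
  shows "reach f g (2 * N + max 1 (min e (2 * n - e)) - cnt f b - cnt g c)"
proof (cases "e < n")
  case True
  have "reach g f (2 * N + max 1 (n - (n - e)) - cnt g c - cnt f b)"
  proof (rule meet[OF g f not_sym[OF bc(1)] bc(3,2), of "n - e" "e - n + 1"])
    fix x
    show "x \<le> e - n + 1 + n - 1" if "e - n + 1 \<le> x" "x < e - n + 1 + N" "g x = c"
      using gc that unfolding arc_def by force
    show "x \<le> e - n + 1 + (n - e) + n - 1" if "e - n + 1 + (n - e) \<le> x" "x < e - n + 1 + (n - e) + N" "f x = b"
      using fb that unfolding arc_def by force
  qed (use True e in auto)
  then have "reach f g (2 * N + max 1 (n - (n - e)) - cnt g c - cnt f b)" by (rule reach_sym)
  moreover have "2 * N + max 1 (n - (n - e)) - cnt g c - cnt f b =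
     2 * N + max 1 (min e (2 * n - e)) - cnt f b - cnt g c" using True by auto
  ultimately show ?thesis by (simp only:)
next
  case False
  have "reach f g (2 * N + max 1 (n - (e - n)) - cnt f b - cnt g c)"
  proof (rule meet[OF f g bc, of "e - n" 1])
    fix x
    show "x \<le> 1 + n - 1" if "1 \<le> x" "x < 1 + N" "f x = b"
      using fb that unfolding arc_def by force
    show "x \<le> 1 + (e - n) + n - 1" if "1 + (e - n) \<le> x" "x < 1 + (e - n) + N" "g x = c"
      using gc that unfolding arc_def by force
  qed (use False e in auto)
  moreover have "2 * N + max 1 (n - (e - n)) - cnt f b - cnt g c =
     2 * N + max 1 (min e (2 * n - e)) - cnt f b - cnt g c" using False e by auto
  ultimately show ?thesis by (simp only:)
qed


section \<open>Shapes of acyclic classes\<close>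

text \<open>A class that contains two residues at distance \<open>n\<close> but does not lie in \<open>n\<close> consecutive residues has
  one of the two forms \<open>J\<close> and \<open>K\<close>.\<close>

definition J :: "(int \<Rightarrow> nat) \<Rightarrow> nat \<Rightarrow> int \<Rightarrow> bool" where
  "J f c p \<longleftrightarrow> f p = c \<and> f (p + n) = c \<and>
     (\<forall>x. p < x \<and> x < p + N \<and> f x = c \<longrightarrow> x = p + n \<or> p + n + 2 \<le> x \<and> x \<le> p + 2 * n - 1)"

definition K :: "(int \<Rightarrow> nat) \<Rightarrow> nat \<Rightarrow> int \<Rightarrow> bool" where
  "K f c q \<longleftrightarrow> f q = c \<and> f (q + n) = c \<and> f (q + n + 1) = c \<and>
     (\<forall>x. q < x \<and> x < q + N \<and> f x = c \<longrightarrow> x = q + n \<or> x = q + n + 1)"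

lemma tri_no: "col f \<Longrightarrow> tri x y z \<Longrightarrow> f x = c \<Longrightarrow> f y = c \<Longrightarrow> f z = c \<Longrightarrow> False"
  using col_acy[of f c] unfolding acy_def by blast

text \<open>Suppose that \<open>p\<close> and \<open>p + n\<close> are in the class. A residue
  strictly between them closes a triangle. If \<open>p + n + 1\<close> or \<open>p + 2 * n\<close>
  is in the class too, any fourth residue closes a triangle, and the class is a triple based at
  \<open>p\<close> or \<open>p + n\<close>; otherwise the form \<open>J\<close> is left. Without two
  residues at distance \<open>n\<close> the class lies in an arc.\<close>

lemma class_cases:
  assumes f: "col f"
  obtains e where "arc f c e" | p where "J f c p" | q where "K f c q"
proof (cases "\<exists>p. f p = c \<and> f (p + n) = c")
  case True
  then obtain p where p: "f p = c" "f (p + n) = c" by blast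
  have pf: "per f" using col_per[OF f] .
  have gap: "f x \<noteq> c" if "p < x" "x < p + n" for x
    using tri_no[OF f, of p x "p + n" c] p that n4 unfolding tri_def by force
  consider "f (p + n + 1) = c" | "f (p + 2 * n) = c" | "f (p + n + 1) \<noteq> c" "f (p + 2 * n) \<noteq> c" by blast
  then show ?thesis
  proof cases
    case 1
    have "x = p + n \<or> x = p + n + 1" if x: "p < x" "x < p + N" "f x = c" for x
    proof (rule ccontr)
      assume "\<not> ?thesis"
      then have "p + n + 1 < x" using x gap[of x] by force
      then have "tri p (p + n + 1) x" using x n4 unfolding tri_def by auto
      then show False using tri_no[OF f] p 1 x by blast
    qed
    then show ?thesis using that(3)[of p] p 1 unfolding K_def by blast
  next
    case 2
    have "x = p + n + n \<or> x = p + n + n + 1" if x: "p + n < x" "x < p + n + N" "f x = c" for x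
    proof (rule ccontr)
      assume a: "\<not> ?thesis"
      have "\<not> (p + N < x)" using gap[of "x - N"] per_shift[OF pf, of x] x by auto
      then have "x < p + 2 * n" using x a by auto
      then have "tri (p + n) x (p + 2 * n)" using x n4 unfolding tri_def by auto
      then show False using tri_no[OF f] p 2 x by blast
    qed
    moreover have "f (p + n + n + 1) = c" using per_plus[OF pf, of p] p by (simp add: algebra_simps)
    moreover have "f (p + n + n) = c" using 2 by (simp add: algebra_simps)
    ultimately show ?thesis using that(3)[of "p + n"] p unfolding K_def by blast
  next
    case 3
    have "x = p + n \<or> p + n + 2 \<le> x \<and> x \<le> p + 2 * n - 1" if x: "p < x" "x < p + N" "f x = c" for x
    proof (rule ccontr)
      assume "\<not> ?thesis"
      then have "x = p + n + 1 \<or> x = p + 2 * n" using x gap[of x] by force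
      then show False using x 3 by auto
    qed
    then show ?thesis using that(2)[of p] p unfolding J_def by blast
  qed
next
  case False
  have pf: "per f" using col_per[OF f] .
  show ?thesis
  proof (cases "\<exists>x. f x = c")
    case no: False
    then show ?thesis using that(1)[of 0] unfolding arc_def by blast
  next
    case True
    then obtain x where x: "f x = c" by blast
    let ?S = "{y \<in> {x..x + n}. f y = c}"
    have fin: "finite ?S" by (rule finite_subset[of _ "{x..x + n}"]) auto
    have "x \<in> ?S" using x n4 by auto
    \<comment> \<open>The arc is going to end with \<open>y\<close>, the last element of the class
      among \<open>{x..x + n}\<close>: a later element within \<open>n + 1\<close> residues after
      \<open>y\<close> would close a triangle with \<open>x\<close> and \<open>y\<close>.\<close>
    define y where "y = Max ?S"
    have yS: "y \<in> ?S" unfolding y_def using Max_in[OF fin] \<open>x \<in> ?S\<close> by blast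
    have ymax: "f w \<noteq> c" if "y < w" "w \<le> x + n" for w
    proof
      assume "f w = c"
      then have "w \<in> ?S" using that yS by auto
      then have "w \<le> y" unfolding y_def using fin by simp
      then show False using that by simp
    qed
    have d1: "f (w + n) \<noteq> c" if "f w = c" for w using False that by blast
    have d2: "f (w + n + 1) \<noteq> c" if "f w = c" for w
    proof
      assume "f (w + n + 1) = c"
      moreover have "f (w + n + 1 + n) = f w" using per_plus[OF pf, of w] by (simp add: algebra_simps)
      ultimately show False using d1[of "w + n + 1"] that by simp
    qed
    have "f z \<noteq> c" if z: "y < z" "z < y + n + 2" for z
    proof
      assume fz: "f z = c"
      have "x + n < z" using ymax[of z] z fz by force
      moreover have "z \<noteq> x + n + 1" using d2[OF x] fz by auto
      moreover have "z \<noteq> y + n" "z \<noteq> y + n + 1" using d1[of y] d2[of y] yS fz by (auto simp: add.assoc)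
      ultimately have "x + n + 2 \<le> z" "z \<le> y + n - 1" using z by auto
      then have t: "tri x y z" using yS z n4 d1[OF x] unfolding tri_def by auto
      then show False using tri_no[OF f t x _ fz] yS by auto
    qed
    then show ?thesis using that(1)[of y] unfolding arc_def by blast
  qed
qed

lemma arc_shift: "per f \<Longrightarrow> arc f c (e + N * j) \<longleftrightarrow> arc f c e"
proof -
  assume p: "per f"
  have "arc f c e \<Longrightarrow> arc f c (e + N * j)" for e j
    unfolding arc_def
  proof (intro allI impI)
    fix x assume a: "\<forall>x. e < x \<and> x < e + n + 2 \<longrightarrow> f x \<noteq> c" "e + N * j < x \<and> x < e + N * j + n + 2"
    then show "f x \<noteq> c" using spec[OF a(1), of "x + N * (-j)"] per_mult[OF p, of x "-j"] by auto
  qed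
  from this[of e j] this[of "e + N * j" "-j"] show ?thesis by auto
qed

lemma J_shift:
  assumes p: "per f" and q: "J f c q"
  shows "J f c (q + N * j)"
proof -
  have pl: "f (w + N * j) = f w" for w using per_mult[OF p] .
  have e: "q + N * j + n = (q + n) + N * j" by simp
  have "x = q + N * j + n \<or> q + N * j + n + 2 \<le> x \<and> x \<le> q + N * j + 2 * n - 1"
    if x: "q + N * j < x" "x < q + N * j + N" "f x = c" for x
  proof -
    have "f (x - N * j) = c" using pl[of "x - N * j"] x by simp
    then have "x - N * j = q + n \<or> q + n + 2 \<le> x - N * j \<and> x - N * j \<le> q + 2 * n - 1"
      using q x unfolding J_def by auto
    then show ?thesis by linarith
  qed
  then show ?thesis using q pl[of q] pl[of "q + n"] unfolding J_def e by simp
qed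

lemma K_shift:
  assumes p: "per f" and q: "K f c q"
  shows "K f c (q + N * j)"
proof -
  have pl: "f (w + N * j) = f w" for w using per_mult[OF p] .
  have e: "q + N * j + n = (q + n) + N * j" "q + N * j + n + 1 = (q + n + 1) + N * j" by simp_all
  have "x = q + N * j + n \<or> x = q + N * j + n + 1"
    if x: "q + N * j < x" "x < q + N * j + N" "f x = c" for x
  proof -
    have "f (x - N * j) = c" using pl[of "x - N * j"] x by simp
    then have "x - N * j = q + n \<or> x - N * j = q + n + 1"
      using q x unfolding K_def by auto
    then show ?thesis by linarith
  qed
  then show ?thesis using q pl[of q] pl[of "q + n"] pl[of "q + n + 1"] e unfolding K_def by metis
qed

lemma class_cases_window:
  assumes f: "col f"
  obtains e where "arc f c e" "a \<le> e" "e < a + N" | p where "J f c p" "a \<le> p" "p < a + N"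
    | q where "K f c q" "a \<le> q" "q < a + N"
proof (rule class_cases[OF f, of c])
  fix e assume "arc f c e"
  moreover obtain j where "a \<le> e + N * j" "e + N * j < a + N" by (rule window_rep)
  ultimately show thesis using that(1) arc_shift[OF col_per[OF f]] by blast
next
  fix e assume "J f c e"
  moreover obtain j where "a \<le> e + N * j" "e + N * j < a + N" by (rule window_rep)
  ultimately show thesis using that(2) J_shift[OF col_per[OF f]] by blast
next
  fix e assume "K f c e"
  moreover obtain j where "a \<le> e + N * j" "e + N * j < a + N" by (rule window_rep)
  ultimately show thesis using that(3) K_shift[OF col_per[OF f]] by blast
qed

text \<open>A form of divisibility that linear arithmetic can use when residues are shifted by whole
  periods.\<close>

lemma mult_cases: "j = 0 \<or> N * j \<le> - N \<or> N \<le> N * (j::int)"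
proof (cases j "0::int" rule: linorder_cases)
  case less
  then have "N * j \<le> N * (-1)" using Npos by (intro mult_left_mono) auto
  then show ?thesis by simp
next
  case greater
  then have "N * 1 \<le> N * j" using Npos by (intro mult_left_mono) auto
  then show ?thesis by simp
qed simp

text \<open>The class \<open>c\<close> can receive all residues of \<open>{l..u}\<close> at once, whereas \<open>acc\<close> below concerns one residue.\<close>

definition rcv :: "(int \<Rightarrow> nat) \<Rightarrow> nat \<Rightarrow> int \<Rightarrow> int \<Rightarrow> bool" where
  "rcv f c l u \<longleftrightarrow> acy (\<lambda>x. f x = c \<or> (\<exists>j. l \<le> x + N * j \<and> x + N * j \<le> u))"

lemma rcv_per:
  assumes "per f"
  shows "per (\<lambda>x. f x = c \<or> (\<exists>j. l \<le> x + N * j \<and> x + N * j \<le> u))"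
proof -
  have "(\<exists>j. l \<le> x + N + N * j \<and> x + N + N * j \<le> u) \<longleftrightarrow> (\<exists>j. l \<le> x + N * j \<and> x + N * j \<le> u)" for x
  proof
    assume "\<exists>j. l \<le> x + N + N * j \<and> x + N + N * j \<le> u"
    then obtain j where "l \<le> x + N + N * j \<and> x + N + N * j \<le> u" by blast
    then have "l \<le> x + N * (j + 1) \<and> x + N * (j + 1) \<le> u" by (simp add: algebra_simps)
    then show "\<exists>j. l \<le> x + N * j \<and> x + N * j \<le> u" by blast
  next
    assume "\<exists>j. l \<le> x + N * j \<and> x + N * j \<le> u"
    then obtain j where "l \<le> x + N * j \<and> x + N * j \<le> u" by blast
    then have "l \<le> x + N + N * (j - 1) \<and> x + N + N * (j - 1) \<le> u" by (simp add: algebra_simps)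
    then show "\<exists>j. l \<le> x + N + N * j \<and> x + N + N * j \<le> u" by blast
  qed
  then show ?thesis using assms unfolding per_def by simp
qed

lemma rcv_arc:
  assumes f: "per f" and a: "arc f c e" and l: "e - n + 1 \<le> l" and u: "u \<le> e"
  shows "rcv f c l u"
  unfolding rcv_def
proof (rule arc_acy[OF rcv_per[OF f], of e])
  fix x assume x: "e < x" "x < e + n + 2"
  have "\<not> (l \<le> x + N * j \<and> x + N * j \<le> u)" for j using mult_cases[of j] x l u n4 by (elim disjE) (simp, linarith+)
  then show "\<not> (f x = c \<or> (\<exists>j. l \<le> x + N * j \<and> x + N * j \<le> u))" using a x unfolding arc_def by auto
qed

text \<open>The received residues are those that \<open>J_acy\<close> allows, one period
  lower.\<close>

lemma rcv_J:
  assumes f: "per f" and a: "J f c p" and l: "p - n + 1 \<le> l" and u: "u \<le> p - 2"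
  shows "rcv f c l u"
  unfolding rcv_def
proof (rule J_acy[OF rcv_per[OF f], of p])
  fix x assume x: "p < x" "x < p + N" and "f x = c \<or> (\<exists>j. l \<le> x + N * j \<and> x + N * j \<le> u)"
  then consider "f x = c" | j where "l \<le> x + N * j" "x + N * j \<le> u" by blast
  then show "x = p + n \<or> p + n + 2 \<le> x \<and> x \<le> p + 2 * n - 1"
  proof cases
    case 1
    then show ?thesis using a x unfolding J_def by blast
  next
    case 2
    have "j = -1"
    proof -
      have "N * j \<noteq> 0" using x 2 u by auto
      then have "j \<noteq> 0" by auto
      moreover have "\<not> N \<le> N * j" using x 2 u n4 by linarith
      moreover have "j + 1 = 0 \<or> N * (j + 1) \<le> - N \<or> N \<le> N * (j + 1)" by (rule mult_cases)
      moreover have "N * (j + 1) = N * j + N" by (simp add: algebra_simps)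
      moreover have "\<not> N * j + N \<le> - N" using x 2 l n4 by linarith
      ultimately show ?thesis using mult_cases[of j] by linarith
    qed
    then show ?thesis using 2 l u by auto
  qed
qed

lemma cnt_upd:
  assumes f: "per f" and x: "f x = c" "r \<noteq> c"
  shows "cnt (upd f x r) c = cnt f c - 1"
proof -
  have "{y \<in> {x..<x + N}. upd f x r y = c} = {y \<in> {x..<x + N}. f y = c} - {x}"
    using upd_window[of x _ x f r] x by (auto split: if_splits)
  moreover have "finite {y \<in> {x..<x + N}. f y = c}" by (rule finite_subset[of _ "{x..<x + N}"]) auto
  moreover have "x \<in> {y \<in> {x..<x + N}. f y = c}" using x n4 by auto
  ultimately have "card {y \<in> {x..<x + N}. f y = c} = Suc (card {y \<in> {x..<x + N}. upd f x r y = c})"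
    by (simp only: card.remove)
  then show ?thesis using cnt_window[OF f, of c x] cnt_window[OF upd_per[OF f], of x r c x] by simp
qed

lemma upd_arc:
  assumes f: "per f" and r: "r \<noteq> c" and x: "e < x" "x < e + n + 2"
    and a: "\<And>y. e < y \<Longrightarrow> y < e + n + 2 \<Longrightarrow> y \<noteq> x \<Longrightarrow> f y \<noteq> c"
  shows "arc (upd f x r) c e"
  unfolding arc_def
proof (intro allI impI)
  fix y assume y: "e < y \<and> y < e + n + 2"
  have "upd f x r y = (if y = x then r else f y)"
    by (rule upd_window[of "e + 1"]) (use x y n4 in auto)
  then show "upd f x r y \<noteq> c" using a[of y] y r by auto
qed

text \<open>The arc that ends with \<open>e\<close> overlaps \<open>{1..n}\<close>, the arc reserved for the class \<open>b\<close> of the other coloring,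
  in \<open>min e (2 * n - e)\<close> residues.\<close>

definition good :: "nat \<Rightarrow> (int \<Rightarrow> nat) \<Rightarrow> bool" where
  "good b f \<longleftrightarrow> (\<exists>g s c e. c \<in> {1..k} \<and> c \<noteq> b \<and> reach f g s \<and> arc g c e \<and> 0 \<le> e \<and> e \<le> 2 * n \<and> e \<noteq> n \<and>
     s + max 1 (min e (2 * n - e)) \<le> h + 1 + cnt g c)"

lemma arc_refl:
  assumes "per g" "arc g c e"
  shows "arc (\<lambda>x. g (n + 1 - x)) c (2 * n - e)"
  unfolding arc_def
proof (intro allI impI)
  fix x assume x: "2 * n - e < x \<and> x < 2 * n - e + n + 2"
  then have "g (n + 1 - x + N) \<noteq> c" using assms unfolding arc_def by force
  then show "g (n + 1 - x) \<noteq> c" using per_plus[OF assms(1), of "n + 1 - x"] by metis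
qed

text \<open>The reflection \<open>n + 1 - x\<close> maps the reserved arc \<open>{1..n}\<close> to
  itself and the end \<open>e\<close> of an arc to \<open>2 * n - e\<close>.\<close>

lemma good_refl:
  assumes "good b (\<lambda>x. f (n + 1 - x))"
  shows "good b f"
proof -
  obtain g s c e where g: "c \<in> {1..k}" "c \<noteq> b" "reach (\<lambda>x. f (n + 1 - x)) g s" "arc g c e" "0 \<le> e" "e \<le> 2 * n" "e \<noteq> n"
     "s + max 1 (min e (2 * n - e)) \<le> h + 1 + cnt g c" using assms unfolding good_def by blast
  have p: "per g" using col_per[OF reach_col(2)[OF g(3)]] .
  have "reach f (\<lambda>x. g (n + 1 - x)) s" using reach_refl_map[OF g(3), of "n + 1"] by simp
  moreover have "arc (\<lambda>x. g (n + 1 - x)) c (2 * n - e)" by (rule arc_refl[OF p g(4)])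
  moreover have "s + max 1 (min (2 * n - e) (2 * n - (2 * n - e))) \<le> h + 1 + cnt (\<lambda>x. g (n + 1 - x)) c"
    using g(8) cnt_refl[OF p] by (simp add: min.commute)
  ultimately show ?thesis unfolding good_def
    using g by (intro exI[of _ "\<lambda>x. g (n + 1 - x)"] exI[of _ s] exI[of _ c] exI[of _ "2 * n - e"]) auto
qed

text \<open>A class inside two consecutive residues fits into \<open>n - 1\<close> different arcs,
  and some of them overlaps \<open>{1..n}\<close> in at most \<open>h + 1\<close> residues. For even
  \<open>n\<close> and two residues in the middle nothing better is possible, which explains the
  constant in \<open>good\<close>.\<close>

lemma short_good:
  assumes g: "reach f g s" and c: "c \<in> {1..k}" "c \<noteq> b" and s: "s \<le> cnt g c"
    and sh: "\<And>y. x + 1 < y \<Longrightarrow> y < x + N \<Longrightarrow> g y \<noteq> c"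
  shows "good b f"
proof -
  have p: "per g" using col_per[OF reach_col(2)[OF g]] .
  obtain j where j: "1 \<le> x + N * j" "x + N * j < 1 + N" by (rule window_rep)
  define z where "z = x + N * j"
  have sh: "g y \<noteq> c" if "z + 1 < y" "y < z + N" for y
    using sh[of "y + N * (-j)"] per_mult[OF p, of y "-j"] that unfolding z_def by auto
  have ar: "arc g c e" if "z + 1 \<le> e" "e \<le> z + n - 1" for e
    unfolding arc_def using sh that by auto
  have ar2: "arc g c e" if "z + 1 \<le> e + N" "e + N \<le> z + n - 1" for e
    using ar[of "e + N * 1"] arc_shift[OF p, of c e 1] that by auto
  have "\<exists>e. arc g c e \<and> 0 \<le> e \<and> e \<le> 2 * n \<and> e \<noteq> n \<and> min e (2 * n - e) \<le> h + 1"
  proof -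
    \<comment> \<open>Inside \<open>{1..n}\<close> the arc extends as far as possible to the left or
      to the right, whichever leaves \<open>{1..n}\<close> sooner. For \<open>z > n\<close> at most
      one residue overlaps.\<close>
    consider "z \<le> h" | "h < z" "z \<le> n" | "n < z" "z < 2 * n" | "z = 2 * n" | "z = 2 * n + 1"
      using j unfolding z_def by linarith
    then show ?thesis
    proof cases
      case 1 then show ?thesis using ar[of "z + 1"] n4 j unfolding z_def by (intro exI[of _ "z + 1"]) (auto simp: z_def)
    next
      case 2 then show ?thesis using ar[of "z + n - 1"] n4 by (intro exI[of _ "z + n - 1"]) auto
    next
      case 3 then show ?thesis using ar[of "2 * n"] n4 by (intro exI[of _ "2 * n"]) auto
    next
      case 4 then show ?thesis using ar2[of 0] n4 by (intro exI[of _ 0]) auto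
    next
      case 5 then show ?thesis using ar2[of 1] n4 by (intro exI[of _ 1]) auto
    qed
  qed
  then obtain e where "arc g c e" "0 \<le> e" "e \<le> 2 * n" "e \<noteq> n" "min e (2 * n - e) \<le> h + 1" by blast
  moreover from this have "s + max 1 (min e (2 * n - e)) \<le> h + 1 + cnt g c" using s n4 by linarith
  ultimately show ?thesis unfolding good_def using g c by blast
qed


section \<open>Moving single residues, and the bases of triples\<close>

lemma J_D: "J f c p \<Longrightarrow> p < x \<Longrightarrow> x < p + N \<Longrightarrow> f x = c \<Longrightarrow>
    x = p + n \<or> p + n + 2 \<le> x \<and> x \<le> p + 2 * n - 1"
  unfolding J_def by blast

lemma K_D: "K f c q \<Longrightarrow> q < x \<Longrightarrow> x < q + N \<Longrightarrow> f x = c \<Longrightarrow> x = q + n \<or> x = q + n + 1"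
  unfolding K_def by blast

lemma arc_D: "arc f c e \<Longrightarrow> e < x \<Longrightarrow> x < e + n + 2 \<Longrightarrow> f x \<noteq> c"
  unfolding arc_def by blast

lemma J_in: "J f c p \<Longrightarrow> f p = c" "J f c p \<Longrightarrow> f (p + n) = c"
  unfolding J_def by blast+

lemma K_in: "K f c q \<Longrightarrow> f q = c" "K f c q \<Longrightarrow> f (q + n) = c" "K f c q \<Longrightarrow> f (q + n + 1) = c"
  unfolding K_def by blast+

definition acc :: "(int \<Rightarrow> nat) \<Rightarrow> nat \<Rightarrow> int \<Rightarrow> bool" where
  "acc f r x \<longleftrightarrow> acy (\<lambda>y. f y = r \<or> N dvd y - x)"

lemma rcv_acc:
  assumes a: "rcv f r l u" "l \<le> x + N * j" "x + N * j \<le> u"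
  shows "acc f r x"
  unfolding acc_def
proof (rule acy_mono[OF a(1)[unfolded rcv_def]])
  fix y assume "f y = r \<or> N dvd y - x"
  moreover have "\<exists>j. l \<le> y + N * j \<and> y + N * j \<le> u" if "N dvd y - x"
  proof -
    from that obtain i where "y - x = N * i" by (rule dvdE)
    then have "y + N * (j - i) = x + N * j" by (simp add: algebra_simps)
    then show ?thesis using a by metis
  qed
  ultimately show "f y = r \<or> (\<exists>j. l \<le> y + N * j \<and> y + N * j \<le> u)" by blast
qed

lemma acc_move: "col f \<Longrightarrow> r \<in> {1..k} \<Longrightarrow> acc f r x \<Longrightarrow> reach f (upd f x r) 1"
  unfolding acc_def by (rule move)

lemma upd_shift: "upd f (x + N * j) r = upd f x r"
proof -
  have "N dvd y - (x + N * j) \<longleftrightarrow> N dvd y - x" for y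
  proof -
    have "y - (x + N * j) = y - x - N * j" by simp
    then show ?thesis by (metis dvd_diff_right_iff dvd_triv_left dvd_diff_commute)
  qed
  then show ?thesis unfolding upd_def by auto
qed

lemma cnt_upd_other:
  assumes f: "per f" and x: "f x \<noteq> c" "r \<noteq> c"
  shows "cnt (upd f x r) c = cnt f c"
proof -
  have "{y \<in> {x..<x + N}. upd f x r y = c} = {y \<in> {x..<x + N}. f y = c}"
    using upd_window[of x _ x f r] x by (auto split: if_splits)
  then show ?thesis using cnt_window[OF f, of c x] cnt_window[OF upd_per[OF f], of x r c x] by simp
qed

lemma K_cnt:
  assumes f: "per f" and q: "K f c q"
  shows "cnt f c = 3"
proof -
  have "{y \<in> {q..<q + N}. f y = c} = {q, q + n, q + n + 1}"
  proof (rule set_eqI)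
    fix y
    show "y \<in> {y \<in> {q..<q + N}. f y = c} \<longleftrightarrow> y \<in> {q, q + n, q + n + 1}"
      using q n4 spec[of _ y] unfolding K_def by (cases "y = q") (auto, force)
  qed
  moreover have "card {q, q + n, q + n + 1} = 3" using n4 by simp
  ultimately show ?thesis using cnt_window[OF f, of c q] by simp
qed

lemma acc_arc: "per f \<Longrightarrow> arc f c e \<Longrightarrow> e - n + 1 \<le> x + N * j \<Longrightarrow> x + N * j \<le> e \<Longrightarrow> acc f c x"
  by (rule rcv_acc[OF rcv_arc[of f c e "e - n + 1" e]]) auto

lemma acc_J: "per f \<Longrightarrow> J f c p \<Longrightarrow> p - n + 1 \<le> x + N * j \<Longrightarrow> x + N * j \<le> p - 2 \<Longrightarrow> acc f c x"
  by (rule rcv_acc[OF rcv_J[of f c p "p - n + 1" "p - 2"]]) auto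

text \<open>Both triples would contain \<open>q + n + 1\<close> and so have the same color, but a
  triple omits the residue after its base.\<close>

lemma K_adjacent:
  assumes f: "per f" and q: "K f c q" "K f c' (q + 1)"
  shows False
proof -
  have e: "q + 1 + n = q + n + 1" by simp
  have "c' = c" using K_in(2)[OF q(2), unfolded e] K_in(3)[OF q(1)] by (simp only:)
  then have "f (q + 1) = c" using K_in(1)[OF q(2)] by (simp only:)
  then show False using K_D[OF q(1), of "q + 1"] n4 by linarith
qed

text \<open>If \<open>b\<close> lay in an arc that begins or ends next to \<open>q\<close>, this arc
  could be shifted by one so as to take in \<open>q\<close>: the residue it loses is
  \<open>q + n\<close> or \<open>q + n + 1\<close> modulo \<open>N\<close> and belongs to the
  triple. So \<open>b\<close> has the form \<open>J\<close>, and as it cannot receive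
  \<open>q\<close>, the base lies strictly between the two residues of \<open>b\<close> at distance
  \<open>n\<close>.\<close>

lemma K_neighbour:
  assumes f: "col f" and q: "K f c q" and cb: "c \<noteq> b" and nK: "\<And>q. \<not> K f b q" and na: "\<not> acc f b q"
  shows "f (q - 1) = b \<Longrightarrow> J f b (q - 1)" "f (q + 1) = b \<Longrightarrow> J f b (q + 1 - n)"
proof -
  have p: "per f" using col_per[OF f] .
  have fq: "f q = c" "f (q + n) = c" "f (q + n + 1) = c" using q unfolding K_def by auto
  have "(f (q - 1) = b \<longrightarrow> J f b (q - 1)) \<and> (f (q + 1) = b \<longrightarrow> J f b (q + 1 - n))"
  proof (rule class_cases_window[OF f, of b "q - n - 1"])
    fix e assume e: "arc f b e" "q - n - 1 \<le> e" "e < q - n - 1 + N"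
    have eq: "e < q" using acc_arc[OF p e(1), of q 0] e na by force
    have "f (q - 1) \<noteq> b"
    proof
      assume a: "f (q - 1) = b"
      then have "e = q - 1" using e(1)[unfolded arc_def, rule_format, of "q - 1"] eq e(2) n4 by linarith
      moreover have "f (q - n) = c" using fq(3) per_shift[OF p, of "q + n + 1"] by (simp add: algebra_simps)
      have "arc f b q" unfolding arc_def
      proof (intro allI impI)
        fix x assume x: "q < x \<and> x < q + n + 2"
        show "f x \<noteq> b"
        proof (cases "x = q + n + 1")
          case True then show ?thesis using fq cb by simp
        next
          case False then show ?thesis using e(1) x \<open>e = q - 1\<close> unfolding arc_def by auto
        qed
      qed
      then show False using acc_arc[OF p, of b q q 0] na n4 by auto
    qed
    moreover have "f (q + 1) \<noteq> b"
    proof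
      assume a: "f (q + 1) = b"
      then have "e = q - n - 1" using e(1)[unfolded arc_def, rule_format, of "q + 1"] eq e(2) n4 by linarith
      have "arc f b (q - n - 2)" unfolding arc_def
      proof (intro allI impI)
        fix x assume x: "q - n - 2 < x \<and> x < q - n - 2 + n + 2"
        show "f x \<noteq> b"
        proof (cases "x = q - n - 1")
          case True
          then have "x + N = q + n" by simp
          then show ?thesis using fq cb per_plus[OF p, of x] by metis
        next
          case False then show ?thesis using e(1) x \<open>e = q - n - 1\<close> unfolding arc_def by auto
        qed
      qed
      then have "arc f b (q - n - 2 + N * 1)" using arc_shift[OF p] by blast
      then show False using acc_arc[OF p, of b _ q 0] na n4 by force
    qed
    ultimately show ?thesis by blast
  next
    fix w assume w0: "K f b w"
    then show ?thesis using nK by blast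
  next
    fix u assume u0: "J f b u"
    obtain j where j: "q - N + 1 \<le> u + N * j" "u + N * j < q - N + 1 + N" by (rule window_rep)
    define v where "v = u + N * j"
    have v: "J f b v" "q - N < v" "v \<le> q" using J_shift[OF p u0] j unfolding v_def by auto
    have vq: "v \<noteq> q" "v + n \<noteq> q" using v(1) fq cb unfolding J_def by auto
    have "\<not> (v + n + 2 \<le> q \<and> q \<le> v + 2 * n - 1)" using acc_J[OF p v(1), of q "-1"] na by auto
    moreover have "q \<noteq> v + n + 1"
      using v(1) fq cb per_plus[OF p, of v] unfolding J_def by (auto simp: algebra_simps)
    moreover have "q \<noteq> v + 2 * n"
    proof
      assume "q = v + 2 * n"
      then have "f (v + n + N) = c" using fq(3) by (simp add: algebra_simps)
      then show False using v(1) cb per_plus[OF p, of "v + n"] unfolding J_def by auto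
    qed
    ultimately have r: "v < q" "q < v + n" using v vq by auto
    have vJ: "x = v + n \<or> v + n + 2 \<le> x \<and> x \<le> v + 2 * n - 1" if "v < x" "x < v + N" "f x = b" for x
      using v(1) that unfolding J_def by blast
    have "q - 1 = v" if "f (q - 1) = b" using vJ[of "q - 1"] r that n4 by linarith
    moreover have "q + 1 - n = v" if "f (q + 1) = b" using vJ[of "q + 1"] r that n4 by linarith
    ultimately show ?thesis using v(1) by metis
  qed
  then show "f (q - 1) = b \<Longrightarrow> J f b (q - 1)" "f (q + 1) = b \<Longrightarrow> J f b (q + 1 - n)" by blast+
qed

text \<open>Bases are never adjacent, so the neighbours of \<open>q\<close> in the run have color
  \<open>b\<close>, and \<open>K_neighbour\<close> fixes the shape of \<open>b\<close>. Neighbours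
  on both sides give incompatible shapes. At an end of the run, the residue two steps inside must be
  a base, and its triple contains a residue of \<open>b\<close>; this is why the run needs three
  residues.\<close>

lemma K_run:
  assumes f: "col f" and xy: "x + 2 \<le> y" and H: "\<And>z. x \<le> z \<Longrightarrow> z \<le> y \<Longrightarrow> f z = b \<or> (\<exists>c. K f c z)"
    and nK: "\<And>q. \<not> K f b q" and q: "K f c q" "x \<le> q" "q \<le> y" and na: "\<not> acc f b q"
  shows False
proof -
  have p: "per f" using col_per[OF f] .
  have cb: "c \<noteq> b" using nK q by auto
  note nb = K_neighbour[OF f q(1) cb nK na]
  have L: "J f b (q - 1)" if "x \<le> q - 1"
  proof -
    have "\<not> K f c' (q - 1)" for c' using K_adjacent[OF p, of c' "q - 1" c] q by auto
    then show ?thesis using nb(1) H[of "q - 1"] that q by auto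
  qed
  have R: "J f b (q + 1 - n)" if "q + 1 \<le> y"
  proof -
    have "\<not> K f c' (q + 1)" for c' using K_adjacent[OF p, of c q c'] q by auto
    then show ?thesis using nb(2) H[of "q + 1"] that q by auto
  qed
  consider "x \<le> q - 1" "q + 1 \<le> y" | "q = y" | "q = x" using q by linarith
  then show False
  proof cases
    case 1
    have "f (q + 1) = b" using R[OF 1(2)] unfolding J_def by auto
    then show False using J_D[OF L[OF 1(1)], of "q + 1"] n4 by linarith
  next
    case 2
    have l: "J f b (q - 1)" using L 2 xy by simp
    have "f (q - 2) \<noteq> b"
    proof
      assume "f (q - 2) = b"
      then have "f (q - 1 + 2 * n) = b" using per_plus[OF p, of "q - 2"] by (simp add: algebra_simps)
      then show False using J_D[OF l, of "q - 1 + 2 * n"] n4 by linarith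
    qed
    then obtain c' where c': "K f c' (q - 2)" using H[of "q - 2"] 2 xy by auto
    have e: "q - 2 + n + 1 = q - 1 + n" by simp
    have "c' = b" using K_in(3)[OF c', unfolded e] J_in(2)[OF l] by (simp only:)
    then show False using c' nK by auto
  next
    case 3
    have l: "J f b (q + 1 - n)" using R 3 xy by simp
    have "f (q + 2) \<noteq> b"
    proof
      assume "f (q + 2) = b"
      then show False using J_D[OF l, of "q + 2"] n4 by linarith
    qed
    then obtain c' where c': "K f c' (q + 2)" using H[of "q + 2"] 3 xy by auto
    have e: "q + 2 + n = q + 1 - n + N" by simp
    have "c' = b" using K_in(2)[OF c', unfolded e] J_in(1)[OF l] per_plus[OF p, of "q + 1 - n"] by (simp only:)
    then show False using c' nK by auto
  qed
qed

text \<open>Around the antipode of a class that is not a triple \<open>K\<close>, a blocked triple has only its base.\<close>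

lemma K_gap:
  assumes f: "col f" and d: "\<And>q. \<not> K f d q"
  obtains x y where "x + 2 \<le> y" "\<And>z. x \<le> z \<Longrightarrow> z \<le> y \<Longrightarrow> f z \<noteq> d"
    "\<And>c q. K f c q \<Longrightarrow> \<not> acc f d q \<Longrightarrow> \<exists>j. x \<le> q + N * j \<and> q + N * j \<le> y"
    "\<And>c q z. K f c q \<Longrightarrow> \<not> acc f d q \<Longrightarrow> x \<le> z \<Longrightarrow> z \<le> y \<Longrightarrow> f z = c \<Longrightarrow> K f c z"
proof -
  note thesisI = that
  have p: "per f" using col_per[OF f] .
  \<comment> \<open>The bound \<open>y \<le> x + n - 2\<close> keeps the other two residues of a
    triple, both at distance \<open>n\<close> from its base, out of a window that contains the
    base.\<close>
  have main: thesis if xy: "x + 2 \<le> y" "y \<le> x + n - 2" and nd: "\<And>z. x \<le> z \<Longrightarrow> z \<le> y \<Longrightarrow> f z \<noteq> d"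
    and rep: "\<And>c q. K f c q \<Longrightarrow> \<not> acc f d q \<Longrightarrow> \<exists>j. x \<le> q + N * j \<and> q + N * j \<le> y" for x y
  proof (rule thesisI[of x y, OF xy(1)])
    fix c q z assume K: "K f c q" "\<not> acc f d q" and z: "x \<le> z" "z \<le> y" "f z = c"
    obtain j where j: "x \<le> q + N * j" "q + N * j \<le> y" using rep[OF K] by blast
    have K': "K f c (q + N * j)" by (rule K_shift[OF p K(1)])
    define v where "v = q + N * j"
    have "z = v"
    proof (rule ccontr)
      assume "z \<noteq> v"
      then consider "v < z" | "v < z + N" "z < v" using z j xy unfolding v_def by linarith
      then show False
      proof cases
        case 1
        then show ?thesis using K' z j xy n4 unfolding K_def v_def[symmetric] by force
      next
        case 2
        then have "z + N = v + n \<or> z + N = v + n + 1" using K' z per_plus[OF p, of z] unfolding K_def v_def[symmetric] by auto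
        then show ?thesis using z j xy unfolding v_def by linarith
      qed
    qed
    then show "K f c z" using K' unfolding v_def by simp
  qed (use nd rep in blast)+
  show thesis
  proof (rule class_cases[OF f, of d])
    fix e assume e: "arc f d e"
    show thesis
    proof (rule main[of "e + 2" "e + n"])
      fix c q assume K: "K f c q" and na: "\<not> acc f d q"
      obtain j where j: "e - n + 1 \<le> q + N * j" "q + N * j < e - n + 1 + N" by (rule window_rep)
      define v where "v = q + N * j"
      have Kv: "K f c v" unfolding v_def by (rule K_shift[OF p K])
      have cd: "c \<noteq> d" using K d by auto
      have "e < v" using acc_arc[OF p e, of q j] na j unfolding v_def by force
      \<comment> \<open>At the outermost positions \<open>e + 1\<close> and \<open>e + n + 1\<close>
        the arc could be shifted by one to receive the base: the residue it would have to give up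
        belongs to the triple.\<close>
      moreover have "v \<noteq> e + 1"
      proof
        assume v: "v = e + 1"
        have "arc f d (e + 1)" unfolding arc_def
        proof (intro allI impI)
          fix x assume x: "e + 1 < x \<and> x < e + 1 + n + 2"
          show "f x \<noteq> d"
          proof (cases "x = e + n + 2")
            case True then show ?thesis using Kv v cd unfolding K_def by (simp add: algebra_simps)
          next
            case False then show ?thesis using e x unfolding arc_def by auto
          qed
        qed
        then show False using acc_arc[OF p, of d "e + 1" q j] na v n4 unfolding v_def by auto
      qed
      moreover have "v \<noteq> e + n + 1"
      proof
        assume v: "v = e + n + 1"
        have "arc f d (e - 1)" unfolding arc_def
        proof (intro allI impI)
          fix x assume x: "e - 1 < x \<and> x < e - 1 + n + 2"
          show "f x \<noteq> d"
          proof (cases "x = e")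
            case True then show ?thesis using Kv v cd per_plus[OF p, of e] unfolding K_def by (auto simp add: algebra_simps)
          next
            case False then show ?thesis using e x unfolding arc_def by auto
          qed
        qed
        moreover have "q + N * (j - 1) = v - N" unfolding v_def by (simp add: algebra_simps)
        ultimately show False using acc_arc[OF p, of d "e - 1" q "j - 1"] na v n4 by auto
      qed
      ultimately show "\<exists>j. e + 2 \<le> q + N * j \<and> q + N * j \<le> e + n" using j unfolding v_def by (intro exI[of _ j]) auto
    qed (use e n4 in \<open>auto simp: arc_def\<close>)
  next
    fix u assume u: "J f d u"
    show thesis
    proof (rule main[of "u + 1" "u + n - 1"])
      fix c q assume K: "K f c q" and na: "\<not> acc f d q"
      obtain j where j: "u \<le> q + N * j" "q + N * j < u + N" by (rule window_rep)
      define v where "v = q + N * j"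
      have Kv: "K f c v" unfolding v_def by (rule K_shift[OF p K])
      have cd: "c \<noteq> d" using K d by auto
      have "v \<noteq> u" "v \<noteq> u + n" using u Kv cd unfolding J_def K_def by auto
      moreover have "\<not> (u + n + 2 \<le> v \<and> v \<le> u + 2 * n - 1)"
      proof -
        have "q + N * (j - 1) = v - N" unfolding v_def by (simp add: algebra_simps)
        then show ?thesis using acc_J[OF p u, of q "j - 1"] na by auto
      qed
      moreover have "v \<noteq> u + n + 1"
        using u Kv cd per_plus[OF p, of u] unfolding J_def K_def by (auto simp: algebra_simps)
      moreover have "v \<noteq> u + 2 * n"
        using u Kv cd per_plus[OF p, of "u + n"] unfolding J_def K_def by (auto simp: algebra_simps)
      ultimately show "\<exists>j. u + 1 \<le> q + N * j \<and> q + N * j \<le> u + n - 1" using j unfolding v_def by (intro exI[of _ j]) auto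
    next
      show "f z \<noteq> d" if "u + 1 \<le> z" "z \<le> u + n - 1" for z
      proof
        assume "f z = d"
        then have "z = u + n \<or> u + n + 2 \<le> z" using u that n4 unfolding J_def by force
        then show False using that by linarith
      qed
    qed (use n4 in auto)
  qed (use d in auto)
qed

text \<open>In the window that \<open>K_gap\<close> provides for \<open>d\<close>, every residue has
  color \<open>d'\<close> or is a base. Either \<open>K_run\<close> applies to \<open>d'\<close>, or
  two adjacent residues are bases. The lemma serves to produce further classes that are not
  triples.\<close>

lemma K_two:
  assumes f: "col f" and d: "\<And>q. \<not> K f d q"
    and all: "\<And>x. f x \<noteq> d \<Longrightarrow> f x \<noteq> d' \<Longrightarrow> \<exists>q. K f (f x) q"
    and ex: "K f c q" and na: "\<And>c q r x. K f c q \<Longrightarrow> f x = r \<Longrightarrow> (\<And>q. \<not> K f r q) \<Longrightarrow> \<not> acc f r q" and dx: "\<exists>x. f x = d"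
  shows False
proof -
  have p: "per f" using col_per[OF f] .
  have nd: "\<not> acc f d q" if "K f c q" for c q using na[OF that] dx d by blast
  obtain x y where xy: "x + 2 \<le> y" "\<And>z. x \<le> z \<Longrightarrow> z \<le> y \<Longrightarrow> f z \<noteq> d"
    "\<And>c q. K f c q \<Longrightarrow> \<not> acc f d q \<Longrightarrow> \<exists>j. x \<le> q + N * j \<and> q + N * j \<le> y"
    "\<And>c q z. K f c q \<Longrightarrow> \<not> acc f d q \<Longrightarrow> x \<le> z \<Longrightarrow> z \<le> y \<Longrightarrow> f z = c \<Longrightarrow> K f c z"
    using K_gap[OF f d] by blast
  have H: "f z = d' \<or> (\<exists>c. K f c z)" if "x \<le> z" "z \<le> y" for z
    using all[of z] xy(2)[OF that] xy(4)[OF _ nd that] by blast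
  show False
  proof (cases "(\<exists>x. f x = d') \<and> (\<forall>q. \<not> K f d' q)")
    case True
    obtain j where j: "x \<le> q + N * j" "q + N * j \<le> y" using xy(3)[OF ex nd[OF ex]] by blast
    have "\<not> acc f d' (q + N * j)" using na[OF K_shift[OF p ex]] True by blast
    then show False using K_run[OF f xy(1) H _ K_shift[OF p ex] j] True by blast
  next
    case False
    then have "\<exists>c. K f c z" if "x \<le> z" "z \<le> y" for z using H[OF that] xy(4)[OF _ nd that] by blast
    then obtain c c' where "K f c x" "K f c' (x + 1)" using xy(1) by force
    then show False using K_adjacent[OF p] by blast
  qed
qed


text \<open>The color \<open>r1\<close> takes the residues in its range and \<open>r2\<close> the
  others. For \<open>r1 = r2\<close> the ranges must agree, because two ranges that can be received
  separately need not be receivable together.\<close>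

lemma clear:
  assumes f: "col f" and ad: "a \<le> d" "d < a + N" and c: "c \<noteq> r1" "c \<noteq> r2" and rk: "r1 \<in> {1..k}" "r2 \<in> {1..k}"
    and rc: "rcv f r1 l1 u1" "rcv f r2 l2 u2" and eq: "r1 = r2 \<Longrightarrow> l1 = l2 \<and> u1 = u2"
    and cov: "\<And>x. a \<le> x \<Longrightarrow> x \<le> d \<Longrightarrow> f x = c \<Longrightarrow> l1 \<le> x \<and> x \<le> u1 \<or> l2 \<le> x \<and> x \<le> u2"
  obtains g where "reach f g (int (card {x \<in> {a..d}. f x = c}))"
    "cnt g c = int (card {x \<in> {d<..<a + N}. f x = c})"
    "\<And>x. a \<le> x \<Longrightarrow> x \<le> d \<Longrightarrow> g x \<noteq> c" "\<And>x. d < x \<Longrightarrow> x < a + N \<Longrightarrow> g x = f x"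
proof -
  define g where "g = ext a (\<lambda>x. if x \<le> d \<and> f x = c then if l1 \<le> x \<and> x \<le> u1 then r1 else r2 else f x)"
  have gw: "g x = (if x \<le> d \<and> f x = c then if l1 \<le> x \<and> x \<le> u1 then r1 else r2 else f x)" if "a \<le> x" "x < a + N" for x
    unfolding g_def using ext_window[OF that] .
  have p: "per f" using col_per[OF f] .
  have pg: "per g" unfolding g_def by (rule ext_per)
  have kf: "f x \<in> {1..k}" for x using f unfolding col_def by blast
  have s: "reach f g (int (card {x \<in> {a..d}. f x = c}))"
  proof (rule recolor[OF f pg])
    show "g x \<in> {1..k}" for x unfolding g_def by (rule ext_range) (use rk kf in presburger)
    show "acy (\<lambda>x. f x = t \<or> g x = t)" for t
    proof -
      consider "t = r1" | "t = r2" "t \<noteq> r1" | "t \<noteq> r1" "t \<noteq> r2" by blast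
      then show ?thesis
      proof cases
        case 1
        show ?thesis
        proof (rule acy_mono[OF rc(1)[unfolded rcv_def]])
          fix x assume x: "f x = t \<or> g x = t"
          show "f x = r1 \<or> (\<exists>j. l1 \<le> x + N * j \<and> x + N * j \<le> u1)"
          proof (cases "f x = t")
            case False
            obtain j where j: "a \<le> x + N * j" "x + N * j < a + N" by (rule window_rep)
            have "g (x + N * j) = t" "f (x + N * j) \<noteq> t" using x False per_mult[OF p] per_mult[OF pg] by auto
            then have "l1 \<le> x + N * j \<and> x + N * j \<le> u1 \<or> r1 = r2 \<and> f (x + N * j) = c \<and> x + N * j \<le> d"
              using gw[OF j] 1 by (metis (full_types))
            then show ?thesis using cov[OF j(1)] eq by blast
          qed (use 1 in blast)
        qed
      next
        case 2
        show ?thesis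
        proof (rule acy_mono[OF rc(2)[unfolded rcv_def]])
          fix x assume x: "f x = t \<or> g x = t"
          show "f x = r2 \<or> (\<exists>j. l2 \<le> x + N * j \<and> x + N * j \<le> u2)"
          proof (cases "f x = t")
            case False
            obtain j where j: "a \<le> x + N * j" "x + N * j < a + N" by (rule window_rep)
            have "g (x + N * j) = t" "f (x + N * j) \<noteq> t" using x False per_mult[OF p] per_mult[OF pg] by auto
            then have "f (x + N * j) = c \<and> x + N * j \<le> d \<and> \<not> (l1 \<le> x + N * j \<and> x + N * j \<le> u1)"
              using gw[OF j] 2 by (metis (full_types))
            then show ?thesis using cov[OF j(1)] by blast
          qed (use 2 in blast)
        qed
      next
        case 3
        show ?thesis by (rule keep_window[OF f pg, of a]) (use gw 3 in metis)
      qed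
    qed
    have "{x \<in> {a..<a + N}. f x \<noteq> g x} \<subseteq> {x \<in> {a..d}. f x = c}"
    proof
      fix x assume x: "x \<in> {x \<in> {a..<a + N}. f x \<noteq> g x}"
      then have "x \<le> d \<and> f x = c" using gw[of x] by (auto split: if_splits)
      then show "x \<in> {x \<in> {a..d}. f x = c}" using x by auto
    qed
    moreover have "finite {x \<in> {a..d}. f x = c}" by (rule finite_subset[of _ "{a..d}"]) auto
    ultimately show "int (card {x \<in> {a..<a + N}. f x \<noteq> g x}) \<le> int (card {x \<in> {a..d}. f x = c})"
      using card_mono of_nat_mono by blast
  qed
  have 1: "g x \<noteq> c" if "a \<le> x" "x \<le> d" for x
  proof -
    have "x < a + N" using that ad by linarith
    from gw[OF that(1) this] show ?thesis using that c by metis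
  qed
  have 2: "g x = f x" if "d < x" "x < a + N" for x using gw[of x] that ad by auto
  have "{x \<in> {a..<a + N}. g x = c} = {x \<in> {d<..<a + N}. f x = c}"
  proof (rule set_eqI)
    fix x
    have "a \<le> x \<and> x < a + N \<and> g x = c \<longleftrightarrow> d < x \<and> x < a + N \<and> f x = c"
      using 1[of x] 2[of x] ad by (cases "x \<le> d") auto
    then show "x \<in> {x \<in> {a..<a + N}. g x = c} \<longleftrightarrow> x \<in> {x \<in> {d<..<a + N}. f x = c}"
      by simp
  qed
  then have "cnt g c = int (card {x \<in> {d<..<a + N}. f x = c})" using cnt_window[OF pg, of c a] by simp
  then show thesis using that s 1 2 by blast
qed

text \<open>Here \<open>I\<close> is the reserved arc \<open>{1..n}\<close>, and \<open>Q\<close>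
  below is its complement \<open>{n + 1..2 * n + 1}\<close>.\<close>

definition inI :: "(int \<Rightarrow> nat) \<Rightarrow> nat \<Rightarrow> int" where
  "inI f c = int (card {x \<in> {1..n}. f x = c})"

definition inQ :: "(int \<Rightarrow> nat) \<Rightarrow> nat \<Rightarrow> int" where
  "inQ f c = int (card {x \<in> {n<..<1 + N}. f x = c})"

lemma cnt_split: "per f \<Longrightarrow> cnt f c = inI f c + inQ f c"
proof -
  assume p: "per f"
  have "{x \<in> {1..<1 + N}. f x = c} = {x \<in> {1..n}. f x = c} \<union> {x \<in> {n<..<1 + N}. f x = c}" using n4 by auto
  moreover have "card ({x \<in> {1..n}. f x = c} \<union> {x \<in> {n<..<1 + N}. f x = c}) =
      card {x \<in> {1..n}. f x = c} + card {x \<in> {n<..<1 + N}. f x = c}"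
    by (rule card_Un_disjoint) (auto intro: finite_subset[of _ "{1..n}"] finite_subset[of _ "{n<..<1 + N}"])
  ultimately show ?thesis unfolding inI_def inQ_def using cnt_window[OF p, of c 1] by simp
qed

lemma inQ_pos: "n < x \<Longrightarrow> x \<le> N \<Longrightarrow> f x = c \<Longrightarrow> 1 \<le> inQ f c"
proof -
  assume x: "n < x" "x \<le> N" "f x = c"
  have "x \<in> {n<..<1 + N}" using x by simp
  then have "{x \<in> {n<..<1 + N}. f x = c} \<noteq> {}" using x by blast
  moreover have "finite {x \<in> {n<..<1 + N}. f x = c}" by (rule finite_subset[of _ "{n<..<1 + N}"]) auto
  ultimately have "card {x \<in> {n<..<1 + N}. f x = c} \<noteq> 0" by (simp only: card_0_eq not_False_eq_True)
  then show ?thesis unfolding inQ_def by linarith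
qed

lemma inI_two:
  assumes "c \<noteq> d"
  shows "inI f c + inI f d \<le> n"
proof -
  have "card {x \<in> {1..n}. f x = c} + card {x \<in> {1..n}. f x = d} = card ({x \<in> {1..n}. f x = c} \<union> {x \<in> {1..n}. f x = d})"
    by (rule card_Un_disjoint[symmetric]) (use assms in \<open>auto intro: finite_subset[of _ "{1..n}"]\<close>)
  also have "\<dots> \<le> card {1..n}" by (rule card_mono) auto
  finally show ?thesis unfolding inI_def using n4 by simp
qed

lemma J_refl:
  assumes p: "per f" and u: "J f c u"
  shows "J (\<lambda>x. f (n + 1 - x)) c (1 - u)"
proof -
  have "x = 1 - u + n \<or> 1 - u + n + 2 \<le> x \<and> x \<le> 1 - u + 2 * n - 1"
    if x: "1 - u < x" "x < 1 - u + N" "f (n + 1 - x) = c" for x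
  proof (cases "u < n + 1 - x")
    case True
    then show ?thesis using J_D[OF u, of "n + 1 - x"] x by force
  next
    case False
    have "f (n + 1 - x + N) = c" using x per_plus[OF p, of "n + 1 - x"] by simp
    moreover have "u < n + 1 - x + N" using x by simp
    ultimately have "n + 1 - x + N = u + n \<or> n + 1 - x + N = u + N \<or> u + n + 2 \<le> n + 1 - x + N \<and> n + 1 - x + N \<le> u + 2 * n - 1"
      using J_D[OF u, of "n + 1 - x + N"] False x by (cases "n + 1 - x = u") auto
    then show ?thesis using x by linarith
  qed
  moreover have "f (n + 1 - (1 - u)) = c" "f (n + 1 - (1 - u + n)) = c" using u unfolding J_def by (simp_all add: algebra_simps)
  ultimately show ?thesis unfolding J_def by blast
qed

lemma K_refl:
  assumes p: "per f" and q: "K f c q"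
  shows "K (\<lambda>x. f (n + 1 - x)) c (n + 1 - q)"
proof -
  have "x = n + 1 - q + n \<or> x = n + 1 - q + n + 1"
    if x: "n + 1 - q < x" "x < n + 1 - q + N" "f (n + 1 - x) = c" for x
  proof -
    have "f (n + 1 - x + N) = c" using x per_plus[OF p, of "n + 1 - x"] by simp
    then have "n + 1 - x + N = q + n \<or> n + 1 - x + N = q + n + 1" using K_D[OF q, of "n + 1 - x + N"] x by auto
    then show ?thesis by linarith
  qed
  moreover have "f (n + 1 - (n + 1 - q)) = c" using q unfolding K_def by simp
  moreover have "f (n + 1 - (n + 1 - q + n)) = c"
    using q per_shift[OF p, of "q + n + 1"] unfolding K_def by (simp add: algebra_simps)
  moreover have "f (n + 1 - (n + 1 - q + n + 1)) = c"
    using q per_shift[OF p, of "q + n"] unfolding K_def by (simp add: algebra_simps)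
  ultimately show ?thesis unfolding K_def by blast
qed

end

section \<open>Colorings without a good class\<close>

text \<open>In the following locale, every class turns out to be a triple \<open>K\<close>.\<close>

locale bad = circ_params +
  fixes f :: "int \<Rightarrow> nat" and b :: nat
  assumes f: "col f" and ng: "\<not> good b f" and ne: "\<And>c. c \<in> {1..k} \<Longrightarrow> \<exists>x. f x = c"
begin

lemma pf: "per f"
  using col_per[OF f] .

lemma kf: "f x \<in> {1..k}"
  using f unfolding col_def by blast

text \<open>No step is spent on this class, so the failure of \<open>good\<close> pushes the end of
  its arc towards \<open>n\<close>, where the overlap is large.\<close>

lemma bad_arc:
  assumes c: "c \<in> {1..k}" "c \<noteq> b" and a: "arc f c e" and e: "0 \<le> e" "e \<le> 2 * n" "e \<noteq> n"
  shows "h + 2 + cnt f c \<le> min e (2 * n - e)" "h + 3 \<le> min e (2 * n - e)"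
proof -
  have "\<not> (0 + max 1 (min e (2 * n - e)) \<le> h + 1 + cnt f c)"
    using ng reach_refl[OF f, of 0] c a e unfolding good_def by blast
  moreover have "1 \<le> cnt f c" using ne[OF c(1)] cnt_pos[OF pf] by blast
  ultimately show "h + 2 + cnt f c \<le> min e (2 * n - e)" "h + 3 \<le> min e (2 * n - e)" using n4 by linarith+
qed

lemma bad_upd:
  assumes c: "c \<noteq> b" and x: "f x = c" and r: "r \<noteq> c" "r \<in> {1..k}" "acc f r x"
    and a: "arc (upd f x r) c e" and e: "0 \<le> e" "e \<le> 2 * n" "e \<noteq> n"
  shows "h + cnt f c \<le> max 1 (min e (2 * n - e))"
proof -
  have "c \<in> {1..k}" using kf x by blast
  then have "\<not> (1 + max 1 (min e (2 * n - e)) \<le> h + 1 + cnt (upd f x r) c)"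
    using ng acc_move[OF f r(2,3)] c a e unfolding good_def by blast
  then show ?thesis using cnt_upd[OF pf x r(1)] by linarith
qed

lemma J_two:
  assumes "J f c p"
  shows "2 \<le> cnt f c"
proof -
  have "{p, p + n} \<subseteq> {y \<in> {p..<p + N}. f y = c}" using assms n4 unfolding J_def by auto
  then have "card {p, p + n} \<le> card {y \<in> {p..<p + N}. f y = c}"
    by (rule card_mono[rotated]) (auto intro: finite_subset[of _ "{p..<p + N}"])
  then show ?thesis using cnt_window[OF pf, of c p] n4 by simp
qed

text \<open>Losing \<open>p\<close> leaves a class in the arc that ends with \<open>p - 2\<close>;
  losing \<open>p + n\<close>, as in \<open>J_drop2\<close>, leaves one in the arc that ends with
  \<open>p\<close>. Either costs one step.\<close>

lemma J_drop1:
  assumes J: "J f c p" and c: "c \<noteq> b" and r: "r \<noteq> c" "r \<in> {1..k}" "acc f r p" and p: "2 \<le> p" "p \<le> 2 * n + 2" "p \<noteq> n + 2"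
  shows "h + cnt f c \<le> max 1 (min (p - 2) (2 * n + 2 - p))"
proof -
  have "arc (upd f p r) c (p - 2)"
  proof (rule upd_arc[OF pf r(1)])
    fix y assume y: "p - 2 < y" "y < p - 2 + n + 2" "y \<noteq> p"
    show "f y \<noteq> c"
    proof (cases "y < p")
      case True
      then have "y + N = p + 2 * n" using y by simp
      then show ?thesis using J_D[OF J, of "y + N"] per_plus[OF pf, of y] y n4 by force
    next
      case False
      then show ?thesis using J_D[OF J, of y] y n4 by force
    qed
  qed (use n4 in auto)
  from bad_upd[OF c _ r this] show ?thesis using J p unfolding J_def by auto
qed

lemma J_drop2:
  assumes J: "J f c p" and c: "c \<noteq> b" and r: "r \<noteq> c" "r \<in> {1..k}" "acc f r (p + n)" and p: "0 \<le> p" "p \<le> 2 * n" "p \<noteq> n"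
  shows "h + cnt f c \<le> max 1 (min p (2 * n - p))"
proof -
  have "arc (upd f (p + n) r) c p"
  proof (rule upd_arc[OF pf r(1)])
    fix y assume y: "p < y" "y < p + n + 2" "y \<noteq> p + n"
    then show "f y \<noteq> c" using J_D[OF J, of y] n4 by force
  qed (use n4 in auto)
  from bad_upd[OF c _ r this] show ?thesis using J p unfolding J_def by auto
qed

lemma bad_short:
  assumes "reach f g s" "c \<in> {1..k}" "c \<noteq> b" "s \<le> cnt g c" "\<And>y. x + 1 < y \<Longrightarrow> y < x + N \<Longrightarrow> g y \<noteq> c"
  shows False
  using short_good[OF assms] ng by blast

text \<open>Losing its base costs one step and leaves the triple with two consecutive residues, so
  \<open>short_good\<close> would apply.\<close>

lemma bad_K:
  assumes q: "K f c q" and c: "c \<noteq> b" and r: "r \<noteq> c" "r \<in> {1..k}"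
  shows "\<not> acc f r q"
proof
  assume a: "acc f r q"
  have fq: "f q = c" using q unfolding K_def by auto
  show False
  proof (rule bad_short[OF acc_move[OF f r(2) a] _ c, of "q + n"])
    show "c \<in> {1..k}" using kf fq by blast
    show "1 \<le> cnt (upd f q r) c" using cnt_upd[OF pf fq r(1)] K_cnt[OF pf q] by simp
    fix y assume y: "q + n + 1 < y" "y < q + n + N"
    show "upd f q r y \<noteq> c"
    proof (cases "y < q + N")
      case True
      then have "upd f q r y = f y" using upd_window[of q y q f r] y n4 by auto
      then show ?thesis using K_D[OF q, of y] y True n4 by force
    next
      case False
      have u: "upd f q r y = upd f q r (y - N)" using per_shift[OF upd_per[OF pf], of q r y] by simp
      have "upd f q r (y - N) = (if y - N = q then r else f (y - N))" using upd_window[of q "y - N" q f r] y False n4 by auto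
      then show ?thesis using K_D[OF q, of "y - N"] y False n4 u r by (cases "y - N = q") force+
    qed
  qed
qed

text \<open>The class \<open>b\<close> itself cannot serve in \<open>good\<close>. But after losing
  its base it consists of two consecutive residues and can receive the base of the triple
  \<open>c\<close>, which then has two consecutive residues after two steps.\<close>

lemma bad_K_b:
  assumes q: "K f b q" and r: "r \<noteq> b" "r \<in> {1..k}" "\<And>q. \<not> K f r q" and q': "K f c q'" "c \<noteq> b"
  shows "\<not> acc f r q"
proof
  assume a: "acc f r q"
  have rc: "r \<noteq> c" using r q' by blast
  define g where "g = upd f q r"
  have s1: "reach f g 1" unfolding g_def by (rule acc_move[OF f r(2) a])
  have pg: "per g" using col_per[OF reach_col(2)[OF s1]] .
  have fq: "f q = b" "f (q + n) = b" "f (q + n + 1) = b" using q unfolding K_def by auto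
  have bk: "b \<in> {1..k}" using kf fq by metis
  obtain j where j: "q \<le> q' + N * j" "q' + N * j < q + N" by (rule window_rep)
  define v where "v = q' + N * j"
  have v: "K f c v" unfolding v_def by (rule K_shift[OF pf q'(1)])
  have fv: "f v = c" "f (v + n) = c" "f (v + n + 1) = c" using v unfolding K_def by auto
  have gw: "g y = (if y = q then r else f y)" if "q \<le> y" "y < q + N" for y
    unfolding g_def using upd_window[of q y q f r] that n4 by auto
  have gb: "g y \<noteq> b" if "q + n + 1 < y" "y < q + n + N" for y
  proof (cases "y < q + N")
    case True
    then show ?thesis using gw[of y] K_D[OF q, of y] that n4 by force
  next
    case False
    then show ?thesis using gw[of "y - N"] per_shift[OF pg, of y] K_D[OF q, of "y - N"] that n4 r by (cases "y - N = q") force+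
  qed
  \<comment> \<open>Every residue except \<open>q\<close> and its two neighbours shares an arc with
    \<open>q + n\<close> and \<open>q + n + 1\<close>, and two bases are neither equal nor
    adjacent.\<close>
  have vq: "v \<noteq> q" "v \<noteq> q + 1" "v \<noteq> q + 2 * n"
  proof -
    show "v \<noteq> q" using fq fv q'(2) by auto
    show "v \<noteq> q + 1" using K_adjacent[OF pf q] v by blast
    show "v \<noteq> q + 2 * n"
    proof
      assume "v = q + 2 * n"
      then have "K f c (v + N * (-1))" "v + N * (-1) + 1 = q" using K_shift[OF pf v, of "-1"] by auto
      then show False using K_adjacent[OF pf] q by metis
    qed
  qed
  have "acc g b v"
  proof (cases "v \<le> q + n + 1")
    case True
    have "arc g b (q + n + 1)" unfolding arc_def
    proof (intro allI impI)
      fix x assume x: "q + n + 1 < x \<and> x < q + n + 1 + n + 2"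
      show "g x \<noteq> b" by (rule gb) (use x n4 in auto)
    qed
    from acc_arc[OF pg this, of v 0] show ?thesis using True vq j unfolding v_def[symmetric] by auto
  next
    case False
    have "arc g b (q + 2 * n - 1)" unfolding arc_def
    proof (intro allI impI)
      fix x assume x: "q + 2 * n - 1 < x \<and> x < q + 2 * n - 1 + n + 2"
      show "g x \<noteq> b" by (rule gb) (use x n4 in auto)
    qed
    from acc_arc[OF pg this, of v 0] show ?thesis using False vq j unfolding v_def[symmetric] by auto
  qed
  then have s2: "reach g (upd g v b) 1" using acc_move[OF reach_col(2)[OF s1] bk] by blast
  have gv: "g v = c" using gw[of v] fv vq j unfolding v_def[symmetric] by auto
  have "cnt g c = 3" unfolding g_def using cnt_upd_other[OF pf, of q c r] fq q'(2) rc K_cnt[OF pf v] by auto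
  then have cn: "cnt (upd g v b) c = 2" using cnt_upd[OF pg gv] q'(2) by auto
  have gc: "g y = c \<longleftrightarrow> f y = c" for y unfolding g_def upd_def using dvd_per[OF pf, of y q] fq q'(2) rc by auto
  show False
  proof (rule bad_short[OF reach_trans[OF s1 s2] _ q'(2), of "v + n"])
    show "c \<in> {1..k}" using kf fv by metis
    show "1 + 1 \<le> cnt (upd g v b) c" using cn by simp
    fix y assume y: "v + n + 1 < y" "y < v + n + N"
    have w: "upd g v b z \<noteq> c" if "v \<le> z" "z < v + N" "z \<noteq> v + n" "z \<noteq> v + n + 1" for z
    proof -
      have "upd g v b z = (if z = v then b else g z)" using upd_window[of v z v g b] that n4 by auto
      moreover have "f z \<noteq> c" if "z \<noteq> v" using K_D[OF v, of z] that \<open>v \<le> z\<close> \<open>z < v + N\<close> \<open>z \<noteq> v + n\<close> \<open>z \<noteq> v + n + 1\<close> by force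
      ultimately show ?thesis using gc q'(2) by auto
    qed
    show "upd g v b y \<noteq> c"
    proof (cases "y < v + N")
      case True then show ?thesis using w[of y] y n4 by auto
    next
      case False
      then show ?thesis using w[of "y - N"] y n4 per_shift[OF upd_per[OF pg], of v b y] by auto
    qed
  qed
qed

text \<open>Moving \<open>c\<close> out of \<open>{1..n}\<close> puts it into
  \<open>{n + 1..2 * n}\<close> or \<open>{n + 2..2 * n + 1}\<close>, unless it contains both end
  residues. This costs \<open>inI f c\<close> steps, leaves \<open>inQ f c\<close> residues, and the
  overlap counts as \<open>1\<close>. As \<open>good\<close> fails, the cost must be large.\<close>

lemma bad_clear:
  assumes c: "c \<in> {1..k}" "c \<noteq> b" "c \<noteq> r1" "c \<noteq> r2" and rk: "r1 \<in> {1..k}" "r2 \<in> {1..k}"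
    and rc: "rcv f r1 l1 u1" "rcv f r2 l2 u2" and eq: "r1 = r2 \<Longrightarrow> l1 = l2 \<and> u1 = u2"
    and cov: "\<And>x. 1 \<le> x \<Longrightarrow> x \<le> n \<Longrightarrow> f x = c \<Longrightarrow> l1 \<le> x \<and> x \<le> u1 \<or> l2 \<le> x \<and> x \<le> u2"
    and ends: "f (n + 1) \<noteq> c \<or> f (2 * n + 1) \<noteq> c"
  shows "h + 1 + inQ f c \<le> inI f c"
proof (rule ccontr)
  assume a: "\<not> ?thesis"
  have "1 \<le> n" "n < 1 + N" using n4 by auto
  from clear[OF f this c(3,4) rk rc eq cov]
  obtain g where g: "reach f g (inI f c)" "cnt g c = inQ f c"
    "\<And>x. 1 \<le> x \<Longrightarrow> x \<le> n \<Longrightarrow> g x \<noteq> c" "\<And>x. n < x \<Longrightarrow> x < 1 + N \<Longrightarrow> g x = f x"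
    unfolding inI_def inQ_def by blast
  have pg: "per g" using col_per[OF reach_col(2)[OF g(1)]] .
  have "\<exists>e. (e = 0 \<or> e = 2 * n) \<and> arc g c e"
  proof (cases "f (n + 1) = c")
    case True
    have "arc g c (2 * n)" unfolding arc_def
    proof (intro allI impI)
      fix x assume x: "2 * n < x \<and> x < 2 * n + n + 2"
      show "g x \<noteq> c"
      proof (cases "x = 2 * n + 1")
        case True then show ?thesis using ends \<open>f (n + 1) = c\<close> g(4)[of x] n4 by auto
      next
        case False
        then have "g (x - N) \<noteq> c" using x by (intro g(3)) auto
        then show ?thesis using per_shift[OF pg, of x] by simp
      qed
    qed
    then show ?thesis by blast
  next
    case False
    have "arc g c 0" unfolding arc_def
    proof (intro allI impI)
      fix x assume x: "0 < x \<and> x < 0 + n + 2"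
      show "g x \<noteq> c"
      proof (cases "x = n + 1")
        case True then show ?thesis using False g(4)[of x] n4 by auto
      next
        case False
        then show ?thesis using x by (intro g(3)) auto
      qed
    qed
    then show ?thesis by blast
  qed
  then obtain e where e: "e = 0 \<or> e = 2 * n" "arc g c e" by blast
  have "inI f c + max 1 (min e (2 * n - e)) \<le> h + 1 + cnt g c" using a e(1) g(2) n4 by auto
  then have "good b f" unfolding good_def using c g(1) e n4 by (intro exI[of _ g] exI[of _ "inI f c"] exI[of _ c] exI[of _ e]) auto
  then show False using ng by blast
qed

end

section \<open>The position of a class relative to the reserved arc\<close>

context circ_params
begin

text \<open>\<open>Pre f c u\<close>: the class \<open>c\<close> is placed so that it can receive all of \<open>{1..u}\<close>; \<open>Suf\<close> is the mirror image.\<close>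

definition Pre :: "(int \<Rightarrow> nat) \<Rightarrow> nat \<Rightarrow> int \<Rightarrow> bool" where
  "Pre f c u \<longleftrightarrow> arc f c u \<and> 0 \<le> u \<and> u \<le> n - 1 \<or> J f c (u + 2) \<and> -1 \<le> u \<and> u \<le> n - 2"

definition Suf :: "(int \<Rightarrow> nat) \<Rightarrow> nat \<Rightarrow> int \<Rightarrow> bool" where
  "Suf f c l \<longleftrightarrow> arc f c (l + n - 1) \<and> 2 \<le> l \<and> l \<le> n + 1 \<or> J f c (l + n - 1) \<and> 3 \<le> l \<and> l \<le> n + 2"

lemma Suf_refl:
  assumes p: "per f" and s: "Suf f c l"
  shows "Pre (\<lambda>x. f (n + 1 - x)) c (n + 1 - l)"
proof -
  have a: "2 * n - (l + n - 1) = n + 1 - l" by simp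
  have b: "1 - (l + n - 1) + N * 1 = n + 1 - l + 2" by simp
  consider "arc f c (l + n - 1)" "2 \<le> l" "l \<le> n + 1" | "J f c (l + n - 1)" "3 \<le> l" "l \<le> n + 2"
    using s unfolding Suf_def by blast
  then show ?thesis
  proof cases
    case 1 then show ?thesis using arc_refl[OF p, of c "l + n - 1"] unfolding Pre_def a by auto
  next
    case 2 then show ?thesis using J_shift[OF per_refl[OF p] J_refl[OF p 2(1)], of 1] unfolding Pre_def b by auto
  qed
qed

lemma Pre_refl:
  assumes p: "per f" and s: "Pre f c u"
  shows "Suf (\<lambda>x. f (n + 1 - x)) c (n + 1 - u)"
proof -
  have a: "n + 1 - u + n - 1 = 2 * n - u" by simp
  have b: "1 - (u + 2) + N * 1 = 2 * n - u" by simp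
  consider "arc f c u" "0 \<le> u" "u \<le> n - 1" | "J f c (u + 2)" "-1 \<le> u" "u \<le> n - 2"
    using s unfolding Pre_def by blast
  then show ?thesis
  proof cases
    case 1 then show ?thesis using arc_refl[OF p, of c u] unfolding Suf_def a by auto
  next
    case 2 then show ?thesis using J_shift[OF per_refl[OF p] J_refl[OF p 2(1)], of 1] unfolding Suf_def a b by auto
  qed
qed

lemma rcv_refl: "rcv f c l u \<Longrightarrow> rcv (\<lambda>x. f (n + 1 - x)) c (n + 1 - u) (n + 1 - l)"
  unfolding rcv_def
proof (drule acy_refl[of _ "n + 1"], erule acy_mono)
  fix x assume "f (n + 1 - x) = c \<or> (\<exists>j. n + 1 - u \<le> x + N * j \<and> x + N * j \<le> n + 1 - l)"
  moreover have "l \<le> n + 1 - x + N * (- j) \<and> n + 1 - x + N * (- j) \<le> u"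
    if "n + 1 - u \<le> x + N * j \<and> x + N * j \<le> n + 1 - l" for j using that by auto
  ultimately show "f (n + 1 - x) = c \<or> (\<exists>j. l \<le> n + 1 - x + N * j \<and> n + 1 - x + N * j \<le> u)" by metis
qed

lemma rcv_Pre: "per f \<Longrightarrow> Pre f c u \<Longrightarrow> rcv f c 1 u"
  unfolding Pre_def using rcv_arc[of f c u 1 u] rcv_J[of f c "u + 2" 1 u] by auto

lemma rcv_Suf: "per f \<Longrightarrow> Suf f c l \<Longrightarrow> rcv f c l n"
  unfolding Suf_def using rcv_arc[of f c "l + n - 1" l n] rcv_J[of f c "l + n - 1" l n] by auto

lemma rcv_Q: "per f \<Longrightarrow> J f c (n + 1) \<Longrightarrow> rcv f c 2 (n - 1)"
  using rcv_J[of f c "n + 1" 2 "n - 1"] by auto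

lemma Q_refl:
  assumes "per f" "J f c (n + 1)"
  shows "J (\<lambda>x. f (n + 1 - x)) c (n + 1)"
  using J_shift[OF per_refl[OF assms(1)] J_refl[OF assms], of 1] by simp

end

context bad
begin

lemma bad_refl: "bad n k (\<lambda>x. f (n + 1 - x)) b"
proof
  show "col (\<lambda>x. f (n + 1 - x))" by (rule col_refl[OF f])
  show "\<not> good b (\<lambda>x. f (n + 1 - x))" using ng good_refl by blast
  show "\<exists>x. f (n + 1 - x) = c" if "c \<in> {1..k}" for c
  proof -
    obtain x where "f x = c" using ne[OF \<open>c \<in> {1..k}\<close>] by blast
    then have "f (n + 1 - (n + 1 - x)) = c" by simp
    then show ?thesis by blast
  qed
qed

text \<open>The cases follow the end of an arc or the base of a \<open>J\<close> around the circle.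
  The base \<open>n + 1\<close> is special: its class contains both \<open>n + 1\<close> and
  \<open>2 * n + 1\<close>, so \<open>bad_clear\<close> does not apply to it.\<close>

lemma types:
  assumes "c \<in> {1..k}"
  obtains u where "Pre f c u" | l where "Suf f c l" | "J f c (n + 1)" | q where "K f c q" "1 \<le> q" "q \<le> N" | "arc f c n"
proof (rule class_cases_window[OF f, of c 1])
  fix e assume e: "arc f c e" "1 \<le> e" "e < 1 + N"
  show thesis
  proof (cases "e = N")
    case True
    then have "Pre f c 0" using arc_shift[OF pf, of c 0 1] e n4 unfolding Pre_def by auto
    then show ?thesis using that by blast
  next
    case False
    consider "e < n" | "e = n" | "n < e" by linarith
    then show ?thesis
    proof cases
      case 1 then show ?thesis using that(1)[of e] e unfolding Pre_def by auto
    next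
      case 2 then show ?thesis using that(5) e by auto
    next
      case 3 then show ?thesis using that(2)[of "e - n + 1"] e False unfolding Suf_def by auto
    qed
  qed
next
  fix p assume p: "J f c p" "1 \<le> p" "p < 1 + N"
  consider "p \<le> n" | "p = n + 1" | "n + 2 \<le> p" by linarith
  then show thesis
  proof cases
    case 1 then show ?thesis using that(1)[of "p - 2"] p unfolding Pre_def by auto
  next
    case 2 then show ?thesis using that(3) p by auto
  next
    case 3 then show ?thesis using that(2)[of "p - n + 1"] p unfolding Suf_def by auto
  qed
qed (use that in auto)

lemma inQ_nonneg: "0 \<le> inQ f c"
  unfolding inQ_def by simp

lemma Pre_ends: "Pre f c u \<Longrightarrow> f (n + 1) \<noteq> c \<or> f (2 * n + 1) \<noteq> c"
  unfolding Pre_def using arc_D[of f c u "n + 1"] J_D[of f c "u + 2" "n + 1"] J_D[of f c "u + 2" "2 * n + 1"] n4 by force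

text \<open>Otherwise \<open>bad_clear\<close> puts more than half of \<open>{1..n}\<close> into
  \<open>c\<close>. For a class in an arc this contradicts the overlap demanded by
  \<open>bad_arc\<close>. A \<open>J\<close> can give its base \<open>p\<close> to one of the
  receivers, and then it is too large for \<open>J_drop1\<close>.\<close>

lemma Pre_clear:
  assumes P: "Pre f c u" and c: "c \<in> {1..k}" "c \<noteq> b" "c \<noteq> r1" "c \<noteq> r2" and rk: "r1 \<in> {1..k}" "r2 \<in> {1..k}"
    and rc: "rcv f r1 l1 u1" "rcv f r2 l2 u2" and eq: "r1 = r2 \<Longrightarrow> l1 = l2 \<and> u1 = u2"
    and cov: "\<And>x. 1 \<le> x \<Longrightarrow> x \<le> n \<Longrightarrow> f x = c \<Longrightarrow> l1 \<le> x \<and> x \<le> u1 \<or> l2 \<le> x \<and> x \<le> u2"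
  shows False
proof -
  have H: "h + 1 + inQ f c \<le> inI f c" by (rule bad_clear[OF c rk rc eq cov Pre_ends[OF P]])
  note cs = cnt_split[OF pf, of c] inQ_nonneg[of c]
  consider "arc f c u" "0 \<le> u" "u \<le> n - 1" | "J f c (u + 2)" "-1 \<le> u" "u \<le> n - 2"
    using P unfolding Pre_def by blast
  then show False
  proof cases
    case 1
    have "h + 2 + cnt f c \<le> min u (2 * n - u)" by (rule bad_arc[OF c(1,2) 1(1)]) (use 1 in auto)
    then show False using H cs 1 by linarith
  next
    case 2
    define p where "p = u + 2"
    have J: "J f c p" "1 \<le> p" "p \<le> n" using 2 unfolding p_def by auto
    have "1 \<le> inQ f c" using inQ_pos[of "p + n"] J J_in(2)[OF J(1)] by auto
    then have cn: "h + 3 \<le> cnt f c" using cs H by linarith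
    obtain r where r: "r \<in> {1..k}" "r \<noteq> c" "acc f r p"
      using cov[OF J(2,3) J_in(1)[OF J(1)]] rcv_acc[OF rc(1), of p 0] rcv_acc[OF rc(2), of p 0] c rk by auto
    show False
    proof (cases "p = 1")
      case True
      \<comment> \<open>\<open>J_drop1\<close> needs \<open>2 \<le> p\<close>, so the base
        \<open>1\<close> is taken one period later; the arc then ends with \<open>2 * n\<close> and
        misses \<open>{1..n}\<close>.\<close>
      have "J f c (2 * n + 2)" using J_shift[OF pf J(1), of 1] True by (simp add: add.commute)
      moreover have "acc f r (2 * n + 2)"
      proof -
        have "2 * n + 2 = p + N * 1" using True by simp
        then have "upd f (2 * n + 2) r = upd f p r" "N dvd y - (2 * n + 2) \<longleftrightarrow> N dvd y - p" for y
          using upd_shift[of f p 1 r] upd_shift[of "\<lambda>_. 0" p 1 1] unfolding upd_def by (metis zero_neq_one)+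
        then show ?thesis using r(3) unfolding acc_def by simp
      qed
      ultimately have "h + cnt f c \<le> max 1 (min (2 * n + 2 - 2) (2 * n + 2 - (2 * n + 2)))"
        using J_drop1[of c "2 * n + 2" r] c(2) r(1,2) n4 by simp
      then show False using cn n4 by linarith
    next
      case False
      then have "h + cnt f c \<le> max 1 (min (p - 2) (2 * n + 2 - p))"
        using J_drop1[OF J(1) c(2) r(2,1,3)] J n4 by simp
      then show False using cn J n4 by linarith
    qed
  qed
qed

lemma Suf_clear:
  assumes P: "Suf f c l" and c: "c \<in> {1..k}" "c \<noteq> b" "c \<noteq> r1" "c \<noteq> r2" and rk: "r1 \<in> {1..k}" "r2 \<in> {1..k}"
    and rc: "rcv f r1 l1 u1" "rcv f r2 l2 u2" and eq: "r1 = r2 \<Longrightarrow> l1 = l2 \<and> u1 = u2"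
    and cov: "\<And>x. 1 \<le> x \<Longrightarrow> x \<le> n \<Longrightarrow> f x = c \<Longrightarrow> l1 \<le> x \<and> x \<le> u1 \<or> l2 \<le> x \<and> x \<le> u2"
  shows False
proof (rule bad.Pre_clear[OF bad_refl Suf_refl[OF pf P] c rk rcv_refl[OF rc(1)] rcv_refl[OF rc(2)]])
  fix x assume "1 \<le> x" "x \<le> n" "f (n + 1 - x) = c"
  then show "n + 1 - u1 \<le> x \<and> x \<le> n + 1 - l1 \<or> n + 1 - u2 \<le> x \<and> x \<le> n + 1 - l2"
    using cov[of "n + 1 - x"] by auto
qed (use eq in auto)

text \<open>At most two residues of a triple lie in \<open>{1..n}\<close>, fewer than the
  \<open>h + 2\<close> that \<open>bad_clear\<close> would require.\<close>

lemma K_clear: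
  assumes K: "K f c q" and c: "c \<in> {1..k}" "c \<noteq> b" "c \<noteq> r1" "c \<noteq> r2" and rk: "r1 \<in> {1..k}" "r2 \<in> {1..k}"
    and rc: "rcv f r1 l1 u1" "rcv f r2 l2 u2" and eq: "r1 = r2 \<Longrightarrow> l1 = l2 \<and> u1 = u2"
    and cov: "\<And>x. 1 \<le> x \<Longrightarrow> x \<le> n \<Longrightarrow> f x = c \<Longrightarrow> l1 \<le> x \<and> x \<le> u1 \<or> l2 \<le> x \<and> x \<le> u2"
    and ends: "f (n + 1) \<noteq> c \<or> f (2 * n + 1) \<noteq> c"
  shows False
proof -
  have H: "h + 1 + inQ f c \<le> inI f c" by (rule bad_clear[OF c rk rc eq cov ends])
  obtain j where j: "1 \<le> q + N * j" "q + N * j < 1 + N" by (rule window_rep)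
  define v where "v = q + N * j"
  have v: "K f c v" unfolding v_def by (rule K_shift[OF pf K])
  have "1 \<le> inQ f c"
    using inQ_pos[of v f c] inQ_pos[of "v + n" f c] K_in[OF v] j unfolding v_def by (cases "v \<le> n") (auto simp: v_def)
  then show False using H cnt_split[OF pf, of c] K_cnt[OF pf v] n4 by linarith
qed

text \<open>A class inside \<open>{1..n}\<close> can receive all of this arc and so empties any
  class that avoids \<open>n + 1\<close>. If that class lies inside \<open>{1..n}\<close> too, each
  of the two would need \<open>h + 1\<close> of the \<open>n\<close> residues.\<close>

lemma no_inside:
  assumes d: "d \<in> {1..k}" "d \<noteq> b"
  shows "\<not> arc f d n"
proof
  assume a: "arc f d n"
  obtain c where c: "c \<in> {1..k}" "c \<noteq> b" "c \<noteq> d" "c \<noteq> f (n + 1)" using color_avoid by blast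
  have rd: "rcv f d 1 n" using rcv_arc[OF pf a, of 1 n] by simp
  show False
  proof (rule types[OF c(1)])
    fix u assume "Pre f c u"
    then show False using Pre_clear[OF _ c(1-3) c(3) d(1) d(1) rd rd] by blast
  next
    fix l assume "Suf f c l"
    then show False using Suf_clear[OF _ c(1-3) c(3) d(1) d(1) rd rd] by blast
  next
    assume "J f c (n + 1)"
    then show False using c J_in by auto
  next
    fix q assume "K f c q"
    then show False using K_clear[OF _ c(1-3) c(3) d(1) d(1) rd rd] c by blast
  next
    assume ac: "arc f c n"
    have rc: "rcv f c 1 n" using rcv_arc[OF pf ac, of 1 n] by simp
    have "h + 1 + inQ f c \<le> inI f c" using bad_clear[OF c(1-3) c(3) d(1) d(1) rd rd] c by blast
    moreover have "h + 1 + inQ f d \<le> inI f d"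
      using bad_clear[OF d not_sym[OF c(3)] not_sym[OF c(3)] c(1) c(1) rc rc] arc_D[OF a, of "n + 1"] n4 by auto
    ultimately show False using inI_two[OF c(3), of f] inQ_nonneg[of c] inQ_nonneg[of d] by linarith
  qed
qed

text \<open>In all other positions one class could receive everything that the other has in
  \<open>{1..n}\<close>. The exception exists because a \<open>J\<close> based at
  \<open>u + 2\<close> receives only up to \<open>u\<close> by \<open>rcv_Pre\<close> but contains
  \<open>u + 2\<close>.\<close>

lemma Pre_Pre:
  assumes c: "Pre f c u" "c \<in> {1..k}" "c \<noteq> b" and r: "Pre f r w" "r \<in> {1..k}" "r \<noteq> b" and cr: "c \<noteq> r" and uw: "u \<le> w"
  shows "J f c (u + 2) \<and> w = u + 1 \<and> (J f r (u + 3) \<or> arc f r (u + 1))"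
proof -
  have wk: False if "arc f c u" "u \<le> n - 1"
  proof (rule Pre_clear[OF c cr cr r(2) r(2) rcv_Pre[OF pf r(1)] rcv_Pre[OF pf r(1)]])
    fix x assume x: "1 \<le> x" "x \<le> n" "f x = c"
    then show "1 \<le> x \<and> x \<le> w \<or> 1 \<le> x \<and> x \<le> w" using arc_D[OF that(1), of x] uw c(1) unfolding Pre_def by force
  qed auto
  then have J: "J f c (u + 2)" "-1 \<le> u" "u \<le> n - 2" using c(1) unfolding Pre_def by auto
  have cI: "x \<le> u \<or> x = u + 2" if "1 \<le> x" "x \<le> n" "f x = c" for x
    using J_D[OF J(1), of x] J_D[OF J(1), of "x + N"] per_plus[OF pf, of x] that J by force
  have "w < u + 2"
  proof (rule ccontr)
    assume w: "\<not> w < u + 2"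
    show False
    proof (rule Pre_clear[OF c cr cr r(2) r(2) rcv_Pre[OF pf r(1)] rcv_Pre[OF pf r(1)]])
      fix x assume "1 \<le> x" "x \<le> n" "f x = c"
      then show "1 \<le> x \<and> x \<le> w \<or> 1 \<le> x \<and> x \<le> w" using cI[of x] w by auto
    qed auto
  qed
  moreover have "w \<noteq> u"
  proof
    assume w: "w = u"
    have "\<not> J f r (u + 2)" using J cr J_in by blast
    then have a: "arc f r u" using r(1) w unfolding Pre_def by auto
    show False
    proof (rule Pre_clear[OF r not_sym[OF cr] not_sym[OF cr] c(2) c(2) rcv_Pre[OF pf c(1)] rcv_Pre[OF pf c(1)]])
      fix x assume x: "1 \<le> x" "x \<le> n" "f x = r"
      then show "1 \<le> x \<and> x \<le> u \<or> 1 \<le> x \<and> x \<le> u" using arc_D[OF a, of x] J by force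
    qed auto
  qed
  ultimately have w: "w = u + 1" using uw by simp
  have "u + 1 + 2 = u + 3" by simp
  then show ?thesis using J w r(1) unfolding Pre_def by metis
qed

text \<open>Suppose that \<open>{1..u}\<close> and \<open>{l..n}\<close> leave a gap. A class in an
  arc is constrained by \<open>bad_arc\<close>; a \<open>J\<close> can hand one of its residues at
  distance \<open>n\<close> to the other class and is constrained by a drop lemma. These constraints
  push \<open>u\<close> up and \<open>l\<close> down until the ranges meet. Only two
  \<open>J\<close> with the adjacent bases \<open>2 * n + 1\<close> and \<open>1\<close>
  escape.\<close>

lemma Pre_Suf:
  assumes c: "Pre f c u" "c \<in> {1..k}" "c \<noteq> b" and d: "Suf f d l" "d \<in> {1..k}" "d \<noteq> b" and cd: "c \<noteq> d"
  shows "l \<le> u + 1 \<or> J f c 1 \<and> J f d (2 * n + 1)"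
proof -
  have carc: "h + 3 \<le> u" if "arc f c u" "0 \<le> u" "u \<le> n - 1"
    using bad_arc(2)[OF c(2,3) that(1)] that by auto
  have darc: "l \<le> h - 1" if "arc f d (l + n - 1)" "2 \<le> l" "l \<le> n + 1"
  proof -
    have "h + 3 \<le> min (l + n - 1) (2 * n - (l + n - 1))"
      by (rule bad_arc(2)[OF d(2,3) that(1)]) (use that n4 in auto)
    then show ?thesis using n4 by linarith
  qed
  have c1: "h + 4 \<le> p" if "J f c p" "2 \<le> p" "p \<le> n" "acc f d p" for p
  proof -
    have "h + cnt f c \<le> max 1 (min (p - 2) (2 * n + 2 - p))"
      by (rule J_drop1[OF that(1) c(3) not_sym[OF cd] d(2) that(4)]) (use that in auto)
    then show ?thesis using J_two[OF that(1)] n4 by linarith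
  qed
  have c2: "h + 2 \<le> p" if "J f c p" "1 \<le> p" "p < n" "acc f d (p + n)" for p
  proof -
    have "h + cnt f c \<le> max 1 (min p (2 * n - p))"
      by (rule J_drop2[OF that(1) c(3) not_sym[OF cd] d(2) that(4)]) (use that in auto)
    then show ?thesis using J_two[OF that(1)] n4 by linarith
  qed
  have d1: "q \<le> 2 * n - h" if "J f d q" "n + 3 \<le> q" "q \<le> 2 * n + 1" "acc f c q" for q
  proof -
    have "h + cnt f d \<le> max 1 (min (q - 2) (2 * n + 2 - q))"
      by (rule J_drop1[OF that(1) d(3) cd c(2) that(4)]) (use that n4 in auto)
    then show ?thesis using J_two[OF that(1)] n4 by linarith
  qed
  have d2: "q \<le> 2 * n - h - 2" if "J f d q" "n < q" "q \<le> 2 * n" "acc f c (q + n)" for q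
  proof -
    have "h + cnt f d \<le> max 1 (min q (2 * n - q))"
      by (rule J_drop2[OF that(1) d(3) cd c(2) that(4)]) (use that n4 in auto)
    then show ?thesis using J_two[OF that(1)] n4 by linarith
  qed
  show ?thesis
  proof (rule ccontr)
    assume neg: "\<not> ?thesis"
    then have lu: "u + 2 \<le> l" by simp
    consider (aa) "arc f c u" "0 \<le> u" "u \<le> n - 1" "arc f d (l + n - 1)" "2 \<le> l" "l \<le> n + 1"
      | (Ja) "J f c (u + 2)" "-1 \<le> u" "u \<le> n - 2" "arc f d (l + n - 1)" "2 \<le> l" "l \<le> n + 1"
      | (aJ) "arc f c u" "0 \<le> u" "u \<le> n - 1" "J f d (l + n - 1)" "3 \<le> l" "l \<le> n + 2"
      | (JJ) "J f c (u + 2)" "-1 \<le> u" "u \<le> n - 2" "J f d (l + n - 1)" "3 \<le> l" "l \<le> n + 2"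
      using c(1) d(1) unfolding Pre_def Suf_def by blast
    then show False
    proof cases
      case aa
      then show ?thesis using carc darc lu by linarith
    next
      case Ja
      have l: "l \<le> h - 1" using darc Ja by blast
      show ?thesis
      proof (cases "u + 2 = l")
        case True
        have "acc f d (u + 2)" using acc_arc[OF pf Ja(4), of "u + 2" 0] True n4 by auto
        then show ?thesis using c1[OF Ja(1)] l True Ja n4 by linarith
      next
        case False
        have "acc f d (u + 2 + n)" using acc_arc[OF pf Ja(4), of "u + 2 + n" 0] False lu l n4 Ja by auto
        then show ?thesis using c2[OF Ja(1)] l lu Ja n4 by linarith
      qed
    next
      case aJ
      have u: "h + 3 \<le> u" using carc aJ by blast
      show ?thesis
      proof (cases "u + 2 = l")
        case True
        have "u + 2 + n - 1 + n + N * (-1) = u" by simp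
        then have "acc f c (l + n - 1 + n)" using acc_arc[OF pf aJ(1), of "l + n - 1 + n" "-1"] True n4 by auto
        then show ?thesis using d2[OF aJ(4)] u lu True aJ n4 by linarith
      next
        case False
        have "acc f c (l + n - 1)" using acc_arc[OF pf aJ(1), of "l + n - 1" "-1"] False lu u n4 aJ by auto
        then show ?thesis using d1[OF aJ(4)] u lu aJ False n4 by linarith
      qed
    next
      case JJ
      have p: "J f c (u + 2)" "1 \<le> u + 2" using JJ by auto
      \<comment> \<open>For \<open>l = u + 3\<close> and \<open>l = u + 4\<close> the two classes
        would share a residue.\<close>
      have "l \<noteq> u + 3"
      proof
        assume "l = u + 3"
        then have "u + 2 + n = l + n - 1" by simp
        then show False using J_in(2)[OF JJ(1)] J_in(1)[OF JJ(4)] cd by metis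
      qed
      moreover have "l \<noteq> u + 4"
      proof
        assume "l = u + 4"
        then have "l + n - 1 + n = u + 2 + N" by simp
        then show False using J_in(1)[OF JJ(1)] J_in(2)[OF JJ(4)] cd per_plus[OF pf, of "u + 2"] by metis
      qed
      ultimately consider "l = u + 2" | "u + 5 \<le> l" using lu by linarith
      then show ?thesis
      proof cases
        case 1
        have "acc f d (u + 2)" using acc_J[OF pf JJ(4), of "u + 2" 0] 1 n4 by auto
        then have "h + 4 \<le> u + 2" using c1[OF JJ(1)] 1 JJ by auto
        moreover have "acc f c (l + n - 1 + n)" using acc_J[OF pf JJ(1), of "l + n - 1 + n" "-1"] 1 n4 by auto
        then have "l + n - 1 \<le> 2 * n - h - 2" using d2[OF JJ(4)] 1 JJ by auto
        ultimately show ?thesis using 1 n4 by linarith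
      next
        case 2
        have ex: "0 \<le> u \<or> l \<le> n + 1"
        proof (rule ccontr)
          assume "\<not> ?thesis"
          then have "u + 2 = 1" "l + n - 1 = 2 * n + 1" using JJ by auto
          then show False using neg JJ(1,4) by metis
        qed
        have "acc f d (u + 2 + n)" using acc_J[OF pf JJ(4), of "u + 2 + n" 0] 2 ex JJ n4 by auto
        then have "h + 2 \<le> u + 2" using c2[OF JJ(1)] 2 JJ by auto
        moreover have "acc f c (l + n - 1)" using acc_J[OF pf JJ(1), of "l + n - 1" "-1"] 2 ex JJ n4 by auto
        then have "l + n - 1 \<le> 2 * n - h" using d1[OF JJ(4)] 2 JJ by auto
        ultimately show ?thesis using 2 n4 by linarith
      qed
    qed
  qed
qed

end

context circ_params
begin

lemma J_not_K:
  assumes p: "per f" and J: "J f c u"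
  shows "\<not> K f c q"
proof
  assume "K f c q"
  obtain j where j: "u \<le> q + N * j" "q + N * j < u + N" by (rule window_rep)
  define v where "v = q + N * j"
  have v: "K f c v" "u \<le> v" "v < u + N" using K_shift[OF p \<open>K f c q\<close>] j unfolding v_def by auto
  have "v = u \<or> v = u + n \<or> u + n + 2 \<le> v \<and> v \<le> u + 2 * n - 1" using J_D[OF J, of v] K_in(1)[OF v(1)] v by force
  then consider "v = u" | "v = u + n" | "u + n + 2 \<le> v" "v \<le> u + 2 * n - 1" by blast
  then show False
  proof cases
    case 1
    then show ?thesis using J_D[OF J, of "u + n + 1"] K_in(3)[OF v(1)] n4 by auto
  next
    case 2
    then show ?thesis using J_D[OF J, of "v + n"] K_in(2)[OF v(1)] n4 by auto
  next
    case 3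
    have "f (v + n - N) = c" using K_in(2)[OF v(1)] per_shift[OF p, of "v + n"] by simp
    then show ?thesis using J_D[OF J, of "v + n - N"] 3 n4 by linarith
  qed
qed

lemma arc_not_K:
  assumes p: "per f" and a: "arc f c e"
  shows "\<not> K f c q"
proof
  assume "K f c q"
  obtain j where j: "e - n + 1 \<le> q + N * j" "q + N * j < e - n + 1 + N" by (rule window_rep)
  define v where "v = q + N * j"
  have v: "K f c v" "e - n + 1 \<le> v" "v < e - n + 1 + N" using K_shift[OF p \<open>K f c q\<close>] j unfolding v_def by auto
  have "v \<le> e" using arc_D[OF a, of v] K_in(1)[OF v(1)] v by force
  then show False using arc_D[OF a, of "v + n"] K_in(2)[OF v(1)] v by force
qed

text \<open>A base outside the open gap of the \<open>J\<close> could be received by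
  \<open>d\<close>, or its triple would contain a residue of \<open>d\<close>.\<close>

lemma K_gap_J:
  assumes p: "per f" and J: "J f d u" and K: "K f c q" and na: "\<not> acc f d q"
  obtains j where "u < q + N * j" "q + N * j < u + n"
proof -
  obtain j where j: "u \<le> q + N * j" "q + N * j < u + N" by (rule window_rep)
  define v where "v = q + N * j"
  have Kv: "K f c v" unfolding v_def by (rule K_shift[OF p K])
  have cd: "c \<noteq> d" using J_not_K[OF p J] K by blast
  have "v \<noteq> u" "v \<noteq> u + n" using J_in[OF J] K_in[OF Kv] cd by auto
  moreover have "\<not> (u + n + 2 \<le> v \<and> v \<le> u + 2 * n - 1)"
  proof -
    have "q + N * (j - 1) = v - N" unfolding v_def by (simp add: algebra_simps)
    then show ?thesis using acc_J[OF p J, of q "j - 1"] na by auto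
  qed
  moreover have "v \<noteq> u + n + 1"
    using J_in[OF J] K_in[OF Kv] cd per_plus[OF p, of u] by (auto simp: algebra_simps)
  moreover have "v \<noteq> u + 2 * n"
    using J_in[OF J] K_in[OF Kv] cd per_plus[OF p, of "u + n"] by (auto simp: algebra_simps)
  ultimately show thesis using j that[of j] unfolding v_def by auto
qed

text \<open>The other two residues of a triple are at distance \<open>n\<close> from its base, one
  on each side, so none of them lies in an interval of \<open>n - 1\<close> residues with the
  base.\<close>

lemma K_base:
  assumes p: "per f" and K: "K f c q" "u < q + N * j" "q + N * j < u + n" and z: "u < z" "z < u + n" "f z = c"
  shows "K f c z"
proof -
  have K': "K f c (q + N * j)" by (rule K_shift[OF p K(1)])
  define v where "v = q + N * j"
  have "z = v"
  proof (rule ccontr)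
    assume "z \<noteq> v"
    then consider "v < z" | "v < z + N" "z < v" using z K unfolding v_def by linarith
    then show False
    proof cases
      case 1
      then show ?thesis using K_D[OF K'[folded v_def], of z] z K unfolding v_def by linarith
    next
      case 2
      then show ?thesis using K_D[OF K'[folded v_def], of "z + N"] per_plus[OF p, of z] z K unfolding v_def by linarith
    qed
  qed
  then show ?thesis using K' unfolding v_def by simp
qed

end

context bad
begin

lemma Pre_not_K: "Pre f c u \<Longrightarrow> \<not> K f c q"
  unfolding Pre_def using J_not_K[OF pf] arc_not_K[OF pf] by blast

lemma Suf_not_K: "Suf f c l \<Longrightarrow> \<not> K f c q"
  unfolding Suf_def using J_not_K[OF pf] arc_not_K[OF pf] by blast

text \<open>By \<open>Pre_Pre\<close>, the class with the smaller range has in \<open>{1..n}\<close>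
  only residues up to \<open>u\<close>, which the other one receives, and possibly
  \<open>u + 2\<close>. A third \<open>Pre\<close> cannot keep the prescribed spacing, and a third
  class of another kind receives \<open>u + 2\<close>, against \<open>Pre_clear\<close>.\<close>

lemma Pre_Pre_other:
  assumes c: "Pre f c u" "c \<in> {1..k}" "c \<noteq> b" and r: "Pre f r w" "r \<in> {1..k}" "r \<noteq> b" and cr: "c \<noteq> r"
    and e: "e \<in> {1..k}" "e \<noteq> b" "e \<noteq> c" "e \<noteq> r" "\<And>q. \<not> K f e q"
  shows False
proof -
  have main: False if c: "Pre f c u" "c \<in> {1..k}" "c \<noteq> b" and r: "Pre f r w" "r \<in> {1..k}" "r \<noteq> b" and cr: "c \<noteq> r"
    and e: "e \<in> {1..k}" "e \<noteq> b" "e \<noteq> c" "e \<noteq> r" "\<And>q. \<not> K f e q" and uw: "u \<le> w" for c u r w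
  proof -
    have P: "J f c (u + 2)" "w = u + 1" "J f r (u + 3) \<or> arc f r (u + 1)" using Pre_Pre[OF c r cr uw] by auto
    have u: "-1 \<le> u" "u \<le> n - 2" using c(1) r(1) P(2) unfolding Pre_def by auto
    have cI: "x \<le> u \<or> x = u + 2" if "1 \<le> x" "x \<le> n" "f x = c" for x
      using J_D[OF P(1), of x] J_D[OF P(1), of "x + N"] per_plus[OF pf, of x] that u by force
    show False
    proof (rule types[OF e(1)])
      fix v assume v: "Pre f e v"
      show False
      proof (cases "v \<le> u")
        case True
        then have "u = v + 1" "w = v + 1"
          using Pre_Pre[OF v e(1,2) c e(3)] Pre_Pre[OF v e(1,2) r e(4)] uw by auto
        then show False using P by simp
      next
        case False
        then have "v = u + 1" using Pre_Pre[OF c v e(1,2) not_sym[OF e(3)]] by auto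
        then show False using Pre_Pre[OF r v e(1,2) not_sym[OF e(4)]] P by auto
      qed
    next
      fix l assume l: "Suf f e l"
      have "l \<le> u + 2"
        using Pre_Suf[OF r l e(1,2) not_sym[OF e(4)]] Pre_Suf[OF c l e(1,2) not_sym[OF e(3)]] P(2) cr J_in(1)[of f c 1] J_in(1)[of f r 1]
        by auto
      show False
      proof (rule Pre_clear[OF c cr not_sym[OF e(3)] r(2) e(1) rcv_Pre[OF pf r(1)] rcv_Suf[OF pf l]])
        fix x assume "1 \<le> x" "x \<le> n" "f x = c"
        then show "1 \<le> x \<and> x \<le> w \<or> l \<le> x \<and> x \<le> n" using cI[of x] P(2) \<open>l \<le> u + 2\<close> by auto
      qed (use e in auto)
    next
      assume Q: "J f e (n + 1)"
      have u1: "u \<noteq> -1"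
      proof
        assume "u = -1"
        then have "u + 2 + n = n + 1" by simp
        then show False using J_in(2)[OF P(1)] J_in(1)[OF Q] e(3) by metis
      qed
      \<comment> \<open>The residue \<open>u + 2 = n\<close> is outside the range of
        \<open>rcv_Q\<close>; in this position, however, \<open>r\<close> would lie inside
        \<open>{1..n}\<close>.\<close>
      have u2: "u \<noteq> n - 2"
      proof
        assume u: "u = n - 2"
        have "u + 3 = n + 1" using u by simp
        then have "\<not> J f r (u + 3)" using J_in(1)[of f r "n + 1"] J_in(1)[OF Q] e(4) by metis
        then have ar: "arc f r (n - 1)" using P(3) u by auto
        have "arc f r n" unfolding arc_def
        proof (intro allI impI)
          fix x assume x: "n < x \<and> x < n + n + 2"
          show "f x \<noteq> r"
          proof (cases "x = 2 * n + 1")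
            case True
            then have "x = n + 1 + n" by simp
            then show ?thesis using J_in(2)[OF Q] e(4) by metis
          next
            case False then show ?thesis using arc_D[OF ar, of x] x by auto
          qed
        qed
        then show False using no_inside[OF r(2,3)] by blast
      qed
      show False
      proof (rule Pre_clear[OF c cr not_sym[OF e(3)] r(2) e(1) rcv_Pre[OF pf r(1)] rcv_Q[OF pf Q]])
        fix x assume "1 \<le> x" "x \<le> n" "f x = c"
        then show "1 \<le> x \<and> x \<le> w \<or> 2 \<le> x \<and> x \<le> n - 1" using cI[of x] P(2) u u1 u2 by auto
      qed (use e in auto)
    next
      fix q assume "K f e q"
      then show False using e by blast
    next
      assume "arc f e n"
      then show False using no_inside e by blast
    qed
  qed
  show False
  proof (cases "u \<le> w")
    case True then show ?thesis using main[OF c r cr e] by blast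
  next
    case False then show ?thesis using main[OF r c not_sym[OF cr] e(1,2,4,3,5)] by simp
  qed
qed

lemma Suf_Suf_other:
  assumes c: "Suf f c u" "c \<in> {1..k}" "c \<noteq> b" and r: "Suf f r w" "r \<in> {1..k}" "r \<noteq> b" and cr: "c \<noteq> r"
    and e: "e \<in> {1..k}" "e \<noteq> b" "e \<noteq> c" "e \<noteq> r" "\<And>q. \<not> K f e q"
  shows False
proof (rule bad.Pre_Pre_other[OF bad_refl Suf_refl[OF pf c(1)] c(2,3) Suf_refl[OF pf r(1)] r(2,3) cr e(1-4)])
  fix q show "\<not> K (\<lambda>x. f (n + 1 - x)) e q"
  proof
    assume "K (\<lambda>x. f (n + 1 - x)) e q"
    from K_refl[OF per_refl[OF pf] this] show False using e(5) by simp
  qed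
qed

text \<open>As \<open>e\<close> contains both \<open>n + 1\<close> and \<open>2 * n + 1\<close>, it
  is emptied on \<open>{0..n}\<close> instead of \<open>{1..n}\<close>, which leaves it only
  \<open>n + 1\<close>. The assumption \<open>nJ\<close> ensures that \<open>c\<close> can receive
  \<open>0\<close> as well, and \<open>J_drop2\<close> bounds the size of \<open>e\<close> and
  thereby the cost.\<close>

lemma Pre_Suf_Q_aux:
  assumes c: "Pre f c u" "c \<in> {1..k}" "c \<noteq> b" and d: "Suf f d l" "d \<in> {1..k}" "d \<noteq> b" and cd: "c \<noteq> d"
    and e: "e \<in> {1..k}" "e \<noteq> b" "e \<noteq> c" "e \<noteq> d" "J f e (n + 1)" and lu: "l \<le> u + 1" and nJ: "\<not> J f c n"
  shows False
proof -
  have rc: "rcv f c 0 u"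
  proof -
    have "u \<noteq> n - 2" if "J f c (u + 2)" using that nJ by auto
    then show ?thesis using c(1) unfolding Pre_def using rcv_arc[OF pf, of c u 0 u] rcv_J[OF pf, of c "u + 2" 0 u] by auto
  qed
  have u0: "0 \<le> u"
  proof (rule ccontr)
    assume "\<not> 0 \<le> u"
    then have "u = -1" "J f c (u + 2)" using c(1) unfolding Pre_def by auto
    then have "f (n + 1) = c" using J_in(2)[of f c 1] by (simp add: add.commute)
    then show False using J_in(1)[OF e(5)] e(3) by simp
  qed
  have "acc f c (n + 1 + n)" using rcv_acc[OF rc, of "n + 1 + n" "-1"] u0 by auto
  then have "h + cnt f e \<le> max 1 (min (n + 1) (2 * n - (n + 1)))"
    by (intro J_drop2[OF e(5,2) not_sym[OF e(3)] c(2)]) (use n4 in auto)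
  then have small: "cnt f e \<le> n - 1 - h" using n4 by auto
  have "0 \<le> n" "n < 0 + N" using n4 by auto
  note ad = this
  have "x = n + 1" if "n < x" "x < N" "f x = e" for x
    using J_D[OF e(5), of x] that n4 by force
  then have one: "{x \<in> {n<..<0 + N}. f x = e} = {n + 1}" using J_in[OF e(5)] n4 by force
  obtain g where g: "reach f g (int (card {x \<in> {0..n}. f x = e}))"
    "cnt g e = int (card {x \<in> {n<..<0 + N}. f x = e})" "\<And>x. 0 \<le> x \<Longrightarrow> x \<le> n \<Longrightarrow> g x \<noteq> e"
  proof (rule clear[OF f ad e(3,4) c(2) d(2) rc rcv_Suf[OF pf d(1)]])
    show "c = d \<Longrightarrow> 0 = l \<and> u = n" using cd by blast
    show "0 \<le> x \<and> x \<le> u \<or> l \<le> x \<and> x \<le> n" if "0 \<le> x" "x \<le> n" for x using that lu by linarith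
  qed (use that in blast)
  have "{x \<in> {0..<N}. f x = e} = {x \<in> {0..n}. f x = e} \<union> {x \<in> {n<..<0 + N}. f x = e}" using n4 by auto
  then have "{x \<in> {0..<N}. f x = e} = insert (n + 1) {x \<in> {0..n}. f x = e}" using one by auto
  moreover have "finite {x \<in> {0..n}. f x = e}" by (rule finite_subset[of _ "{0..n}"]) auto
  ultimately have s: "int (card {x \<in> {0..n}. f x = e}) = cnt f e - 1" unfolding cnt_def by (simp add: card_insert_disjoint)
  have pg: "per g" using col_per[OF reach_col(2)[OF g(1)]] .
  have "arc g e (2 * n)" unfolding arc_def
  proof (intro allI impI)
    fix x assume x: "2 * n < x \<and> x < 2 * n + n + 2"
    have "g (x - N) \<noteq> e" by (rule g(3)) (use x in auto)
    then show "g x \<noteq> e" using per_shift[OF pg, of x] by simp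
  qed
  moreover have "cnt f e - 1 + max 1 (min (2 * n) (2 * n - 2 * n)) \<le> h + 1 + cnt g e"
    using small g(2) one n4 by auto
  ultimately have "good b f" unfolding good_def using e g(1) s n4
    by (intro exI[of _ g] exI[of _ "cnt f e - 1"] exI[of _ e] exI[of _ "2 * n"]) auto
  then show False using ng by blast
qed

text \<open>The previous lemma and its mirror image force the bases \<open>n\<close> and
  \<open>n + 2\<close> for \<open>c\<close> and \<open>d\<close>. Then \<open>1\<close> has color
  \<open>d\<close>, and \<open>d\<close> and \<open>e\<close> together receive
  \<open>{2..n}\<close>, which empties \<open>c\<close>.\<close>

lemma Pre_Suf_Q:
  assumes c: "Pre f c u" "c \<in> {1..k}" "c \<noteq> b" and d: "Suf f d l" "d \<in> {1..k}" "d \<noteq> b" and cd: "c \<noteq> d"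
    and e: "e \<in> {1..k}" "e \<noteq> b" "e \<noteq> c" "e \<noteq> d" "J f e (n + 1)"
  shows False
proof -
  have "\<not> J f c 1" using J_in(2)[of f c 1] J_in(1)[OF e(5)] e(3) by (auto simp: add.commute)
  then have lu: "l \<le> u + 1" using Pre_Suf[OF c d cd] by blast
  have c1: "J f c n" using Pre_Suf_Q_aux[OF c d cd e lu] by blast
  have d1: "J f d (n + 2)"
  proof (rule ccontr)
    assume nd: "\<not> J f d (n + 2)"
    have "\<not> J (\<lambda>x. f (n + 1 - x)) d n"
    proof
      assume "J (\<lambda>x. f (n + 1 - x)) d n"
      from J_refl[OF per_refl[OF pf] this] have "J f d (1 - n)" by simp
      from J_shift[OF pf this, of 1] show False using nd by simp
    qed
    then show False
      using bad.Pre_Suf_Q_aux[OF bad_refl Suf_refl[OF pf d(1)] d(2,3) Pre_refl[OF pf c(1)] c(2,3) not_sym[OF cd] e(1,2,4,3) Q_refl[OF pf e(5)]] lu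
      by auto
  qed
  have s3: "3 + n - 1 = n + 2" by simp
  have Sd: "Suf f d 3" unfolding Suf_def s3 using d1 n4 by simp
  have Pc: "Pre f c (n - 2)" using c1 n4 unfolding Pre_def by simp
  have f1: "f 1 = d"
  proof -
    have e: "n + 2 + n = 1 + N" by simp
    show ?thesis using J_in(2)[OF d1, unfolded e] per_plus[OF pf, of 1] by (simp only:)
  qed
  show False
  proof (rule Pre_clear[OF Pc c(2,3) cd not_sym[OF e(3)] d(2) e(1) rcv_Suf[OF pf Sd] rcv_Q[OF pf e(5)]])
    fix x assume "1 \<le> x" "x \<le> n" "f x = c"
    then show "3 \<le> x \<and> x \<le> n \<or> 2 \<le> x \<and> x \<le> n - 1" using f1 cd n4 by (cases "x = 1"; cases "x = 2") auto
  qed (use e in auto)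
qed

text \<open>Each of the three classes is a \<open>Pre\<close>, a \<open>Suf\<close> or the
  \<open>J\<close> based at \<open>n + 1\<close>, and the last occurs at most once. So two of them
  are on the same side, or each kind occurs once.\<close>

lemma three_not_K:
  assumes c: "c \<in> {1..k}" "c \<noteq> b" "\<And>q. \<not> K f c q" and d: "d \<in> {1..k}" "d \<noteq> b" "\<And>q. \<not> K f d q"
    and e: "e \<in> {1..k}" "e \<noteq> b" "\<And>q. \<not> K f e q" and ne: "c \<noteq> d" "c \<noteq> e" "d \<noteq> e"
  shows False
proof -
  have ty: "(\<exists>u. Pre f a u) \<or> (\<exists>l. Suf f a l) \<or> J f a (n + 1)" if "a \<in> {1..k}" "a \<noteq> b" "\<And>q. \<not> K f a q" for a
    using types[OF that(1)] that no_inside by metis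
  have qq: False if "J f a (n + 1)" "J f a' (n + 1)" "a \<noteq> a'" for a a' using that J_in by metis
  from ty[OF c] ty[OF d] ty[OF e] show False
    using Pre_Pre_other[OF _ c(1,2) _ d(1,2) ne(1) e(1,2) not_sym[OF ne(2)] not_sym[OF ne(3)] e(3)]
      Pre_Pre_other[OF _ c(1,2) _ e(1,2) ne(2) d(1,2) not_sym[OF ne(1)] ne(3) d(3)]
      Pre_Pre_other[OF _ d(1,2) _ e(1,2) ne(3) c(1,2) ne(1) ne(2) c(3)]
      Suf_Suf_other[OF _ c(1,2) _ d(1,2) ne(1) e(1,2) not_sym[OF ne(2)] not_sym[OF ne(3)] e(3)]
      Suf_Suf_other[OF _ c(1,2) _ e(1,2) ne(2) d(1,2) not_sym[OF ne(1)] ne(3) d(3)]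
      Suf_Suf_other[OF _ d(1,2) _ e(1,2) ne(3) c(1,2) ne(1) ne(2) c(3)]
      qq[OF _ _ ne(1)] qq[OF _ _ ne(2)] qq[OF _ _ ne(3)]
      Pre_Suf_Q[OF _ c(1,2) _ d(1,2) ne(1) e(1,2) not_sym[OF ne(2)] not_sym[OF ne(3)]]
      Pre_Suf_Q[OF _ d(1,2) _ c(1,2) not_sym[OF ne(1)] e(1,2) not_sym[OF ne(3)] not_sym[OF ne(2)]]
      Pre_Suf_Q[OF _ c(1,2) _ e(1,2) ne(2) d(1,2) not_sym[OF ne(1)] ne(3)]
      Pre_Suf_Q[OF _ e(1,2) _ c(1,2) not_sym[OF ne(2)] d(1,2) ne(3) not_sym[OF ne(1)]]
      Pre_Suf_Q[OF _ d(1,2) _ e(1,2) ne(3) c(1,2) ne(1) ne(2)]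
      Pre_Suf_Q[OF _ e(1,2) _ d(1,2) not_sym[OF ne(3)] c(1,2) ne(2) ne(1)]
    by (elim disjE exE)
qed


section \<open>Triples next to classes of other shapes\<close>

lemma K_pos:
  assumes "K f a q"
  obtains v where "K f a v" "1 \<le> v" "v \<le> N"
proof -
  obtain j where "1 \<le> q + N * j" "q + N * j < 1 + N" by (rule window_rep)
  then show thesis using that[of "q + N * j"] K_shift[OF pf assms] by auto
qed

lemma K_low:
  assumes "K f a q" "1 \<le> q" "q \<le> N" "1 \<le> x" "x \<le> n" "f x = a"
  shows "x = q \<or> x = q - n - 1 \<or> x = q - n"
proof (cases "q < x")
  case True
  then show ?thesis using K_D[OF assms(1), of x] assms by force
next
  case False
  have "f (x + N) = a" using per_plus[OF pf, of x] assms by simp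
  then show ?thesis using K_D[OF assms(1), of "x + N"] assms False by (cases "x = q") force+
qed

text \<open>The ranges \<open>{1..u}\<close> of \<open>c\<close> and \<open>{2..n - 1}\<close> of
  \<open>e\<close> could miss only the residues \<open>1\<close> and \<open>n\<close> of the triple.
  The residue \<open>1\<close> occurs only for the base \<open>n + 2\<close>, and then
  \<open>1 \<le> u\<close>; the residue \<open>n\<close> is excluded by the color of
  \<open>n + 1\<close> and \<open>2 * n + 1\<close> and by \<open>bad_K\<close>.\<close>

lemma Pre_Q_K:
  assumes c: "Pre f c u" "c \<in> {1..k}" "c \<noteq> b" and e: "e \<in> {1..k}" "e \<noteq> b" "e \<noteq> c" "J f e (n + 1)"
    and a: "K f a q" "a \<noteq> b" "a \<in> {1..k}"
  shows False
proof -
  have ac: "a \<noteq> c" "a \<noteq> e" using a Pre_not_K[OF c(1)] J_not_K[OF pf e(4)] by blast+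
  obtain v where v: "K f a v" "1 \<le> v" "v \<le> N" using K_pos[OF a(1)] by blast
  have fe: "f (n + 1) = e" "f (2 * n + 1) = e"
  proof -
    have s: "n + 1 + n = 2 * n + 1" by simp
    show "f (n + 1) = e" "f (2 * n + 1) = e" using J_in[OF e(4), unfolded s] by blast+
  qed
  have "f 0 = e" using per_plus[OF pf, of 0] fe by simp
  have low: "x = v \<or> x = v - n - 1 \<or> x = v - n" if "1 \<le> x" "x \<le> n" "f x = a" for x
    using K_low[OF v that] .
  have v1: "v \<noteq> 1" using K_in(2)[OF v(1)] fe ac by (auto simp: add.commute)
  have vn: "v \<noteq> n"
  proof
    assume "v = n"
    then have "v + n + 1 = 2 * n + 1" by simp
    then show False using K_in(3)[OF v(1)] fe ac by metis
  qed
  have vq: "v \<noteq> n + 1" "v \<noteq> 2 * n + 1" using K_in(1)[OF v(1)] fe ac by auto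
  have v2n: "v \<noteq> 2 * n"
  proof
    assume v2: "v = 2 * n"
    have s: "v + n = n - 1 + N" "v + n + 1 = n + N" using v2 by auto
    have fn: "f (n - 1) = a" "f n = a"
      using K_in(2,3)[OF v(1), unfolded s] per_plus[OF pf, of "n - 1"] per_plus[OF pf, of n] by simp_all
    have "acc f c v"
    proof -
      consider "arc f c u" "0 \<le> u" "u \<le> n - 1" | "J f c (u + 2)" "-1 \<le> u" "u \<le> n - 2" using c(1) unfolding Pre_def by blast
      then show ?thesis
      proof cases
        case 1
        have "u \<noteq> n - 1"
        proof
          assume u: "u = n - 1"
          have "arc f c n" unfolding arc_def
          proof (intro allI impI)
            fix x assume x: "n < x \<and> x < n + n + 2"
            show "f x \<noteq> c"
            proof (cases "x = 2 * n + 1")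
              case True then show ?thesis using fe e by auto
            next
              case False then show ?thesis using arc_D[OF 1(1), of x] u x by auto
            qed
          qed
          then show False using no_inside c by blast
        qed
        then show ?thesis using acc_arc[OF pf 1(1), of v "-1"] 1 v2 by auto
      next
        case 2
        have "u + 2 \<noteq> n" "u + 2 \<noteq> n - 1" using J_in(1)[OF 2(1)] fn ac by metis+
        moreover have "u \<noteq> -1"
        proof
          assume "u = -1"
          then have "u + 2 + n = n + 1" by simp
          then show False using J_in(2)[OF 2(1)] fe e by metis
        qed
        ultimately show ?thesis using acc_J[OF pf 2(1), of v "-1"] 2 v2 by auto
      qed
    qed
    then show False using bad_K[OF v(1) a(2) not_sym[OF ac(1)] c(2)] by blast
  qed
  have u1: "1 \<le> u" if "v = n + 2"
  proof -
    consider "arc f c u" "0 \<le> u" "u \<le> n - 1" | "J f c (u + 2)" "-1 \<le> u" "u \<le> n - 2" using c(1) unfolding Pre_def by blast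
    then show ?thesis
    proof cases
      case 1
      then show ?thesis using bad_arc(2)[OF c(2,3) 1(1)] n4 by auto
    next
      case 2
      have "u \<noteq> -1"
      proof
        assume "u = -1"
        then have "u + 2 + n = n + 1" by simp
        then show False using J_in(2)[OF 2(1)] fe e by metis
      qed
      moreover have "u \<noteq> 0"
      proof
        assume "u = 0"
        then have "u + 2 + n = v" using that by simp
        then show False using J_in(2)[OF 2(1)] K_in(1)[OF v(1)] ac by metis
      qed
      ultimately show ?thesis using 2 by simp
    qed
  qed
  show False
  proof (rule K_clear[OF v(1) a(3,2) ac c(2) e(1) rcv_Pre[OF pf c(1)] rcv_Q[OF pf e(4)]])
    fix x assume x: "1 \<le> x" "x \<le> n" "f x = a"
    show "1 \<le> x \<and> x \<le> u \<or> 2 \<le> x \<and> x \<le> n - 1"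
    proof (cases "x = 1")
      case True
      then have "v = n + 2" using low[OF x] v v1 vq by auto
      then show ?thesis using u1 True by simp
    next
      case False
      have "x \<noteq> n" using low[OF x] vn v2n vq by auto
      then show ?thesis using False x by auto
    qed
  qed (use e fe ac in auto)
qed

lemma Suf_acc_mid:
  assumes d: "Suf f d l" and nJ: "\<not> J f d (n + 2)" "f (2 * n + 1) \<noteq> d"
  shows "acc f d (n + 1)"
proof -
  consider "arc f d (l + n - 1)" "2 \<le> l" "l \<le> n + 1" | "J f d (l + n - 1)" "3 \<le> l" "l \<le> n + 2" using d unfolding Suf_def by blast
  then show ?thesis
  proof cases
    case 1
    then show ?thesis using acc_arc[OF pf 1(1), of "n + 1" 0] by auto
  next
    case 2
    have "l + n - 1 \<noteq> n + 2" "l + n - 1 \<noteq> 2 * n + 1" using 2(1) nJ J_in(1) by metis+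
    then show ?thesis using acc_J[OF pf 2(1), of "n + 1" 0] 2 by auto
  qed
qed

lemma Pre_acc_mid:
  assumes c: "Pre f c u" and nJ: "\<not> J f c n" "f (n + 1) \<noteq> c"
  shows "acc f c (2 * n + 1)"
proof -
  consider "arc f c u" "0 \<le> u" "u \<le> n - 1" | "J f c (u + 2)" "-1 \<le> u" "u \<le> n - 2" using c unfolding Pre_def by blast
  then show ?thesis
  proof cases
    case 1
    then show ?thesis using acc_arc[OF pf 1(1), of "2 * n + 1" "-1"] by auto
  next
    case 2
    have "u + 2 \<noteq> n" using 2(1) nJ by metis
    moreover have "u + 2 + n \<noteq> n + 1" using J_in(2)[OF 2(1)] nJ by metis
    ultimately show ?thesis using acc_J[OF pf 2(1), of "2 * n + 1" "-1"] 2 by auto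
  qed
qed

text \<open>The two ranges cover \<open>{1..n}\<close>, so \<open>K_clear\<close> applies unless the
  triple contains \<open>n + 1\<close> and \<open>2 * n + 1\<close>. Then its base is one of these
  two and can be received by \<open>d\<close> or \<open>c\<close>, against
  \<open>bad_K\<close>.\<close>

lemma Pre_Suf_K:
  assumes c: "Pre f c u" "c \<in> {1..k}" "c \<noteq> b" and d: "Suf f d l" "d \<in> {1..k}" "d \<noteq> b" and cd: "c \<noteq> d"
    and lu: "l \<le> u + 1" and a: "K f a q" "a \<noteq> b" "a \<in> {1..k}"
  shows False
proof -
  have ac: "a \<noteq> c" "a \<noteq> d" using a Pre_not_K[OF c(1)] Suf_not_K[OF d(1)] by blast+
  obtain v where v: "K f a v" "1 \<le> v" "v \<le> N" using K_pos[OF a(1)] by blast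
  have "f (n + 1) \<noteq> a \<or> f (2 * n + 1) \<noteq> a"
  proof (rule ccontr)
    assume "\<not> ?thesis"
    then have fa: "f (n + 1) = a" "f (2 * n + 1) = a" by auto
    have "v = n + 1 \<or> v = 2 * n + 1"
    proof (rule ccontr)
      assume *: "\<not> ?thesis"
      consider "v < n + 1" | "n + 1 < v" "v < 2 * n + 1" using * v by linarith
      then show False
        using K_D[OF v(1), of "n + 1"] K_D[OF v(1), of "2 * n + 1"] fa v(2) n4 by cases force+
    qed
    then show False
    proof
      assume v1: "v = n + 1"
      have s: "n + 2 + n = v + n + 1" using v1 by simp
      have "\<not> J f d (n + 2)" using J_in(2)[of f d "n + 2", unfolded s] K_in(3)[OF v(1)] ac by auto
      then have "acc f d v" using Suf_acc_mid[OF d(1)] fa ac v1 by auto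
      then show False using bad_K[OF v(1) a(2) not_sym[OF ac(2)] d(2)] by blast
    next
      assume v1: "v = 2 * n + 1"
      have s: "v + n = n + N" using v1 by simp
      have "\<not> J f c n" using J_in(1)[of f c n] K_in(2)[OF v(1), unfolded s] per_plus[OF pf, of n] ac by auto
      then have "acc f c v" using Pre_acc_mid[OF c(1)] fa ac v1 by auto
      then show False using bad_K[OF v(1) a(2) not_sym[OF ac(1)] c(2)] by blast
    qed
  qed
  then show False
    using K_clear[OF v(1) a(3,2) ac c(2) d(2) rcv_Pre[OF pf c(1)] rcv_Suf[OF pf d(1)]] cd lu by force
qed

lemma blocked:
  assumes a: "K f a q" "a \<noteq> b" and K: "K f a' q'" and r: "f x = r" "\<And>q. \<not> K f r q"
  shows "\<not> acc f r q'"
proof -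
  have rk: "r \<in> {1..k}" using kf r by blast
  have "r \<noteq> a'" using K r by blast
  then show ?thesis using bad_K[OF K _ _ rk] bad_K_b[OF _ _ rk r(2) a] K by blast
qed

text \<open>All bases lie in the gap of \<open>c\<close>, and the residues of this gap, except
  \<open>p + 1\<close> if \<open>d\<close> is based there, have color \<open>b\<close> or are bases.
  This run is long enough for \<open>K_run\<close> unless \<open>n = 4\<close>; there, one move to
  \<open>b\<close> makes \<open>d\<close> or \<open>c\<close> short enough for
  \<open>bad_short\<close>.\<close>

lemma J_adjacent:
  assumes c: "J f c p" "c \<noteq> b" and d: "J f d (p + 1) \<or> arc f d (p - 1)" "d \<in> {1..k}" "d \<noteq> b" and cd: "c \<noteq> d"
    and a: "K f a q" "a \<noteq> b" and all: "\<And>x. f x \<noteq> b \<Longrightarrow> f x \<noteq> c \<Longrightarrow> f x \<noteq> d \<Longrightarrow> \<exists>q. K f (f x) q"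
  shows False
proof -
  have ck: "c \<in> {1..k}" using J_in(1)[OF c(1)] kf by metis
  have cK: "\<not> K f c q" for q using J_not_K[OF pf c(1)] .
  have dK: "\<not> K f d q" for q using d(1) J_not_K[OF pf] arc_not_K[OF pf] by blast
  have nc: "f z \<noteq> c" if "p < z" "z < p + n" for z using J_D[OF c(1), of z] that n4 by force
  have gapc: "\<exists>j. p < q + N * j \<and> q + N * j < p + n" if "K f a q" for a q
    using K_gap_J[OF pf c(1) that blocked[OF a that J_in(1)[OF c(1)] cK]] by blast
  have base: "K f (f z) z" if "p < z" "z < p + n" "K f (f z) q" for z q
    using gapc[OF that(3)] K_base[OF pf that(3) _ _ that(1,2)] by blast
  define x where "x = (if J f d (p + 1) then p + 2 else p + 1)"
  have x: "p + 1 \<le> x" "x \<le> p + 2" unfolding x_def by auto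
  have nd: "f z \<noteq> d" if "x \<le> z" "z < p + n" for z
  proof (cases "J f d (p + 1)")
    case True then show ?thesis using J_D[OF True, of z] that n4 unfolding x_def by force
  next
    case False then show ?thesis using arc_D[of f d "p - 1" z] d(1) that unfolding x_def by auto
  qed
  have H: "f z = b \<or> (\<exists>c. K f c z)" if "x \<le> z" "z \<le> p + n - 1" for z
    using all[of z] nc[of z] nd[of z] base[of z] that x by force
  obtain j where j: "p < q + N * j" "q + N * j < p + n" using gapc[OF a(1)] by blast
  define v where "v = q + N * j"
  have v: "K f a v" "p < v" "v < p + n" using K_shift[OF pf a(1)] j unfolding v_def by auto
  have ad: "a \<noteq> d" using dK a by blast
  have vx: "x \<le> v"
  proof (cases "J f d (p + 1)")
    case True
    then have "v \<noteq> p + 1" using J_in(1)[OF True] K_in(1)[OF v(1)] ad by metis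
    then show ?thesis using v unfolding x_def by auto
  next
    case False then show ?thesis using v unfolding x_def by auto
  qed
  show False
  proof (cases "(\<exists>z. f z = b) \<and> (\<forall>q. \<not> K f b q)")
    case False
    have "\<exists>c. K f c z" if "x \<le> z" "z \<le> p + n - 1" for z
      using H[OF that] False base[of z] that x by force
    from this[of x] this[of "x + 1"] show False using K_adjacent[OF pf] x n4 by force
  next
    case True
    then have bK: "\<not> K f b q" for q by blast
    have nab: "\<not> acc f b q" if "K f a q" for a q using blocked[OF a that _ bK] True by blast
    show False
    proof (cases "x + 2 \<le> p + n - 1")
      case True
      show False by (rule K_run[OF f True H bK v(1) vx _ nab[OF v(1)]]) (use v in auto)
    next
      case False
      then have n: "n = 4" and xp: "x = p + 2" using x n4 by linarith+
      have dJ: "J f d (p + 1)" using xp unfolding x_def by (auto split: if_splits)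
      have bk: "b \<in> {1..k}" using True kf by metis
      note nb = K_neighbour[OF f v(1) a(2) bK nab[OF v(1)]]
      consider "v = p + 2" | "v = p + 3" using v vx n xp by linarith
      then show False
      proof cases
        case 1
        have "\<not> K f c' (v + 1)" for c' using K_adjacent[OF pf v(1)] by blast
        then have "f (v + 1) = b" using H[of "v + 1"] 1 n xp by auto
        then have bJ: "J f b (p - 1)" using nb(2) 1 n by simp
        have ac: "acc f b (p + 5)" using acc_J[OF pf bJ, of "p + 5" "-1"] n by auto
        have fd: "f (p + 5) = d" using J_in(2)[OF dJ] n by (simp add: add.commute)
        show False
        proof (rule bad_short[OF acc_move[OF f bk ac] d(2,3), of "p + 1"])
          show "1 \<le> cnt (upd f (p + 5) b) d" using cnt_upd[OF pf fd] J_two[OF dJ] d(3) by auto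
          fix y assume y: "p + 1 + 1 < y" "y < p + 1 + N"
          have u: "upd f (p + 5) b y = (if y = p + 5 then b else f y)" using upd_window[of "p + 1" y "p + 5"] y n by auto
          have "f (p + 7) = a" using K_in(3)[OF v(1)] 1 n by (simp add: add.commute)
          moreover have "f (p + 8) = b" using J_in(1)[OF bJ] per_plus[OF pf, of "p - 1"] n by (simp add: add.commute)
          ultimately show "upd f (p + 5) b y \<noteq> d" using u J_D[OF dJ, of y] y n ad d(3) a(2)
            by (cases "y = p + 5"; cases "y = p + 7"; cases "y = p + 8") auto
        qed
      next
        case 2
        have "\<not> K f c' (v - 1)" for c' using K_adjacent[OF pf, of c' "v - 1" a] v(1) by auto
        then have "f (v - 1) = b" using H[of "v - 1"] 2 n xp by auto
        moreover have "v - 1 = p + 2" using 2 by simp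
        ultimately have bJ: "J f b (p + 2)" using nb(1) by metis
        have ac: "acc f b p" using acc_J[OF pf bJ, of p 0] n by auto
        have aca: "a \<noteq> c" using a cK by blast
        show False
        proof (rule bad_short[OF acc_move[OF f bk ac] ck c(2), of "p + 4"])
          show "1 \<le> cnt (upd f p b) c" using cnt_upd[OF pf J_in(1)[OF c(1)]] J_two[OF c(1)] c(2) by auto
          fix y assume y: "p + 4 + 1 < y" "y < p + 4 + N"
          have f6: "f (p + 6) = b" using J_in(2)[OF bJ] n by (simp add: add.commute)
          have f7: "f (p + 7) = a" using K_in(2)[OF v(1)] 2 n by (simp add: add.commute)
          have w: "upd f p b z \<noteq> c" if "p \<le> z" "z < p + N" "z \<noteq> p + 4" for z
          proof -
            have u: "upd f p b z = (if z = p then b else f z)" using upd_window[of p z p] that n by auto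
            show ?thesis using u J_D[OF c(1), of z] that n f6 f7 c(2) aca
              by (cases "z = p"; cases "z = p + 6"; cases "z = p + 7") auto
          qed
          show "upd f p b y \<noteq> c"
          proof (cases "y < p + N")
            case True then show ?thesis using w[of y] y by auto
          next
            case False
            then show ?thesis using w[of "y - N"] y n per_shift[OF upd_per[OF pf], of p b y] by auto
          qed
        qed
      qed
    qed
  qed
qed

lemma Pre_Pre_K:
  assumes c: "Pre f c u" "c \<in> {1..k}" "c \<noteq> b" and r: "Pre f r w" "r \<in> {1..k}" "r \<noteq> b" and cr: "c \<noteq> r"
    and a: "K f a q" "a \<noteq> b"
  shows False
proof -
  have main: False if c: "Pre f c u" "c \<in> {1..k}" "c \<noteq> b" and r: "Pre f r w" "r \<in> {1..k}" "r \<noteq> b" and cr: "c \<noteq> r"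
    and uw: "u \<le> w" for c u r w
  proof -
    have P: "J f c (u + 2)" "J f r (u + 3) \<or> arc f r (u + 1)" using Pre_Pre[OF c r cr uw] by auto
    have e: "u + 2 + 1 = u + 3" "u + 2 - 1 = u + 1" by auto
    show False
    proof (rule J_adjacent[OF P(1) c(3) _ r(2,3) cr a])
      show "J f r (u + 2 + 1) \<or> arc f r (u + 2 - 1)" using P(2) unfolding e .
      fix x assume x: "f x \<noteq> b" "f x \<noteq> c" "f x \<noteq> r"
      show "\<exists>q. K f (f x) q"
      proof (rule ccontr)
        assume "\<nexists>q. K f (f x) q"
        then show False using Pre_Pre_other[OF c r cr kf x] by blast
      qed
    qed
  qed
  show False
  proof (cases "u \<le> w")
    case True then show ?thesis using main[OF c r cr] by blast
  next
    case False then show ?thesis using main[OF r c not_sym[OF cr]] by simp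
  qed
qed

lemma two_not_K:
  assumes c: "c \<in> {1..k}" "c \<noteq> b" "\<And>q. \<not> K f c q" and d: "d \<in> {1..k}" "d \<noteq> b" "\<And>q. \<not> K f d q" and cd: "c \<noteq> d"
    and a: "K f a q" "a \<noteq> b" "a \<in> {1..k}"
  shows False
proof -
  have ty: "(\<exists>u. Pre f a u) \<or> (\<exists>l. Suf f a l) \<or> J f a (n + 1)" if "a \<in> {1..k}" "a \<noteq> b" "\<And>q. \<not> K f a q" for a
    using types[OF that(1)] that no_inside by metis
  have nonK: False if "f x \<noteq> b" "f x \<noteq> c" "f x \<noteq> d" "\<nexists>q. K f (f x) q" for x
    using three_not_K[OF c d kf that(1) _ cd] that by metis
  note Ka = K_refl[OF pf a(1)]
  have PS: False if P: "Pre f c u" "Suf f d l" and c: "c \<in> {1..k}" "c \<noteq> b" and d: "d \<in> {1..k}" "d \<noteq> b" and cd: "c \<noteq> d"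
    and oth: "\<And>x. f x \<noteq> b \<Longrightarrow> f x \<noteq> c \<Longrightarrow> f x \<noteq> d \<Longrightarrow> \<exists>q. K f (f x) q" for c d u l
  proof (cases "l \<le> u + 1")
    case True
    then show False using Pre_Suf_K[OF P(1) c P(2) d cd _ a] by blast
  next
    case False
    then have j: "J f c 1" "J f d (2 * n + 1)" using Pre_Suf[OF P(1) c P(2) d cd] by auto
    \<comment> \<open>The exceptional pair of \<open>Pre_Suf\<close> has the adjacent bases
      \<open>0\<close> and \<open>1\<close>.\<close>
    have "2 * n + 1 + N * (-1) = 0" by simp
    then have "J f d 0" using J_shift[OF pf j(2), of "-1"] by simp
    then show False using J_adjacent[of d 0 c a q] j(1) d c cd a oth by auto
  qed
  have qq: False if "J f a (n + 1)" "J f a' (n + 1)" "a \<noteq> a'" for a a' using that J_in by metis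
  from ty[OF c] ty[OF d] show False
  proof (elim disjE exE)
    fix u w assume "Suf f c u" "Suf f d w"
    then show False
      using bad.Pre_Pre_K[OF bad_refl Suf_refl[OF pf] c(1,2) Suf_refl[OF pf] d(1,2) cd Ka a(2)] by blast
  next
    fix u assume "Suf f c u" "J f d (n + 1)"
    then show False
      using bad.Pre_Q_K[OF bad_refl Suf_refl[OF pf] c(1,2) d(1,2) not_sym[OF cd] Q_refl[OF pf] Ka a(2,3)] by blast
  next
    fix u assume "J f c (n + 1)" "Suf f d u"
    then show False
      using bad.Pre_Q_K[OF bad_refl Suf_refl[OF pf] d(1,2) c(1,2) cd Q_refl[OF pf] Ka a(2,3)] by blast
  qed (use Pre_Pre_K[OF _ c(1,2) _ d(1,2) cd a(1,2)] Pre_Q_K[OF _ c(1,2) d(1,2) not_sym[OF cd] _ a]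
       Pre_Q_K[OF _ d(1,2) c(1,2) cd _ a] PS[OF _ _ c(1,2) d(1,2) cd] PS[OF _ _ d(1,2) c(1,2) not_sym[OF cd]] nonK qq cd in blast)+
qed

text \<open>If a triple of a color other than \<open>b\<close> exists, \<open>K_two\<close> for
  \<open>c\<close> and \<open>b\<close> yields a color \<open>f x\<close> that is no triple and
  differs from \<open>b\<close>. By \<open>two_not_K\<close> it is the only such color, so
  \<open>K_two\<close> for \<open>f x\<close> and \<open>b\<close> is contradictory. If no such
  triple exists, \<open>k4\<close> gives three colors for \<open>three_not_K\<close>.\<close>

lemma all_K:
  assumes c: "c \<in> {1..k}"
  shows "\<exists>q. K f c q"
proof (rule ccontr)
  assume cK: "\<nexists>q. K f c q"
  show False
  proof (cases "\<exists>a q. K f a q \<and> a \<noteq> b")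
    case True
    then obtain a q where a: "K f a q" "a \<noteq> b" by blast
    have ak: "a \<in> {1..k}" using K_in(1)[OF a(1)] kf by metis
    have K2: False if d: "d \<in> {1..k}" "\<And>q. \<not> K f d q" "\<And>x. f x \<noteq> d \<Longrightarrow> f x \<noteq> b \<Longrightarrow> \<exists>q. K f (f x) q" for d
    proof (rule K_two[OF f d(2,3) a(1)])
      show "\<not> acc f r q'" if "K f a' q'" "f x = r" "\<And>q. \<not> K f r q" for a' q' r x
        using blocked[OF a that] .
    qed (use ne[OF d(1)] in auto)
    have "\<exists>x. f x \<noteq> c \<and> f x \<noteq> b \<and> (\<nexists>q. K f (f x) q)" using K2[OF c] cK by blast
    then obtain x where x: "f x \<noteq> b" "\<And>q. \<not> K f (f x) q" by blast
    have "\<exists>q. K f (f y) q" if "f y \<noteq> f x" "f y \<noteq> b" for y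
    proof (rule ccontr)
      assume "\<nexists>q. K f (f y) q"
      then show False using two_not_K[OF kf x kf that(2) _ not_sym[OF that(1)] a ak] by blast
    qed
    then show False using K2[OF kf x(2)] by blast
  next
    case False
    obtain c1 where 1: "c1 \<in> {1..k}" "c1 \<noteq> b" using color_avoid by blast
    obtain c2 where 2: "c2 \<in> {1..k}" "c2 \<noteq> b" "c2 \<noteq> c1" using color_avoid by blast
    obtain c3 where 3: "c3 \<in> {1..k}" "c3 \<noteq> b" "c3 \<noteq> c1" "c3 \<noteq> c2" using color_avoid by blast
    show False using three_not_K[OF 1 _ 2(1,2) _ 3(1,2)] False 1 2 3 by metis
  qed
qed

end

lemma (in circ_params) good_or_K:
  assumes "col f" "\<And>c. c \<in> {1..k} \<Longrightarrow> \<exists>x. f x = c" "c \<in> {1..k}" "\<nexists>q. K f c q"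
  shows "good b f"
proof (rule ccontr)
  assume "\<not> good b f"
  then interpret bad n k f b by unfold_locales (use assms in auto)
  show False using all_K assms by blast
qed

context circ_params
begin

section \<open>Connecting two colorings\<close>

lemma nonK_ex:
  assumes f: "col f" and k: "3 * int k \<noteq> N"
  obtains c where "c \<in> {1..k}" "\<nexists>q. K f c q"
proof (rule ccontr)
  note * = that
  assume no: "\<not> thesis"
  have "\<exists>q. K f c q" if "c \<in> {1..k}" for c using no * that by blast
  then have c3: "card {x \<in> {0..<N}. f x = c} = 3" if "c \<in> {1..k}" for c
    using that K_cnt[OF col_per[OF f]] unfolding cnt_def by fastforce
  have "{0..<N} = (\<Union>c\<in>{1..k}. {x \<in> {0..<N}. f x = c})"
    using f unfolding col_def by auto
  then have "card {0..<N} = card (\<Union>c\<in>{1..k}. {x \<in> {0..<N}. f x = c})" by (rule arg_cong)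
  also have "\<dots> = (\<Sum>c\<in>{1..k}. card {x \<in> {0..<N}. f x = c})"
    by (rule card_UN_disjoint) (auto intro: finite_subset[of _ "{0..<N}"])
  also have "\<dots> = (\<Sum>c\<in>{1..k}. 3)" by (rule sum.cong) (use c3 in auto)
  also have "\<dots> = 3 * k" by simp
  finally show False using k n4 by simp
qed

text \<open>The step saved here pays for the term \<open>1\<close> in the bound of \<open>good\<close>.\<close>

definition lead :: "(int \<Rightarrow> nat) \<Rightarrow> bool" where
  "lead f \<longleftrightarrow> (\<exists>g s c e. c \<in> {1..k} \<and> reach f g s \<and> arc g c e \<and> s + 1 \<le> cnt g c)"

text \<open>The class left is only as large as the number of steps spent, one short of
  \<open>lead\<close>; its free position makes up for this.\<close>

definition single :: "(int \<Rightarrow> nat) \<Rightarrow> nat \<Rightarrow> bool" where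
  "single f c \<longleftrightarrow> c \<in> {1..k} \<and> (\<exists>g x. reach f g 1 \<and> g x = c \<and> (\<forall>y. x < y \<and> y < x + N \<longrightarrow> g y \<noteq> c))"

text \<open>In the positions left out the two classes would share a residue.\<close>

lemma J_apart:
  assumes f: "per f" and c: "J f c p" and d: "J f d q" and cd: "c \<noteq> d" and q: "p \<le> q" "q < p + N"
  shows "q = p + 1 \<or> q = p + 2 * n \<or> p + 2 \<le> q \<and> q \<le> p + n - 1 \<or> p + n + 2 \<le> q \<and> q \<le> p + 2 * n - 1"
proof -
  have "q \<noteq> p" "q \<noteq> p + n" using J_in[OF c] J_in[OF d] cd by auto
  moreover have "q \<noteq> p + n + 1"
  proof
    assume "q = p + n + 1"
    then have "q + n = p + N" by simp
    then have "f p = d" using J_in(2)[OF d] per_plus[OF f, of p] by metis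
    then show False using J_in(1)[OF c] cd by simp
  qed
  ultimately show ?thesis using q by linarith
qed

text \<open>The residue \<open>p\<close> can move to \<open>d\<close>, and \<open>q + n\<close> can
  move to \<open>c\<close>; each move leaves a class in an arc. If one of the classes has three
  residues, this is a \<open>lead\<close>; otherwise both have two and become singletons.\<close>

lemma J_pair:
  assumes f: "col f" and c: "c \<in> {1..k}" "J f c p" and d: "d \<in> {1..k}" "J f d q" and cd: "c \<noteq> d"
    and q: "p + 2 \<le> q" "q \<le> p + n - 1"
  shows "lead f \<or> single f c \<and> single f d"
proof -
  have pf: "per f" using col_per[OF f] .
  have "acc f d p" by (rule acc_J[OF pf d(2), of _ 0]) (use q in auto)
  then have m1: "reach f (upd f p d) 1" using acc_move f d by blast
  have "acc f c (q + n)" by (rule acc_J[OF pf c(2), of _ "-1"]) (use q in auto)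
  then have m2: "reach f (upd f (q + n) c) 1" using acc_move f c by blast
  have n1: "cnt (upd f p d) c = cnt f c - 1" using cnt_upd[OF pf J_in(1)[OF c(2)]] cd by metis
  have n2: "cnt (upd f (q + n) c) d = cnt f d - 1" using cnt_upd[OF pf J_in(2)[OF d(2)]] cd by metis
  have w: "y = p + n \<or> p + n + 2 \<le> y \<and> y \<le> p + 2 * n - 1" if "p < y" "y < p + N" "f y = c" for y
    using J_D[OF c(2) that] .
  have sh: "upd f (p + N) d = upd f p d" using upd_shift[of f p 1 d] by simp
  have a1: "arc (upd f p d) c (p + 2 * n - 1)"
  proof (rule upd_arc[OF pf cd[symmetric], where x = "p + N", unfolded sh])
    fix y assume y: "p + 2 * n - 1 < y" "y < p + 2 * n - 1 + n + 2" "y \<noteq> p + N"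
    have "f (y - N) = f y" using per_shift[OF pf] .
    then show "f y \<noteq> c" using w[of y] w[of "y - N"] y n4 by (cases "y < p + N") force+
  qed (use cd n4 in auto)
  have a2: "arc (upd f (q + n) c) d q"
  proof (rule upd_arc[OF pf cd])
    fix y assume y: "q < y" "y < q + n + 2" "y \<noteq> q + n"
    then show "f y \<noteq> d" using J_D[OF d(2), of y] n4 by force
  qed (use n4 in auto)
  show ?thesis
  proof (cases "3 \<le> cnt f c \<or> 3 \<le> cnt f d")
    case True
    then show ?thesis
    proof
      assume "3 \<le> cnt f c"
      then have "(1::int) + 1 \<le> cnt (upd f p d) c" using n1 by linarith
      then show ?thesis unfolding lead_def using c m1 a1 by blast
    next
      assume "3 \<le> cnt f d"
      then have "(1::int) + 1 \<le> cnt (upd f (q + n) c) d" using n2 by linarith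
      then show ?thesis unfolding lead_def using d m2 a2 by blast
    qed
  next
    case False
    have two: "y = u \<or> y = u + n" if u: "J f t u" "cnt f t < 3" and y: "u \<le> y" "y < u + N" "f y = t" for t u y
    proof (rule ccontr)
      assume "\<not> ?thesis"
      then have "card {u, u + n, y} = 3" using n4 by auto
      moreover have "card {u, u + n, y} \<le> card {x \<in> {u..<u + N}. f x = t}"
        by (rule card_mono) (use J_in[OF u(1)] y n4 in \<open>auto intro: finite_subset[of _ "{u..<u + N}"]\<close>)
      ultimately show False using cnt_window[OF pf, of t u] u(2) by linarith
    qed
    have "single f c" unfolding single_def
    proof (intro conjI exI allI impI)
      show "reach f (upd f p d) 1" by (rule m1)
      show "upd f p d (p + n) = c" using upd_window[of p "p + n" p f d] J_in[OF c(2)] n4 by simp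
      fix y assume y: "p + n < y \<and> y < p + n + N"
      have u: "upd f p d y = (if y = p + N then d else f y)"
        using upd_window[of "p + n + 1" y "p + N" f d] y n4 unfolding sh by simp
      have "y = p + N" if "f y = c"
      proof (cases "y < p + N")
        case True
        then show ?thesis using two[OF c(2), of y] that y False n4 by force
      next
        case ge: False
        have "f (y - N) = c" using per_shift[OF pf, of y] that by (simp only:)
        then have "y - N = p \<or> y - N = p + n" using two[OF c(2), of "y - N"] ge y False by linarith
        then show ?thesis using y by linarith
      qed
      then show "upd f p d y \<noteq> c" unfolding u using cd by auto
    qed (use c in auto)
    moreover have "single f d" unfolding single_def
    proof (intro conjI exI allI impI)
      show "reach f (upd f (q + n) c) 1" by (rule m2)
      show "upd f (q + n) c q = d" using upd_window[of q q "q + n" f c] J_in[OF d(2)] n4 by simp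
      fix y assume y: "q < y \<and> y < q + N"
      have "upd f (q + n) c y = (if y = q + n then c else f y)"
        using upd_window[of q y "q + n" f c] y n4 by simp
      then show "upd f (q + n) c y \<noteq> d" using two[OF d(2), of y] y False cd by auto
    qed (use d in auto)
    ultimately show ?thesis by blast
  qed
qed

text \<open>Suppose that both alternatives fail. Then no class lies in an arc and no base of a
  triple can be received, so \<open>K_two\<close> yields three classes of the form \<open>J\<close>.
  By \<open>J_pair\<close> their bases are pairwise adjacent on the circle, which is impossible for
  three residues.\<close>

lemma lead_or_single:
  assumes f: "col f" and ne: "\<And>c. c \<in> {1..k} \<Longrightarrow> \<exists>x. f x = c" and d: "d \<in> {1..k}" "\<nexists>q. K f d q"
  shows "lead f \<or> (\<exists>c d. c \<noteq> d \<and> single f c \<and> single f d)"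
proof (rule ccontr)
  assume no: "\<not> ?thesis"
  have pf: "per f" using col_per[OF f] .
  have rng: "f x \<in> {1..k}" for x using f unfolding col_def by blast
  have na: "\<not> arc f c e" if "c \<in> {1..k}" for c e
  proof
    assume "arc f c e"
    moreover have "(0::int) + 1 \<le> cnt f c" using ne[OF that] cnt_pos[OF pf] by force
    ultimately show False using no that reach_refl[OF f] unfolding lead_def by blast
  qed
  have J: "\<exists>p. J f c p" if "c \<in> {1..k}" "\<nexists>q. K f c q" for c
    using class_cases[OF f, of c thesis] na that by (metis class_cases[OF f])
  have bl: "\<not> acc f r q" if q: "K f a q" and r: "f x = r" "\<And>q. \<not> K f r q" for a q r x
  proof
    assume A: "acc f r q"
    have ra: "r \<noteq> a" using q r by metis
    have "reach f (upd f q r) 1" using acc_move[OF f _ A] rng r by blast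
    moreover have "arc (upd f q r) a (q + n + 1)"
    proof -
      have sh: "upd f (q + N) r = upd f q r" using upd_shift[of f q 1 r] by simp
      show ?thesis
      proof (rule upd_arc[OF pf ra, where x = "q + N", unfolded sh])
        fix y assume y: "q + n + 1 < y" "y < q + n + 1 + n + 2" "y \<noteq> q + N"
        have "f (y - N) = f y" using per_shift[OF pf] .
        then show "f y \<noteq> a" using K_D[OF q, of y] K_D[OF q, of "y - N"] y n4 by (cases "y < q + N") force+
      qed (use n4 in auto)
    qed
    moreover have "(1::int) + 1 \<le> cnt (upd f q r) a"
      using cnt_upd[OF pf K_in(1)[OF q] ra] K_cnt[OF pf q] by linarith
    moreover have "a \<in> {1..k}" using rng[of q] K_in(1)[OF q] by simp
    ultimately show False using no unfolding lead_def by blast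
  qed
  have three: "\<exists>c\<in>{1..k}. c \<noteq> d \<and> c \<noteq> e \<and> (\<nexists>q. K f c q)" for e
  proof (cases "\<exists>a q. K f a q")
    case True
    then obtain a q where a: "K f a q" by blast
    show ?thesis
    proof (rule ccontr)
      assume N3: "\<not> ?thesis"
      show False
      proof (rule K_two[OF f _ _ a bl])
        show "\<not> K f d q" for q using d by blast
        show "\<exists>q. K f (f x) q" if "f x \<noteq> d" "f x \<noteq> e" for x using N3 that rng by blast
        show "\<exists>x. f x = d" using ne d by blast
      qed
    qed
  next
    case False
    then show ?thesis using color_avoid[of d e e] by blast
  qed
  obtain e where e: "e \<in> {1..k}" "e \<noteq> d" "\<nexists>q. K f e q" using three[of d] by blast
  obtain c where c: "c \<in> {1..k}" "c \<noteq> d" "c \<noteq> e" "\<nexists>q. K f c q" using three[of e] by blast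
  have apart: "q' = p + 1 \<or> q' = p + 2 * n"
    if c: "J f c p" "c \<in> {1..k}" and d: "J f d q'" "d \<in> {1..k}" and cd: "c \<noteq> d" and q: "p \<le> q'" "q' < p + N" for c d p q'
  proof -
    have "\<not> (p + 2 \<le> q' \<and> q' \<le> p + n - 1)" using J_pair[OF f c(2,1) d(2,1) cd] no cd by blast
    moreover have "\<not> (p + n + 2 \<le> q' \<and> q' \<le> p + 2 * n - 1)"
    proof
      assume r: "p + n + 2 \<le> q' \<and> q' \<le> p + 2 * n - 1"
      have "J f c (p + N)" using J_shift[OF pf c(1), of 1] by simp
      then show False using J_pair[OF f d(2,1) c(2), of "p + N"] r no cd by force
    qed
    ultimately show ?thesis using J_apart[OF pf c(1) d(1) cd q] by blast
  qed
  obtain p where p: "J f d p" using J d by blast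
  obtain q where q: "J f e q" "p \<le> q" "q < p + N"
    using J[OF e(1,3)] J_shift[OF pf] window_rep by metis
  obtain r where r: "J f c r" "p \<le> r" "r < p + N"
    using J[OF c(1,4)] J_shift[OF pf] window_rep by metis
  have Q: "q = p + 1 \<or> q = p + 2 * n" by (rule apart[OF p d(1) q(1) e(1) _ q(2,3)]) (use e in blast)
  have R: "r = p + 1 \<or> r = p + 2 * n" by (rule apart[OF p d(1) r(1) c(1) _ r(2,3)]) (use c in blast)
  have "q \<noteq> r" using J_in(1)[OF q(1)] J_in(1)[OF r(1)] c by metis
  moreover have False if "J f e q" "J f c r" "q = p + 1" "r = p + 2 * n" "e \<in> {1..k}" "c \<in> {1..k}" "e \<noteq> c" for e c q r
    using apart[OF that(1,5,2,6,7)] that(3,4) n4 by linarith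
  ultimately show False using Q R q r e c by metis
qed

lemma short_arc:
  assumes f: "col f" and k: "3 * int k \<noteq> N"
  obtains g s c e where "c \<in> {1..k}" "reach f g s" "arc g c e" "s \<le> cnt g c"
proof (cases "\<exists>c\<in>{1..k}. \<forall>x. f x \<noteq> c")
  case True
  then obtain c where c: "c \<in> {1..k}" "\<And>x. f x \<noteq> c" by blast
  have "arc f c 0" using c unfolding arc_def by blast
  then show thesis using that[OF c(1) reach_refl[OF f order_refl]] cnt_nonneg by blast
next
  case False
  obtain d where d: "d \<in> {1..k}" "\<nexists>q. K f d q" using nonK_ex[OF f k] .
  from lead_or_single[OF f _ d] False consider "lead f" | c where "single f c" by blast
  then show thesis
  proof cases
    case 1
    then obtain g s c e where "c \<in> {1..k}" "reach f g s" "arc g c e" "s + 1 \<le> cnt g c" unfolding lead_def by blast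
    then show thesis using that by force
  next
    case 2
    then obtain g x where g: "c \<in> {1..k}" "reach f g 1" "g x = c" "\<And>y. x < y \<Longrightarrow> y < x + N \<Longrightarrow> g y \<noteq> c"
      unfolding single_def by blast
    have "arc g c x" unfolding arc_def using g(4) n4 by auto
    moreover have "1 \<le> cnt g c" using cnt_pos[OF col_per[OF reach_col(2)[OF g(2)]] g(3)] .
    ultimately show thesis using that g by blast
  qed
qed

lemma arc_win:
  assumes f: "per f" and a: "arc f c e" and x: "e - n + 1 \<le> x" "x < e - n + 1 + N" "f x = c"
  shows "x \<le> e"
  using arc_D[OF a, of x] x by force

text \<open>The arc of the empty class can be chosen to suit the other coloring: the same arc for
  equal colors, a disjoint one otherwise. As no overlap is paid for, \<open>s \<le> cnt g' c\<close>
  is enough.\<close>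

lemma reach_empty:
  assumes f: "col f" and b: "b \<in> {1..k}" "\<And>x. f x \<noteq> b" and g: "col g" and k: "3 * int k \<noteq> N"
  shows "reach f g (2 * N + h)"
proof -
  obtain g' s c e where g': "c \<in> {1..k}" "reach g g' s" "arc g' c e" "s \<le> cnt g' c"
    using short_arc[OF g k] .
  note cg = reach_col(2)[OF g'(2)]
  have w: "x \<le> e" if "e - n + 1 \<le> x" "x < e - n + 1 + N" "g' x = c" for x
    using arc_win[OF col_per[OF cg] g'(3) that] .
  have "reach f g' (2 * N + 1 - cnt g' c)"
  proof (cases "c = b")
    case True
    have "reach f g' (2 * N + 1 - cnt f b - cnt g' b)"
      by (rule meet_same[OF f cg b(1), of "e - n + 1"]) (use b w True in force)+
    then show ?thesis by (rule reach_mono) (use cnt_nonneg[of f b] True in simp)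
  next
    case False
    have "reach f g' (2 * N + max 1 (n - n) - cnt f b - cnt g' c)"
      by (rule meet[OF f cg _ b(1) g'(1), of n "e - 2 * n + 1"]) (use b w False n4 in force)+
    then show ?thesis by (rule reach_mono) (use cnt_nonneg[of f b] in simp)
  qed
  from reach_trans[OF this reach_sym[OF g'(2)]] show ?thesis
    by (rule reach_mono) (use g'(4) n4 in linarith)
qed

text \<open>A translation moves the arc of \<open>b\<close> to \<open>{1..n}\<close>, to which
  \<open>good\<close> refers. Beyond \<open>2 * N\<close>, the coloring \<open>g\<close> then
  contributes at most \<open>h + 1\<close> and \<open>f\<close> at most \<open>-1\<close>.\<close>

lemma reach_lead:
  assumes f: "lead f" and g: "col g" "\<And>c. c \<in> {1..k} \<Longrightarrow> \<exists>x. g x = c" and k: "3 * int k \<noteq> N"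
  shows "reach f g (2 * N + h)"
proof -
  obtain f' s b e0 where f': "b \<in> {1..k}" "reach f f' s" "arc f' b e0" "s + 1 \<le> cnt f' b"
    using f unfolding lead_def by blast
  define F where "F x = f' (x + (e0 - n))" for x
  define G where "G x = g (x + (e0 - n))" for x
  have rF: "reach (\<lambda>x. f (x + (e0 - n))) F s" unfolding F_def by (rule reach_shift[OF f'(2)])
  have aF: "arc F b n" using f'(3) unfolding arc_def F_def by auto
  have cF: "cnt F b = cnt f' b" unfolding F_def by (rule cnt_shift[OF col_per[OF reach_col(2)[OF f'(2)]]])
  have G: "col G" unfolding G_def by (rule col_shift[OF g(1)])
  have neG: "\<exists>x. G x = c" if c: "c \<in> {1..k}" for c
  proof -
    obtain x where "g x = c" using g(2)[OF c] by blast
    then have "G (x - (e0 - n)) = c" unfolding G_def by simp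
    then show ?thesis by blast
  qed
  obtain d where d: "d \<in> {1..k}" "\<nexists>q. K G d q" using nonK_ex[OF G k] .
  have "good b G" by (rule good_or_K[OF G neG d])
  then obtain G' t c e where G': "c \<in> {1..k}" "c \<noteq> b" "reach G G' t" "arc G' c e" "0 \<le> e" "e \<le> 2 * n" "e \<noteq> n"
     "t + max 1 (min e (2 * n - e)) \<le> h + 1 + cnt G' c" unfolding good_def by blast
  have "reach F G' (2 * N + max 1 (min e (2 * n - e)) - cnt F b - cnt G' c)"
    by (rule arc_meet[OF reach_col(2)[OF rF] reach_col(2)[OF G'(3)] _ f'(1) G'(1) aF G'(4-7)]) (use G'(2) in blast)
  from reach_trans[OF reach_trans[OF rF this] reach_sym[OF G'(3)]]
  have "reach (\<lambda>x. f (x + (e0 - n))) G (2 * N + h)"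
    by (rule reach_mono) (use G'(8) f'(4) cF in linarith)
  from reach_shift[OF this, of "n - e0"] show ?thesis unfolding G_def by simp
qed

text \<open>A singleton may be put anywhere in its arc. For different residues the arcs can be
  disjoint; for the same residue one arc ends and the other begins there.\<close>

lemma reach_single:
  assumes f: "single f c" and g: "single g d" and cd: "c \<noteq> d"
  shows "reach f g (2 * N + 1)"
proof -
  obtain f' x where f': "c \<in> {1..k}" "reach f f' 1" "f' x = c" "\<And>y. x < y \<Longrightarrow> y < x + N \<Longrightarrow> f' y \<noteq> c"
    using f unfolding single_def by blast
  obtain g' y0 where g': "d \<in> {1..k}" "reach g g' 1" "g' y0 = d" "\<And>y. y0 < y \<Longrightarrow> y < y0 + N \<Longrightarrow> g' y \<noteq> d"
    using g unfolding single_def by blast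
  note cf = reach_col(2)[OF f'(2)]
  note cg = reach_col(2)[OF g'(2)]
  have pf: "per f'" and pg: "per g'" using cf cg col_per by auto
  obtain j where j: "x \<le> y0 + N * j" "y0 + N * j < x + N" by (rule window_rep)
  define y where "y = y0 + N * j"
  have gy: "g' z \<noteq> d" if "y < z" "z < y + N" for z
    using g'(4)[of "z + N * (- j)"] per_mult[OF pg, of z "- j"] that unfolding y_def by auto
  have cnts: "1 \<le> cnt f' c" "1 \<le> cnt g' d" using cnt_pos pf pg f'(3) g'(3) by auto
  have fl: "f' z \<noteq> c" if "z < x" "x - N < z" for z
    using f'(4)[of "z + N"] per_plus[OF pf, of z] that by force
  have gl: "g' z \<noteq> d" if "z < y" "y - N < z" for z
    using gy[of "z + N"] per_plus[OF pg, of z] that by force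
  have ff: "z = x" if "f' z = c" "x - N < z" "z < x + N" for z
    using f'(4)[of z] fl[of z] that by (cases z x rule: linorder_cases) auto
  have gg: "z = y" if "g' z = d" "y - N < z" "z < y + N" for z
    using gy[of z] gl[of z] that by (cases z y rule: linorder_cases) auto
  have dist: "reach f' g' (2 * N - 1)"
  proof -
    consider "x + 1 \<le> y" "y \<le> x + n" | "y = x" | "x + n + 1 \<le> y" "y \<le> x + 2 * n" using j unfolding y_def by linarith
    then show ?thesis
    proof cases
      case 1
      have "reach f' g' (2 * N + max 1 (n - n) - cnt f' c - cnt g' d)"
      proof (rule meet[OF cf cg cd f'(1) g'(1), of n "x - n + 1"])
        fix z assume "x - n + 1 \<le> z" "z < x - n + 1 + N" "f' z = c"
        then show "z \<le> x - n + 1 + n - 1" using ff[of z] f'(4)[of z] n4 by force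
      next
        fix z assume z: "x - n + 1 + n \<le> z" "z < x - n + 1 + n + N" "g' z = d"
        then have "z = y" using gg[of z] 1 gy[of z] by force
        then show "z \<le> x - n + 1 + n + n - 1" using 1 by simp
      qed (use n4 in auto)
      then show ?thesis by (rule reach_mono) (use cnts in simp)
    next
      case 2
      have "reach f' g' (2 * N + max 1 (n - (n - 1)) - cnt f' c - cnt g' d)"
      proof (rule meet[OF cf cg cd f'(1) g'(1), of "n - 1" "x - n + 1"])
        fix z assume "x - n + 1 \<le> z" "z < x - n + 1 + N" "f' z = c"
        then show "z \<le> x - n + 1 + n - 1" using ff[of z] f'(4)[of z] n4 by force
      next
        fix z assume z: "x - n + 1 + (n - 1) \<le> z" "z < x - n + 1 + (n - 1) + N" "g' z = d"
        then have "z = y" using gg[of z] 2 by force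
        then show "z \<le> x - n + 1 + (n - 1) + n - 1" using 2 n4 by simp
      qed (use n4 in auto)
      then show ?thesis by (rule reach_mono) (use cnts in simp)
    next
      case 3
      have "reach g' f' (2 * N + max 1 (n - n) - cnt g' d - cnt f' c)"
      proof (rule meet[OF cg cf cd[symmetric] g'(1) f'(1), of n "y - n + 1"])
        fix z assume "y - n + 1 \<le> z" "z < y - n + 1 + N" "g' z = d"
        then show "z \<le> y - n + 1 + n - 1" using gg[of z] gy[of z] n4 by force
      next
        fix z assume z: "y - n + 1 + n \<le> z" "z < y - n + 1 + n + N" "f' z = c"
        have "f' (z - N) = c" using per_shift[OF pf, of z] z by simp
        then have "z = x + N" using ff[of "z - N"] z 3 f'(4)[of z] n4 by force
        then show "z \<le> y - n + 1 + n + n - 1" using 3 by simp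
      qed (use n4 in auto)
      then have "reach f' g' (2 * N + max 1 (n - n) - cnt g' d - cnt f' c)" by (rule reach_sym)
      then show ?thesis by (rule reach_mono) (use cnts in simp)
    qed
  qed
  from reach_trans[OF reach_trans[OF f'(2) dist] reach_sym[OF g'(2)]] show ?thesis
    by (rule reach_mono) simp
qed

theorem reach_all:
  assumes f: "col f" and g: "col g" and k: "3 * int k \<noteq> N"
  shows "reach f g (2 * N + h)"
proof (cases "(\<exists>c\<in>{1..k}. \<forall>x. f x \<noteq> c) \<or> (\<exists>c\<in>{1..k}. \<forall>x. g x \<noteq> c)")
  case True
  then show ?thesis using reach_empty[OF f _ _ g k] reach_sym[OF reach_empty[OF g _ _ f k]] by blast
next
  case False
  then have ne: "\<And>c. c \<in> {1..k} \<Longrightarrow> \<exists>x. f x = c" "\<And>c. c \<in> {1..k} \<Longrightarrow> \<exists>x. g x = c" by blast+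
  obtain a a' where a: "a \<in> {1..k}" "\<nexists>q. K f a q" and a': "a' \<in> {1..k}" "\<nexists>q. K g a' q"
    using nonK_ex[OF f k] nonK_ex[OF g k] by metis
  \<comment> \<open>Having two singletons for \<open>f\<close> allows a choice whose color differs
    from that of the singleton for \<open>g\<close>.\<close>
  from lead_or_single[OF f ne(1) a] lead_or_single[OF g ne(2) a']
  consider "lead f" | "lead g" | c c' d where "c \<noteq> c'" "single f c" "single f c'" "single g d" by blast
  then show ?thesis
  proof cases
    case 1
    then show ?thesis using reach_lead[OF _ g ne(2) k] by blast
  next
    case 2
    then show ?thesis using reach_sym[OF reach_lead[OF _ f ne(1) k]] by blast
  next
    case 3
    then have "reach f g (2 * N + 1)" using reach_single by (metis)
    then show ?thesis by (rule reach_mono) (use n4 in linarith)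
  qed
qed


section \<open>The dicoloring graph\<close>

text \<open>The gap \<open>n + 1\<close> stands for the arcs from \<open>a\<close> to
  \<open>a - n\<close>.\<close>

definition beats :: "int \<Rightarrow> int \<Rightarrow> bool" where
  "beats x y \<longleftrightarrow> (\<exists>g. (1 \<le> g \<and> g \<le> n - 1 \<or> g = n + 1) \<and> y mod N = (x + g) mod N)"

lemma beats_irrefl: "\<not> beats x x"
proof
  assume "beats x x"
  then obtain g where g0: "1 \<le> g \<and> g \<le> n - 1 \<or> g = n + 1" and e: "x mod N = (x + g) mod N" unfolding beats_def by blast
  have g: "1 \<le> g" "g \<le> n + 1" using g0 n4 by auto
  have "N dvd x + g - x" using e by (metis mod_eq_dvd_iff)
  then show False using dvd_window[of "x + g" x x] g n4 by simp
qed

text \<open>Two gaps that do not close a triangle add up to an allowed gap; twice the gap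
  \<open>n + 1\<close> wraps around to the gap \<open>1\<close>.\<close>

lemma beats_trans:
  assumes f: "col f" and xy: "beats x y" and yz: "beats y z" and c: "f x = c" "f y = c" "f z = c"
  shows "beats x z"
proof -
  obtain g where g: "1 \<le> g \<and> g \<le> n - 1 \<or> g = n + 1" "y mod N = (x + g) mod N" using xy unfolding beats_def by blast
  obtain g' where g': "1 \<le> g' \<and> g' \<le> n - 1 \<or> g' = n + 1" "z mod N = (y + g') mod N" using yz unfolding beats_def by blast
  have "(y + g') mod N = (x + g + g') mod N" using mod_add_cong[OF g(2) refl[of "g' mod N"]] .
  then have z: "z mod N = (x + (g + g')) mod N" using g'(2) by (simp only: add.assoc)
  have fy: "f (x + g) = c" using per_cong[OF col_per[OF f] g(2)] c by simp
  have fz: "f (x + (g + g')) = c" using per_cong[OF col_per[OF f] z] c by simp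
  have "\<not> tri x (x + g) (x + (g + g'))" using tri_no[OF f _ c(1) fy fz] by blast
  then have "1 \<le> g + g' \<and> g + g' \<le> n - 1 \<or> g + g' = n + 1 \<or> g = n + 1 \<and> g' = n + 1"
    using g(1) g'(1) n4 unfolding tri_def by linarith
  moreover have ?thesis if "g = n + 1" "g' = n + 1"
  proof -
    have "x + (g + g') = x + 1 + N" using that by simp
    then have "z mod N = (x + 1) mod N" using z by (metis mod_add_self2)
    then show ?thesis unfolding beats_def using n4 by (intro exI[of _ 1]) simp
  qed
  ultimately show ?thesis unfolding beats_def using z by blast
qed

section \<open>Walks in the tournament and in the dicoloring graph\<close>

abbreviation T :: "(int, int \<times> int) pre_digraph" where "T \<equiv> circ_tournament (nat n)"

lemma T_verts: "verts T = {0..<N}"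
  using n4 by (simp add: circ_tournament_def)

lemma T_ends: "tail T = fst" "head T = snd"
  by (simp_all add: circ_tournament_def)

lemma T_arcs: "(a, b) \<in> arcs T \<longleftrightarrow> a \<in> {0..<N} \<and> b \<in> {0..<N} \<and> beats a b"
proof -
  have e: "(a - n) mod N = (a + (n + 1)) mod N"
    using mod_add_self2[of "a - n" N] by (simp add: algebra_simps)
  have "(a, b) \<in> arcs T \<longleftrightarrow> a \<in> {0..<N} \<and> ((\<exists>j. 1 \<le> j \<and> j \<le> n - 1 \<and> b = (a + j) mod N) \<or> b = (a - n) mod N)"
    using n4 by (auto simp: circ_tournament_def)
  moreover have "b = w mod N \<longleftrightarrow> b \<in> {0..<N} \<and> b mod N = w mod N" for w
    using mod_N[of w] by (auto simp: mod_pos_pos_trivial)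
  ultimately show ?thesis unfolding beats_def e by blast
qed

text \<open>By transitivity a nonempty walk inside a class collapses to a single arc, so a cycle
  would make a vertex beat itself. This lifts the absence of triangles to the absence of
  cycles.\<close>

lemma walk_beats:
  assumes f: "col f"
  shows "p \<noteq> [] \<Longrightarrow> set p \<subseteq> arcs (T \<restriction> {x \<in> verts T. f x = c}) \<Longrightarrow>
    pre_digraph.cas (T \<restriction> {x \<in> verts T. f x = c}) u p v \<Longrightarrow> beats u v \<and> f u = c \<and> f v = c"
proof (induction p arbitrary: u)
  case (Cons e p)
  obtain a b where e: "e = (a, b)" by (cases e)
  have ab: "beats a b" "f a = c" "f b = c" "a = u"
    using Cons.prems unfolding e by (auto simp: pre_digraph.cas.simps T_ends T_arcs)
  show ?case
  proof (cases "p = []")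
    case True
    then show ?thesis using Cons.prems ab unfolding e by (auto simp: pre_digraph.cas.simps T_ends)
  next
    case False
    then have "beats b v \<and> f b = c \<and> f v = c"
      using Cons.prems Cons.IH[of b] unfolding e by (auto simp: pre_digraph.cas.simps T_ends)
    then show ?thesis using ab beats_trans[OF f ab(1)] by blast
  qed
qed simp

lemma col_dicoloring:
  assumes f: "col f"
  shows "restrict f (verts T) \<in> dicolorings k T"
proof -
  have "acyclic_digraph (T \<restriction> {x \<in> verts T. restrict f (verts T) x = c})" for c
  proof -
    have S: "{x \<in> verts T. restrict f (verts T) x = c} = {x \<in> verts T. f x = c}" by auto
    show ?thesis
      unfolding S acyclic_digraph_def pre_digraph.cycle_def pre_digraph.awalk_def
      using walk_beats[OF f] beats_irrefl by blast
  qed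
  then show ?thesis using f unfolding dicolorings_def col_def by auto
qed

lemma dicoloring_col:
  assumes a: "\<alpha> \<in> dicolorings k T"
  shows "col (\<lambda>x. \<alpha> (x mod N))"
  unfolding col_def
proof (intro conjI allI)
  show "per (\<lambda>x. \<alpha> (x mod N))" unfolding per_def by (simp only: mod_add_self2 simp_thms)
  have m: "x mod N \<in> verts T" for x using mod_N[of x] unfolding T_verts by simp
  show rng: "\<alpha> (x mod N) \<in> {1..k}" for x
    using a m[of x] unfolding dicolorings_def by blast
  show "acy (\<lambda>x. \<alpha> (x mod N) = c)" for c
    unfolding acy_def
  proof (intro allI impI notI)
    fix x y z assume t: "tri x y z" and c: "\<alpha> (x mod N) = c \<and> \<alpha> (y mod N) = c \<and> \<alpha> (z mod N) = c"
    let ?D = "T \<restriction> {x \<in> verts T. \<alpha> x = c}"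
    have ac: "acyclic_digraph ?D" using a rng[of x] c unfolding dicolorings_def by auto
    have dm: "beats (u mod N) (v mod N)" if "1 \<le> v - u \<and> v - u \<le> n - 1 \<or> v - u = n + 1" for u v
      unfolding beats_def using that by (intro exI[of _ "v - u"]) (simp add: mod_add_left_eq)
    have "beats (x mod N) (y mod N)" "beats (y mod N) (z mod N)" "beats (z mod N) ((x + N) mod N)"
      by (rule dm; use t in \<open>auto simp: tri_def\<close>)+
    then have d: "beats (x mod N) (y mod N)" "beats (y mod N) (z mod N)" "beats (z mod N) (x mod N)"
      by (simp_all only: mod_add_self2)
    have ne: "u mod N \<noteq> v mod N" if "x \<le> u" "u < v" "v < x + N" for u v
      using dvd_window[of v u x] that by (auto simp: mod_eq_dvd_iff dvd_diff_commute)
    have "x mod N \<noteq> y mod N" "y mod N \<noteq> z mod N" "x mod N \<noteq> z mod N"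
      by (rule ne; use t in \<open>auto simp: tri_def\<close>)+
    then have "pre_digraph.cycle ?D [(x mod N, y mod N), (y mod N, z mod N), (z mod N, x mod N)]"
      unfolding pre_digraph.cycle_def pre_digraph.awalk_def
      using d c m by (intro exI[of _ "x mod N"])
        (auto simp: pre_digraph.cas.simps pre_digraph.awalk_verts.simps T_ends T_arcs T_verts)
    then show False using ac unfolding acyclic_digraph_def by blast
  qed
qed

lemma adj_arc:
  assumes a: "adj f g"
  shows "(restrict f (verts T), restrict g (verts T)) \<in> arcs (dicoloring_graph k T)"
proof -
  have c: "col f" "col g" using adj_col[OF a] by auto
  obtain x where x: "f x \<noteq> g x" "\<And>y. f y \<noteq> g y \<Longrightarrow> N dvd y - x" using a unfolding adj_def by blast
  have "\<exists>!y. y \<in> verts T \<and> restrict f (verts T) y \<noteq> restrict g (verts T) y"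
  proof (rule ex1I[of _ "x mod N"])
    have "f (x mod N) \<noteq> g (x mod N)" using x(1) per_mod[OF col_per] c by metis
    then show "x mod N \<in> verts T \<and> restrict f (verts T) (x mod N) \<noteq> restrict g (verts T) (x mod N)"
      using mod_N[of x] unfolding T_verts by simp
    fix y assume y: "y \<in> verts T \<and> restrict f (verts T) y \<noteq> restrict g (verts T) y"
    then have "N dvd y - x" using x(2) by auto
    then have "y mod N = x mod N" by (simp only: mod_eq_dvd_iff)
    then show "y = x mod N" using y unfolding T_verts by (simp add: mod_pos_pos_trivial)
  qed
  then show ?thesis using col_dicoloring c by (simp add: dicoloring_graph_def)
qed

lemma adj_pow_walk:
  "(adj ^^ i) f g \<Longrightarrow> col f \<Longrightarrow>
    \<exists>p. pre_digraph.awalk (dicoloring_graph k T) (restrict f (verts T)) p (restrict g (verts T)) \<and> length p = i"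
proof (induction i arbitrary: f)
  interpret D: wf_digraph "dicoloring_graph k T" by (rule dicoloring_graph_wf)
  case 0
  have "f = g" using 0 by simp
  moreover have "D.awalk (restrict g (verts T)) [] (restrict g (verts T))"
    using col_dicoloring[of g] 0 unfolding D.awalk_Nil_iff by (simp add: dicoloring_graph_def)
  ultimately show ?case by (intro exI[of _ "[]"]) (simp only: list.size simp_thms)
next
  interpret D: wf_digraph "dicoloring_graph k T" by (rule dicoloring_graph_wf)
  case (Suc i)
  obtain u where u: "adj f u" "(adj ^^ i) u g" using relpowp_Suc_D2[OF Suc.prems(1)] by blast
  obtain p where p: "D.awalk (restrict u (verts T)) p (restrict g (verts T))" "length p = i"
    using Suc.IH[OF u(2)] adj_col[OF u(1)] by blast
  have "D.awalk (restrict f (verts T)) ((restrict f (verts T), restrict u (verts T)) # p) (restrict g (verts T))"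
    using adj_arc[OF u(1)] p(1) by (simp add: D.awalk_Cons_iff) (simp add: dicoloring_graph_def)
  then show ?case using p(2) by (metis length_Cons)
qed

text \<open>Three arcs of \<open>n\<close>, \<open>n\<close> and \<open>1\<close> residues.
  Connectedness of the dicoloring graph requires that it has a vertex.\<close>

lemma col_ex: "\<exists>f. col f"
proof -
  define f :: "int \<Rightarrow> nat" where "f = ext 0 (\<lambda>x. if x < n then 1 else if x < 2 * n then 2 else 3)"
  have w: "f x = (if x < n then 1 else if x < 2 * n then 2 else 3)" if "0 \<le> x" "x < 0 + N" for x
    unfolding f_def by (rule ext_window[OF that])
  have p: "per (\<lambda>x. f x = c)" for c unfolding f_def by (rule per_eq[OF ext_per])
  have "acy (\<lambda>x. f x = c)" for c
  proof -
    define l where "l = (if c = 1 then 0 else if c = 2 then n else 2 * n)"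
    show ?thesis
    proof (rule arc_acy_w[OF p, of 0 l "l + n - 1"])
      fix x assume x: "0 \<le> x" "x < 0 + N" "f x = c"
      have "(if x < n then 1 else if x < 2 * n then 2 else 3) = c" using w[OF x(1,2)] x(3) by simp
      then show "l \<le> x \<and> x \<le> l + n - 1"
        using x(1,2) n4 unfolding l_def by (auto split: if_splits)
    qed (use n4 in \<open>auto simp: l_def\<close>)
  qed
  moreover have "f x \<in> {1..k}" for x unfolding f_def by (rule ext_range) (use k4 in auto)
  ultimately have "col f" unfolding col_def f_def using ext_per by blast
  then show ?thesis by blast
qed

lemma dicoloring_walk:
  assumes k: "3 * int k \<noteq> N" and a: "\<alpha> \<in> dicolorings k T" and b: "\<beta> \<in> dicolorings k T"
  shows "\<exists>p. pre_digraph.awalk (dicoloring_graph k T) \<alpha> p \<beta> \<and> int (length p) \<le> 2 * N + h"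
proof -
  obtain i where i: "int i \<le> 2 * N + h" "(adj ^^ i) (\<lambda>x. \<alpha> (x mod N)) (\<lambda>x. \<beta> (x mod N))"
    using reach_all[OF dicoloring_col[OF a] dicoloring_col[OF b] k] unfolding reach_def by blast
  have e: "restrict (\<lambda>x. \<gamma> (x mod N)) (verts T) = \<gamma>" if "\<gamma> \<in> dicolorings k T" for \<gamma>
  proof (rule HOL.ext)
    fix x
    show "restrict (\<lambda>x. \<gamma> (x mod N)) (verts T) x = \<gamma> x"
    proof (cases "x \<in> verts T")
      case True
      then show ?thesis unfolding T_verts by (simp add: mod_pos_pos_trivial)
    next
      case False
      moreover have "\<gamma> \<in> extensional (verts T)" using that unfolding dicolorings_def by (simp add: PiE_def)
      ultimately show ?thesis by (simp add: extensional_def)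
    qed
  qed
  show ?thesis using adj_pow_walk[OF i(2) dicoloring_col[OF a]] i(1) unfolding e[OF a] e[OF b] by metis
qed

end

theorem theorem6:
  fixes n k :: nat
  assumes "n \<ge> 4" and "k \<ge> 4" and "real k \<noteq> (2 * real n + 1) / 3"
  shows "Digraph_Component.connected (dicoloring_graph k (circ_tournament n)) \<and>
    diameter (dicoloring_graph k (circ_tournament n))
      \<le> ereal (real (4 * n + 2 + nat \<lfloor>real n / 2\<rfloor>))"
proof -
  interpret circ_params "int n" k by unfold_locales (use assms in auto)
  let ?G = "dicoloring_graph k (circ_tournament n)"
  interpret G: wf_digraph ?G by (rule dicoloring_graph_wf)
  have "3 * real k \<noteq> 2 * real n + 1" using assms(3) by simp
  then have "3 * int k \<noteq> 2 * int n + 1" by linarith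
  moreover have "nat \<lfloor>real n / 2\<rfloor> = n div 2"
    by (metis floor_divide_of_nat_eq nat_int of_nat_numeral)
  ultimately have walk: "\<exists>p. G.awalk \<alpha> p \<beta> \<and> length p \<le> 4 * n + 2 + nat \<lfloor>real n / 2\<rfloor>"
    if "\<alpha> \<in> verts ?G" "\<beta> \<in> verts ?G" for \<alpha> \<beta>
    using dicoloring_walk[of \<alpha> \<beta>] that by (fastforce simp: dicoloring_graph_def)
  have "verts ?G \<noteq> {}"
    using col_ex col_dicoloring by (auto simp: dicoloring_graph_def)
  then have "Digraph_Component.connected ?G"
    unfolding connected_def using walk G.reachable_awalk G.reachable_mk_symmetricI
    by (intro strongly_connectedI) (simp, metis pverts_mk_symmetric with_proj_simps(1))
  moreover have "diameter ?G \<le> ereal (real (4 * n + 2 + nat \<lfloor>real n / 2\<rfloor>))"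
    using walk diameter_le_iff[OF dicoloring_graph_wf] by blast
  ultimately show ?thesis by blast
qed

end
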